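(* Let $n\ge 1$. For $1<p<\infty$ there is a constant $C_p$ (independent of $h$) such that for all $h>0$ $$\|m_h^{[n]}\|_{\mathcal{M}_p}\le C_p.$$ For $p=1,\infty$ there is a constant $C$ (independent of $h$) such that for all $h>0$ $$\|m_h^{[n]}\|_{\mathcal{M}_1}=\|m_h^{[n]}\|_{\mathcal{M}_\infty}\le C\,(1+|\log h|)^n.$$
   Context: For $h>0$ and $\xi\in\mathbb{R}^n$, $$m_h^{[n]}(\xi):=\frac{\exp(-\frac14|\xi|^2)}{\sum_{j\in\mathbb{Z}^n}\exp\left(-\frac14\left|\xi-\frac{2\pi j}{h}\right|^2\right)}.$$ The Fourier transform is $\widehat f(\xi)=\int_{\mathbb{R}^n}f(x)e^{-i\langle \xi,x\rangle}\,dx$, with inverse $f^\vee(x)=(2\pi)^{-n}\int_{\mathbb{R}^n} f(\xi)e^{i\langle x,\xi\rangle}\,d\xi$. For a multiplier $m:\mathbb{R}^n\to\mathbb{C}$, which maps $f$ to $(\widehat f\cdot m)^\vee$, the $L_p\to L_p$ operator norm is $$\|m\|_{\mathcal{M}_p}:=\sup_{\|f\|_{L_p(\mathbb{R}^n)}=1}\left\|\left(\widehat f\cdot m\right)^\vee\right\|_{L_p(\mathbb{R}^n)}.$$ (Equivalently here, the operator is convolution with $(m_h^{[n]})^\vee$.) *)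

theory Defs
  imports "HOL-Probability.Essential_Supremum"
begin

section \<open>Lebesgue norms\<close>

text \<open>
  Exponents range over \<open>[1, \<infinity>]\<close>, represented in \<^typ>\<open>ennreal\<close>; functions are complex-valued.
  The norm is meaningful for measurable functions only.
\<close>

definition Lp_norm :: "ennreal \<Rightarrow> ('a::euclidean_space \<Rightarrow> complex) \<Rightarrow> ennreal" where
  "Lp_norm p f =
     (if p = \<infinity> then esssup lborel (\<lambda>x. ennreal (norm (f x)))
      else let I = (\<integral>\<^sup>+x. ennreal (norm (f x) powr enn2real p) \<partial>lborel)
           in if I = \<infinity> then \<infinity> else ennreal (enn2real I powr (1 / enn2real p)))"

definition Lp_space :: "ennreal \<Rightarrow> ('a::euclidean_space \<Rightarrow> complex) set" where
  "Lp_space p = {f \<in> borel_measurable lborel. Lp_norm p f < \<infinity>}"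

section \<open>Schwartz functions\<close>

fun iterated_partial ::
    "'a::euclidean_space list \<Rightarrow> ('a \<Rightarrow> complex) \<Rightarrow> 'a \<Rightarrow> complex" where
  "iterated_partial [] f = f"
| "iterated_partial (b # bs) f =
     (\<lambda>x. frechet_derivative (iterated_partial bs f) (at x) b)"

text \<open>
  Total differentiability of all iterated partial derivatives is the same as smoothness.
\<close>

definition schwartz :: "('a::euclidean_space \<Rightarrow> complex) \<Rightarrow> bool" where
  "schwartz f \<longleftrightarrow>
     (\<forall>bs. set bs \<subseteq> Basis \<longrightarrow>
        (\<forall>x. iterated_partial bs f differentiable (at x)) \<and>
        (\<forall>k::nat. bounded (range (\<lambda>x. norm x ^ k * norm (iterated_partial bs f x)))))"

section \<open>Fourier transform\<close>

definition fourier :: "('a::euclidean_space \<Rightarrow> complex) \<Rightarrow> 'a \<Rightarrow> complex" where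
  "fourier f \<xi> = (\<integral>x. f x * cis (- (\<xi> \<bullet> x)) \<partial>lborel)"

definition inv_fourier :: "('a::euclidean_space \<Rightarrow> complex) \<Rightarrow> 'a \<Rightarrow> complex" where
  "inv_fourier f x =
     complex_of_real (1 / (2 * pi) ^ DIM('a)) * (\<integral>\<xi>. f \<xi> * cis (x \<bullet> \<xi>) \<partial>lborel)"

text \<open>
  For \<open>f\<close> in \<open>L\<^sub>p\<close> the transform of \<open>f\<close> is in general (in particular for \<open>p = \<infinity>\<close>) only a tempered
  distribution, so the operations are extended to distributions by duality. Distributions
  are represented by functionals of which only the values on Schwartz functions matter.
\<close>

type_synonym 'a functional = "('a \<Rightarrow> complex) \<Rightarrow> complex"

definition regular_dist :: "('a::euclidean_space \<Rightarrow> complex) \<Rightarrow> 'a functional" where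
  "regular_dist f = (\<lambda>\<phi>. \<integral>x. f x * \<phi> x \<partial>lborel)"

definition dist_fourier :: "'a::euclidean_space functional \<Rightarrow> 'a functional" where
  "dist_fourier T = (\<lambda>\<phi>. T (fourier \<phi>))"

definition dist_inv_fourier :: "'a::euclidean_space functional \<Rightarrow> 'a functional" where
  "dist_inv_fourier T = (\<lambda>\<phi>. T (inv_fourier \<phi>))"

definition dist_mult :: "('a::euclidean_space \<Rightarrow> complex) \<Rightarrow> 'a functional \<Rightarrow> 'a functional" where
  "dist_mult m T = (\<lambda>\<phi>. T (\<lambda>\<xi>. m \<xi> * \<phi> \<xi>))"

text \<open>
  The \<open>L\<^sub>p\<close> norm of a distribution: the norm of the function in \<open>L\<^sub>p\<close> representing it (which is
  unique almost everywhere), and \<open>\<infinity>\<close> (the infimum of the empty set) if there is none.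
\<close>

definition dist_Lp_norm :: "ennreal \<Rightarrow> 'a::euclidean_space functional \<Rightarrow> ennreal" where
  "dist_Lp_norm p T =
     Inf {Lp_norm p g | g. g \<in> Lp_space p \<and> (\<forall>\<phi>. schwartz \<phi> \<longrightarrow> T \<phi> = regular_dist g \<phi>)}"

section \<open>Multiplier norms\<close>

text \<open>
  Intended for multipliers such that multiplication by \<open>m\<close> preserves Schwartz functions
  (smooth, with all derivatives of polynomial growth).
\<close>

definition multiplier_op ::
    "('a::euclidean_space \<Rightarrow> complex) \<Rightarrow> ('a \<Rightarrow> complex) \<Rightarrow> 'a functional" where
  "multiplier_op m f = dist_inv_fourier (dist_mult m (dist_fourier (regular_dist f)))"

definition multiplier_norm :: "ennreal \<Rightarrow> ('a::euclidean_space \<Rightarrow> complex) \<Rightarrow> ennreal" where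
  "multiplier_norm p m =
     (SUP f \<in> {f \<in> Lp_space p. Lp_norm p f = 1}. dist_Lp_norm p (multiplier_op m f))"

definition gauss_multiplier :: "real \<Rightarrow> real ^ 'n \<Rightarrow> complex" where
  "gauss_multiplier h \<xi> =
     complex_of_real
       (exp (- (1 / 4) * (norm \<xi>)\<^sup>2) /
        (\<Sum>\<^sub>\<infinity>j\<in>(UNIV :: (int ^ 'n) set).
           exp (- (1 / 4) * (norm (\<xi> - (\<chi> i. 2 * pi * real_of_int (j $ i) / h)))\<^sup>2)))"

end

theory Submission
  imports Defs "HOL-Probability.Probability" "HOL-Complex_Analysis.Complex_Analysis"
begin

text \<open>
  The operator belonging to \<open>m\<close> is convolution with the inverse Fourier transform \<open>K\<close> of \<open>m\<close>. As \<open>K\<close> is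
  integrable, Fubini's theorem alone identifies the distribution \<open>multiplier_op m f\<close> with the function
  \<open>convol K f\<close> (\<open>multiplier_op_eq_convol\<close>), and all norms become norms of convolution operators. The
  lattice sum in the denominator factorises, so \<open>K\<close> is a product of one-dimensional kernels \<open>k\<close>.

  For \<open>p = 1\<close> and \<open>p = \<infinity>\<close> both norms are equal to the \<open>L\<^sub>1\<close> norm of \<open>K\<close>: it is an upper bound by Tonelli's
  theorem, and a lower bound because testing with shrinking Gaussians recovers \<open>K\<close> pointwise
  (\<open>multiplier_norm_1_ge\<close>, \<open>multiplier_norm_inf_ge\<close>). It remains to integrate \<open>\<bar>k\<bar>\<close> over the line. With
  \<open>b = \<pi> / h\<close> the one-dimensional multiplier at \<open>t\<close> is \<open>1 / \<Theta> (b * t)\<close>, where \<open>\<Theta> u\<close> is the sum of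
  \<open>exp (j * u - b\<^sup>2 * j\<^sup>2)\<close> over all integers \<open>j\<close>. Such a sum is log-convex, and it is quasi-periodic: its
  logarithmic derivative \<open>L\<close> increases by exactly \<open>1\<close> over each interval of length \<open>2 * b\<^sup>2\<close>, whereas the
  translates of \<open>1 / \<Theta>\<close> by multiples of this length add up to \<open>1\<close>. Consequently the multiplier and its
  first two derivatives have integrals of at most \<open>4 * b\<close>, \<open>2\<close> and \<open>4 * b\<close> in absolute value, and the
  kernel satisfies \<open>\<bar>k x\<bar> \<le> 2 / h\<close>, \<open>\<bar>x\<bar> * \<bar>k x\<bar> \<le> 1\<close> and \<open>x\<^sup>2 * \<bar>k x\<bar> \<le> 2 / h\<close>. Integrating the best of
  the three bounds gives a multiple of \<open>1 + \<bar>ln h\<bar>\<close> (\<open>nn_integral_theta_kernel\<close>).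

  For \<open>1 < p < \<infinity>\<close> only the bound \<open>2\<close> for the variation matters, as it does not depend on \<open>h\<close>. It makes
  \<open>x * k x\<close> a superposition of characters of bounded total mass, hence \<open>k\<close> a limit of superpositions of
  modulated conjugate Poisson kernels. These are uniformly bounded on \<open>L\<^sub>p\<close> by a theorem of M. Riesz,
  proved here for \<open>p \<le> 2\<close> as follows. For \<open>f \<ge> 0\<close> the Cauchy extension \<open>F\<close> has positive real part, so
  \<open>F powr p\<close> is holomorphic and integrates to zero over horizontal lines; the elementary inequality
  \<open>\<bar>z\<bar> powr p \<le> A * (Re z) powr p - B * Re (z powr p)\<close> then controls \<open>F\<close> by its real part, a Poisson
  integral of \<open>f\<close>. Duality gives \<open>p > 2\<close>, as the kernel is even (\<open>bv_kernel_Lp_bound\<close>). In several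
  dimensions the coordinates are treated one after the other (\<open>tensor_kernel_Lp_bound\<close>).
\<close>

section \<open>Lebesgue integrals and norms\<close>

text \<open>
  Integrals that name no measure are taken with respect to Lebesgue measure.
\<close>

syntax
  "_lborel_integral" :: "pttrn \<Rightarrow> 'b \<Rightarrow> 'b" ("(\<integral>_./ _)" [0, 10] 10)
  "_lborel_nn_integral" :: "pttrn \<Rightarrow> ennreal \<Rightarrow> ennreal" ("(\<integral>\<^sup>+_./ _)" [0, 10] 10)
translations
  "_lborel_integral x f" \<rightleftharpoons> "CONST lebesgue_integral (CONST lborel) (\<lambda>x. f)"
  "_lborel_nn_integral x f" \<rightleftharpoons> "CONST nn_integral (CONST lborel) (\<lambda>x. f)"

text \<open>
  Boundedness on \<open>L\<^sub>p\<close> is stated below as \<open>Lp_mass p (T f) \<le> C * Lp_mass p f\<close>, so that no \<open>p\<close>-th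
  roots have to be carried along.
\<close>

abbreviation Lp_mass :: "real \<Rightarrow> ('a::euclidean_space \<Rightarrow> complex) \<Rightarrow> ennreal" where
  "Lp_mass p f \<equiv> (\<integral>\<^sup>+x. ennreal (norm (f x) powr p))"

abbreviation L1_mass :: "('a::euclidean_space \<Rightarrow> complex) \<Rightarrow> ennreal" where
  "L1_mass f \<equiv> (\<integral>\<^sup>+x. ennreal (norm (f x)))"

lemma integrable_mult_bounded:
  fixes f g :: "'a \<Rightarrow> complex"
  assumes "integrable M f" "g \<in> borel_measurable M" "\<And>x. norm (g x) \<le> B"
  shows "integrable M (\<lambda>x. f x * g x)"
proof (rule Bochner_Integration.integrable_bound)
  show "integrable M (\<lambda>x. norm (f x) * B)" using assms(1) by simp
  show "AE x in M. norm (f x * g x) \<le> norm (norm (f x) * B)"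
  proof (rule AE_I2)
    fix x
    have "norm (f x) * norm (g x) \<le> norm (f x) * B" by (intro mult_left_mono assms(3)) simp
    then show "norm (f x * g x) \<le> norm (norm (f x) * B)" by (simp add: norm_mult)
  qed
qed (use assms in measurable)

text \<open>
  Fatou's lemma in the form that carries bounds for approximations over to their pointwise limit.
\<close>

lemma nn_integral_le_of_fatou:
  assumes [measurable]: "\<And>n. u n \<in> borel_measurable M"
    and lim: "AE x in M. (\<lambda>n. u n x) \<longlonglongrightarrow> f x"
    and le: "eventually (\<lambda>n. (\<integral>\<^sup>+x. u n x \<partial>M) \<le> b n) sequentially"
    and b: "b \<longlonglongrightarrow> (a::ennreal)"
  shows "(\<integral>\<^sup>+x. f x \<partial>M) \<le> a"
proof -
  have "(\<integral>\<^sup>+x. f x \<partial>M) = (\<integral>\<^sup>+x. liminf (\<lambda>n. u n x) \<partial>M)"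
    using lim by (intro nn_integral_cong_AE) (auto elim!: eventually_mono simp: lim_imp_Liminf)
  also have "\<dots> \<le> liminf (\<lambda>n. \<integral>\<^sup>+x. u n x \<partial>M)"
    by (rule nn_integral_liminf) simp
  also have "\<dots> \<le> liminf b"
    by (rule Liminf_mono) (rule le)
  also have "\<dots> = a" using b by (simp add: lim_imp_Liminf)
  finally show ?thesis .
qed

lemma tendsto_mult_indicator_exhaust:
  fixes g :: "real \<Rightarrow> ennreal"
  shows "(\<lambda>n. g x * indicator {- real n..real n} x) \<longlonglongrightarrow> g x"
proof (rule tendsto_eventually)
  obtain N where N: "\<bar>x\<bar> \<le> real N" using real_arch_simple by blast
  show "\<forall>\<^sub>F n in sequentially. g x * indicator {- real n..real n} x = g x"
    using eventually_ge_at_top[of N]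
    by eventually_elim (use N in \<open>auto simp: indicator_def abs_le_iff\<close>)
qed

lemma nn_integral_even:
  fixes f :: "real \<Rightarrow> ennreal"
  assumes [measurable]: "f \<in> borel_measurable borel" and even: "\<And>x. f (- x) = f x"
  shows "(\<integral>\<^sup>+x. f x) = 2 * (\<integral>\<^sup>+x. f x * indicator {0..} x)"
proof -
  have "(\<integral>\<^sup>+x. f x) = (\<integral>\<^sup>+x. f x * indicator {0..} x + f x * indicator {..<0} x)"
    by (intro nn_integral_cong) (auto simp: indicator_def)
  also have "\<dots> = (\<integral>\<^sup>+x. f x * indicator {0..} x) + (\<integral>\<^sup>+x. f x * indicator {..<0} x)"
    by (rule nn_integral_add) auto
  also have "(\<integral>\<^sup>+x. f x * indicator {..<0} x) = (\<integral>\<^sup>+x. f x * indicator {..<0::real} (-x))"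
    by (subst nn_integral_real_affine[where c="-1" and t=0]) (auto simp: even)
  also have "\<dots> = (\<integral>\<^sup>+x. f x * indicator {0..} x)"
    using AE_lborel_singleton[of "0::real"]
    by (intro nn_integral_cong_AE) (auto elim!: eventually_mono simp: indicator_def)
  finally show ?thesis by (simp add: mult_2)
qed

lemma nn_integral_translate:
  fixes f :: "'a::euclidean_space \<Rightarrow> ennreal"
  assumes [measurable]: "f \<in> borel_measurable borel"
  shows "(\<integral>\<^sup>+x. f (a + x)) = (\<integral>\<^sup>+x. f x)"
proof -
  have "(\<integral>\<^sup>+x. f x) = (\<integral>\<^sup>+x. f x \<partial>distr lborel borel ((+) a))"
    by (simp add: lborel_distr_plus)
  also have "\<dots> = (\<integral>\<^sup>+x. f (a + x))" by (subst nn_integral_distr) auto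
  finally show ?thesis by simp
qed

lemma nn_integral_translate_diff:
  fixes f :: "'a::euclidean_space \<Rightarrow> ennreal"
  assumes [measurable]: "f \<in> borel_measurable borel"
  shows "(\<integral>\<^sup>+x. f (x - a)) = (\<integral>\<^sup>+x. f x)"
  using nn_integral_translate[OF assms, of "- a"] by simp

lemma nn_integral_continuous_interval:
  fixes g :: "real \<Rightarrow> real"
  assumes "continuous_on {a..b} g" "\<And>x. x \<in> {a..b} \<Longrightarrow> g x \<ge> 0"
  shows "(\<integral>\<^sup>+x. ennreal (g x) * indicator {a..b} x) = ennreal (integral {a..b} g)"
proof -
  have i: "set_integrable lborel {a..b} g"
    unfolding set_integrable_def by (intro borel_integrable_compact assms) auto
  have "(\<integral>\<^sup>+x. ennreal (g x) * indicator {a..b} x) = (\<integral>\<^sup>+x. ennreal (indicator {a..b} x *\<^sub>R g x))"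
    by (intro nn_integral_cong) (auto simp: indicator_def)
  also have "\<dots> = ennreal (LINT x:{a..b}|lborel. g x)"
    unfolding set_lebesgue_integral_def
    using i assms(2) unfolding set_integrable_def
    by (intro nn_integral_eq_integral) (auto simp: indicator_def)
  also have "(LINT x:{a..b}|lborel. g x) = integral {a..b} g"
    by (rule set_borel_integral_eq_integral(2)[OF i])
  finally show ?thesis .
qed

text \<open>
  Integrals of such functions against bounded kernels converge absolutely, and the class is closed
  under truncation and under multiplication with characters.
\<close>

definition bdd_supp :: "('a::euclidean_space \<Rightarrow> 'b::{real_normed_vector, second_countable_topology}) \<Rightarrow> bool" where
  "bdd_supp f \<longleftrightarrow> f \<in> borel_measurable borel \<and> (\<exists>B. \<forall>x. norm (f x) \<le> B) \<and> (\<exists>M. \<forall>x. norm x > M \<longrightarrow> f x = 0)"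

lemma bdd_supp_measurable: "bdd_supp f \<Longrightarrow> f \<in> borel_measurable borel"
  by (simp add: bdd_supp_def)

lemma bdd_supp_integrable:
  fixes f :: "'a::euclidean_space \<Rightarrow> 'b::{banach, second_countable_topology}"
  assumes "bdd_supp f"
  shows "integrable lborel f"
proof -
  obtain B M where B: "\<And>x. norm (f x) \<le> B" and M: "\<And>x. norm x > M \<Longrightarrow> f x = 0"
    using assms by (auto simp: bdd_supp_def)
  have "integrable lborel (\<lambda>x. indicator (cball 0 M) x *\<^sub>R B)"
    by (intro borel_integrable_compact) auto
  then show ?thesis
  proof (rule Bochner_Integration.integrable_bound)
    show "AE x in lborel. norm (f x) \<le> norm (indicator (cball 0 M) x *\<^sub>R B)"
      using B M norm_ge_zero by (intro AE_I2) (force simp: indicator_def intro: order_trans[OF _ abs_ge_self])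
  qed (use assms bdd_supp_measurable in auto)
qed

lemma bdd_supp_powr:
  assumes "bdd_supp f" "p > 0"
  shows "bdd_supp (\<lambda>x. norm (f x) powr p)"
proof -
  obtain B M where B: "\<And>x. norm (f x) \<le> B" and M: "\<And>x. norm x > M \<Longrightarrow> f x = 0"
    using assms by (auto simp: bdd_supp_def)
  have [measurable]: "f \<in> borel_measurable borel" using assms(1) by (rule bdd_supp_measurable)
  have "norm (norm (f x) powr p) \<le> B powr p" for x
    using B[of x] assms by (auto intro!: powr_mono2)
  moreover have "(\<lambda>x. norm (f x) powr p) \<in> borel_measurable borel" by measurable
  moreover have "norm x > M \<Longrightarrow> norm (f x) powr p = 0" for x using M by simp
  ultimately show ?thesis unfolding bdd_supp_def by blast
qed

lemma integrable_bdd_supp_mult: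
  fixes f :: "'a::euclidean_space \<Rightarrow> real"
  assumes f: "bdd_supp f" and [measurable]: "g \<in> borel_measurable borel" and g: "\<And>x. \<bar>g x\<bar> \<le> B"
  shows "integrable lborel (\<lambda>x. f x * g x)"
proof (rule Bochner_Integration.integrable_bound)
  show "integrable lborel (\<lambda>x. \<bar>f x\<bar> * B)" using bdd_supp_integrable[OF f] by simp
  show "AE x in lborel. norm (f x * g x) \<le> norm (\<bar>f x\<bar> * B)"
  proof (rule AE_I2)
    fix x
    have "\<bar>f x\<bar> * \<bar>g x\<bar> \<le> \<bar>f x\<bar> * B" by (intro mult_left_mono g) simp
    moreover have "B \<ge> 0" using g[of x] by linarith
    ultimately show "norm (f x * g x) \<le> norm (\<bar>f x\<bar> * B)" by (simp add: abs_mult)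
  qed
qed (use bdd_supp_measurable[OF f] in measurable)

text \<open>
  The graph of \<open>\<lambda>s. s powr p\<close> lies above its tangent at \<open>l\<close>; this is Young's inequality for \<open>s\<close> and
  \<open>l powr (p - 1)\<close>.
\<close>

lemma powr_tangent_ineq:
  fixes p s l :: real
  assumes "1 < p" "s \<ge> 0" "l \<ge> 0"
  shows "p * l powr (p - 1) * s \<le> s powr p + (p - 1) * l powr p"
proof -
  define q where "q = p / (p - 1)"
  have q: "q > 1" "1 / p + 1 / q = 1" using assms by (auto simp: q_def field_simps)
  have "s * l powr (p - 1) \<le> s powr p / p + (l powr (p - 1)) powr q / q"
    using assms q by (intro Youngs_inequality) auto
  also have "(l powr (p - 1)) powr q = l powr p" using assms by (simp add: powr_powr q_def)
  finally have "p * (s * l powr (p - 1)) \<le> p * (s powr p / p + l powr p / q)"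
    using assms by (intro mult_left_mono) auto
  also have "\<dots> = s powr p + (p - 1) * l powr p" using assms by (simp add: q_def field_simps)
  finally show ?thesis by (simp add: mult_ac)
qed

text \<open>
  Jensen's inequality for the measure with density \<open>P\<close>: the tangent inequality at the mean value of
  \<open>f\<close> is integrated.
\<close>

lemma powr_integral_le:
  fixes p :: real and f P :: "'a \<Rightarrow> real"
  assumes p: "1 < p" and P: "integrable M P" and c: "integral\<^sup>L M P > 0"
    and nn: "\<And>x. P x \<ge> 0" "\<And>x. f x \<ge> 0"
    and i1: "integrable M (\<lambda>x. f x * P x)" and i2: "integrable M (\<lambda>x. f x powr p * P x)"
  shows "(\<integral>x. f x * P x \<partial>M) powr p \<le> (integral\<^sup>L M P) powr (p - 1) * (\<integral>x. f x powr p * P x \<partial>M)"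
proof -
  define c where "c = integral\<^sup>L M P"
  define l where "l = (\<integral>x. f x * P x \<partial>M) / c"
  have c0: "c > 0" using c by (simp add: c_def)
  have l0: "l \<ge> 0" unfolding l_def using nn c0 by (intro divide_nonneg_pos integral_nonneg_AE) auto
  have "(\<integral>x. (p * l powr (p - 1)) * (f x * P x) \<partial>M) \<le> (\<integral>x. f x powr p * P x + ((p - 1) * l powr p) * P x \<partial>M)"
  proof (rule integral_mono)
    fix x
    have "(p * l powr (p - 1) * f x) * P x \<le> (f x powr p + (p - 1) * l powr p) * P x"
      using nn powr_tangent_ineq[OF p nn(2) l0] by (intro mult_right_mono) auto
    then show "p * l powr (p - 1) * (f x * P x) \<le> f x powr p * P x + (p - 1) * l powr p * P x"
      by (simp add: algebra_simps)
  qed (use P i1 i2 in auto)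
  then have "p * l powr (p - 1) * (l * c) \<le> (\<integral>x. f x powr p * P x \<partial>M) + (p - 1) * l powr p * c"
    using P i1 i2 c0 by (simp add: c_def[symmetric] l_def)
  moreover have "l powr (p - 1) * l = l powr p"
    using l0 by (cases "l = 0") (auto simp: powr_diff field_simps)
  ultimately have "p * (l powr p * c) \<le> (\<integral>x. f x powr p * P x \<partial>M) + (p - 1) * l powr p * c"
    by (metis mult.assoc)
  then have *: "l powr p * c \<le> (\<integral>x. f x powr p * P x \<partial>M)" by (simp add: algebra_simps)
  have "(\<integral>x. f x * P x \<partial>M) powr p = (l * c) powr p" using c0 by (simp add: l_def)
  also have "\<dots> = c powr (p - 1) * (l powr p * c)"
    using c0 l0 by (simp add: powr_mult powr_diff)
  also have "\<dots> \<le> c powr (p - 1) * (\<integral>x. f x powr p * P x \<partial>M)" by (intro mult_left_mono *) simp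
  finally show ?thesis by (simp add: c_def)
qed

section \<open>The inequality of M. Riesz for the conjugate Poisson kernel\<close>

text \<open>
  Since \<open>1 < p \<le> 2\<close>, the angle \<open>p * \<theta>\<close> has passed \<open>\<pi> / 2\<close>, but not \<open>\<pi>\<close>, when \<open>\<theta>\<close> reaches \<open>\<pi> / 2\<close>. Hence
  \<open>cos (p * \<theta>)\<close> is negative near the angle where \<open>cos \<theta>\<close> vanishes, and suitable multiples of the two
  terms cover all angles.
\<close>

lemma cos_powr_minorant:
  fixes p :: real
  assumes "1 < p" "p \<le> 2"
  obtains A B where "A \<ge> 0" "B \<ge> 0"
    "\<And>\<theta>. \<bar>\<theta>\<bar> < pi / 2 \<Longrightarrow> 1 \<le> A * cos \<theta> powr p - B * cos (p * \<theta>)"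
proof -
  \<comment> \<open>Any angle strictly between \<open>\<pi> / (2 * p)\<close> and \<open>\<pi> / 2\<close> separates the two ranges.\<close>
  define \<theta>0 where "\<theta>0 = (pi / (2 * p) + pi / 2) / 2"
  have lt: "pi / (2 * p) < pi / 2" using assms by (simp add: field_simps)
  have t1: "pi / (2 * p) < \<theta>0" and t2: "\<theta>0 < pi / 2" using lt by (auto simp: \<theta>0_def)
  have t0: "0 < \<theta>0" using assms by (simp add: \<theta>0_def add_pos_pos)
  have p0: "pi / 2 < p * \<theta>0" using t1 assms by (simp add: field_simps)
  have p1: "p * \<theta>0 < pi"
    using mult_right_mono[OF assms(2), of \<theta>0] t2 t0 by linarith
  define \<kappa> where "\<kappa> = - cos (p * \<theta>0)"
  have \<kappa>: "\<kappa> > 0"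
    using cos_monotone_0_pi[of "pi/2" "p * \<theta>0"] p0 p1 by (simp add: \<kappa>_def)
  define B where "B = 1 / \<kappa>"
  define A where "A = (1 + B) / cos \<theta>0 powr p"
  have c0: "cos \<theta>0 > 0" using t0 t2 by (intro cos_gt_zero) auto
  have B: "B \<ge> 0" using \<kappa> by (simp add: B_def)
  have A: "A \<ge> 0" using B by (simp add: A_def)
  have main: "1 \<le> A * cos \<theta> powr p - B * cos (p * \<theta>)" if "0 \<le> \<theta>" "\<theta> < pi / 2" for \<theta>
  proof (cases "\<theta> \<le> \<theta>0")
    case True
    have "cos \<theta>0 \<le> cos \<theta>" using True that t2 t0 by (intro cos_monotone_0_pi_le) auto
    then have "cos \<theta>0 powr p \<le> cos \<theta> powr p" using c0 assms by (intro powr_mono2) auto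
    then have "A * cos \<theta>0 powr p \<le> A * cos \<theta> powr p" using A by (intro mult_left_mono) auto
    moreover have "A * cos \<theta>0 powr p = 1 + B" using c0 by (simp add: A_def)
    moreover have "B * cos (p * \<theta>) \<le> B" using B by (simp add: mult_left_le)
    ultimately show ?thesis by linarith
  next
    case False
    have "p * \<theta> \<le> 2 * (pi / 2)" using that assms by (intro mult_mono) auto
    then have "cos (p * \<theta>) \<le> cos (p * \<theta>0)"
      using False assms t0 by (intro cos_monotone_0_pi_le) auto
    then have "B * \<kappa> \<le> B * (- cos (p * \<theta>))" using B by (intro mult_left_mono) (auto simp: \<kappa>_def)
    then have "1 \<le> - B * cos (p * \<theta>)" using \<kappa> by (simp add: B_def)
    moreover have "0 \<le> A * cos \<theta> powr p" using A by simp
    ultimately show ?thesis by linarith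
  qed
  have "1 \<le> A * cos \<theta> powr p - B * cos (p * \<theta>)" if "\<bar>\<theta>\<bar> < pi / 2" for \<theta>
    using main[of "\<bar>\<theta>\<bar>"] that by (cases "\<theta> \<ge> 0") auto
  with A B that show ?thesis by blast
qed

text \<open>
  The inequality \<open>cos_powr_minorant\<close> in polar coordinates. For \<open>z = F x\<close>, where \<open>F\<close> is analytic in the
  upper half-plane, has positive real part and decays, the last term is the real part of an analytic
  function and integrates to zero; the modulus of \<open>F\<close> is then controlled by its real part alone.
\<close>

lemma riesz_pointwise:
  fixes p :: real
  assumes "1 < p" "p \<le> 2"
  obtains A B where "A \<ge> 0" "B \<ge> 0"
    "\<And>z. Re z > 0 \<Longrightarrow> norm z powr p \<le> A * Re z powr p - B * Re (z powr complex_of_real p)"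
proof -
  obtain A B where A: "A \<ge> 0" and B: "B \<ge> 0"
    and AB: "\<And>\<theta>. \<bar>\<theta>\<bar> < pi / 2 \<Longrightarrow> 1 \<le> A * cos \<theta> powr p - B * cos (p * \<theta>)"
    using cos_powr_minorant[OF assms] by blast
  have "norm z powr p \<le> A * Re z powr p - B * Re (z powr complex_of_real p)" if z: "Re z > 0" for z
  proof -
    define \<theta> where "\<theta> = Im (Ln z)"
    have nz: "z \<noteq> 0" using z by auto
    have \<theta>: "\<bar>\<theta>\<bar> < pi / 2" using Re_Ln_pos_lt_imp[OF z] by (simp add: \<theta>_def)
    have "Re z = Re (exp (Ln z))" using nz by simp
    also have "\<dots> = norm z * cos \<theta>" unfolding Re_exp \<theta>_def using nz by simp
    finally have 1: "Re z = norm z * cos \<theta>" .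
    have 2: "Re (z powr complex_of_real p) = norm z powr p * cos (p * \<theta>)"
      using nz by (simp add: powr_def Re_exp \<theta>_def)
    have c: "cos \<theta> > 0" using \<theta> by (intro cos_gt_zero_pi) auto
    have "norm z powr p * 1 \<le> norm z powr p * (A * cos \<theta> powr p - B * cos (p * \<theta>))"
      using AB[OF \<theta>] by (intro mult_left_mono) auto
    also have "\<dots> = A * Re z powr p - B * Re (z powr complex_of_real p)"
      using c unfolding 2 unfolding 1 by (simp add: powr_mult algebra_simps)
    finally show ?thesis by simp
  qed
  with A B that show ?thesis by blast
qed

text \<open>
  The Cauchy transform of \<open>f\<close>, multiplied by \<open>\<i>\<close>. At height \<open>e\<close> above the real axis its real and imaginary
  parts are the convolutions of \<open>f\<close> with the Poisson kernel and with the conjugate Poisson kernel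
  (\<open>cauchy_ext_Complex\<close>).
\<close>

definition cauchy_ext :: "(real \<Rightarrow> real) \<Rightarrow> complex \<Rightarrow> complex" where
  "cauchy_ext f z = (\<integral>t. complex_of_real (f t) * (\<i> / (z - complex_of_real t)))"

lemma quotient_minus: "c \<noteq> 0 \<Longrightarrow> a / c - D = (a - c * D) / (c::complex)"
  by (simp add: field_simps)

lemma integral_linear_comb3:
  fixes a b c :: "'a \<Rightarrow> complex"
  assumes "integrable M a" "integrable M b" "integrable M c"
  shows "(\<integral>t. a t - b t - k * c t \<partial>M) = integral\<^sup>L M a - integral\<^sup>L M b - k * integral\<^sup>L M c"
  using assms by simp

lemma norm_diff_real_ge_Im: "Im z \<le> norm (z - complex_of_real t)"
  using abs_Im_le_cmod[of "z - complex_of_real t"] by simp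

lemma cauchy_ext_integrable:
  assumes "integrable lborel f" "Im z > 0"
  shows "integrable lborel (\<lambda>t. complex_of_real (f t) * (\<i> / (z - complex_of_real t)))"
proof (rule integrable_mult_bounded[where B="1 / Im z"])
  show "norm (\<i> / (z - complex_of_real t)) \<le> 1 / Im z" for t
    using norm_diff_real_ge_Im[of z t] assms(2) by (simp add: norm_divide frac_le)
qed (use assms(1) in auto)

text \<open>
  The error of the first-order expansion of the integrand is computed exactly; it carries the factor
  \<open>(w - z)\<^sup>2\<close>, and the remaining denominators are at least the heights of \<open>w\<close> and \<open>z\<close> above the real axis.
\<close>

lemma cauchy_ext_has_derivative:
  assumes f: "integrable lborel f" and z: "Im z > 0"
  shows "(cauchy_ext f has_field_derivative
    (\<integral>t. complex_of_real (f t) * (- \<i> / (z - complex_of_real t)^2))) (at z)"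
    (is "(_ has_field_derivative ?D) _")
proof -
  define y where "y = Im z"
  define L where "L = (\<integral>t. \<bar>f t\<bar>)"
  have y: "y > 0" using z by (simp add: y_def)
  have L0: "L \<ge> 0" by (simp add: L_def)
  have intD: "integrable lborel (\<lambda>t. complex_of_real (f t) * (- \<i> / (z - complex_of_real t)^2))"
  proof (rule integrable_mult_bounded[where B="1 / y^2"])
    show "norm (- \<i> / (z - complex_of_real t)^2) \<le> 1 / y^2" for t
      using norm_diff_real_ge_Im[of z t] y
      by (simp add: norm_divide norm_power y_def frac_le power_mono)
  qed (use f in auto)
  have bound: "norm ((cauchy_ext f w - cauchy_ext f z) / (w - z) - ?D) \<le> norm (w - z) * (L * (2 / y ^ 3))"
    if w: "dist w z < y / 2" "w \<noteq> z" for w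
  proof -
    have "\<bar>Im (w - z)\<bar> < y / 2" using w(1) abs_Im_le_cmod[of "w - z"] by (simp add: dist_norm)
    then have Iw: "Im w > y / 2" by (simp add: y_def abs_if split: if_splits)
    have eq: "complex_of_real (f t) * (\<i> / (w - complex_of_real t)) - complex_of_real (f t) * (\<i> / (z - complex_of_real t))
        - (w - z) * (complex_of_real (f t) * (- \<i> / (z - complex_of_real t)^2))
       = complex_of_real (f t) * (\<i> * (w - z)^2 / ((w - complex_of_real t) * (z - complex_of_real t)^2))" for t
    proof -
      have a: "w - complex_of_real t \<noteq> 0" "z - complex_of_real t \<noteq> 0"
        using Iw z y by (auto simp: complex_eq_iff)
      define a b where "a = w - complex_of_real t" and "b = z - complex_of_real t"
      have wz: "w - z = a - b" by (simp add: a_def b_def)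
      show ?thesis using a unfolding wz a_def[symmetric] b_def[symmetric]
        by (simp add: field_simps power2_eq_square)
    qed
    have bd: "norm (\<i> * (w - z)^2 / ((w - complex_of_real t) * (z - complex_of_real t)^2)) \<le> norm (w - z)^2 * (2 / y^3)" for t
    proof -
      have "y / 2 * y^2 \<le> norm (w - complex_of_real t) * norm (z - complex_of_real t)^2"
        using norm_diff_real_ge_Im[of z t] norm_diff_real_ge_Im[of w t] Iw y
        by (intro mult_mono power_mono) (auto simp: y_def)
      moreover have "0 < y / 2 * y^2" using y by simp
      ultimately have "norm (w - z)^2 / (norm (w - complex_of_real t) * norm (z - complex_of_real t)^2) \<le> norm (w - z)^2 / (y / 2 * y^2)"
        by (intro divide_left_mono mult_pos_pos[of _ "y / 2 * y^2"]) auto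
      then show ?thesis using y by (simp add: norm_divide norm_mult norm_power power3_eq_cube power2_eq_square)
    qed
    have "cauchy_ext f w - cauchy_ext f z - (w - z) * ?D =
       (\<integral>t. complex_of_real (f t) * (\<i> * (w - z)^2 / ((w - complex_of_real t) * (z - complex_of_real t)^2)))"
      unfolding cauchy_ext_def eq[symmetric]
      by (intro integral_linear_comb3[symmetric] cauchy_ext_integrable f z intD) (use Iw y in linarith)
    also have "norm \<dots> \<le> (\<integral>t. \<bar>f t\<bar> * (norm (w - z)^2 * (2 / y^3)))"
    proof (rule Bochner_Integration.integral_norm_bound_integral)
      show "integrable lborel (\<lambda>t. complex_of_real (f t) * (\<i> * (w - z)^2 / ((w - complex_of_real t) * (z - complex_of_real t)^2)))"
        by (rule integrable_mult_bounded[OF _ _ bd]) (use f in auto)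
      show "norm (complex_of_real (f t) * (\<i> * (w - z)^2 / ((w - complex_of_real t) * (z - complex_of_real t)^2)))
         \<le> \<bar>f t\<bar> * (norm (w - z)^2 * (2 / y^3))" for t
        using mult_left_mono[OF bd[of t], of "\<bar>f t\<bar>"] unfolding norm_mult[of "complex_of_real (f t)"] by simp
    qed (use f in auto)
    also have "\<dots> = norm (w - z)^2 * (L * (2 / y ^ 3))" by (simp add: L_def)
    finally have *: "norm (cauchy_ext f w - cauchy_ext f z - (w - z) * ?D) \<le> norm (w - z)^2 * (L * (2 / y ^ 3))" .
    have "norm ((cauchy_ext f w - cauchy_ext f z) / (w - z) - ?D)
      = norm ((cauchy_ext f w - cauchy_ext f z - (w - z) * ?D) / (w - z))"
      using w(2) by (subst quotient_minus) auto
    also have "\<dots> \<le> norm (w - z)^2 * (L * (2 / y ^ 3)) / norm (w - z)"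
      unfolding norm_divide by (intro divide_right_mono *) simp
    also have "\<dots> = norm (w - z) * (L * (2 / y ^ 3))" using w(2) by (simp add: power2_eq_square)
    finally show ?thesis .
  qed
  show ?thesis unfolding has_field_derivative_iff
  proof (rule Lim_null[THEN iffD2], rule Lim_null_comparison)
    show "\<forall>\<^sub>F w in at z. norm ((cauchy_ext f w - cauchy_ext f z) / (w - z) - ?D) \<le> norm (w - z) * (L * (2 / y ^ 3))"
      unfolding eventually_at using bound y by (intro exI[of _ "y/2"]) auto
    have "((\<lambda>w. norm (w - z) * (L * (2 / y ^ 3))) \<longlongrightarrow> norm (z - z) * (L * (2 / y ^ 3))) (at z)"
      by (intro tendsto_intros)
    then show "((\<lambda>w. norm (w - z) * (L * (2 / y ^ 3))) \<longlongrightarrow> 0) (at z)" by simp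
  qed
qed

lemma cauchy_ext_holomorphic:
  assumes f: "integrable lborel f"
  shows "cauchy_ext f holomorphic_on {z. Im z > 0}"
  using cauchy_ext_has_derivative[OF f]
  by (auto simp: holomorphic_on_def field_differentiable_def intro: has_field_derivative_at_within)

definition poisson_kernel :: "real \<Rightarrow> real \<Rightarrow> real" where
  "poisson_kernel e x = e / (x^2 + e^2)"

definition conj_poisson_kernel :: "real \<Rightarrow> real \<Rightarrow> real" where
  "conj_poisson_kernel e x = x / (x^2 + e^2)"

lemma poisson_kernel_measurable [measurable]: "poisson_kernel e \<in> borel_measurable borel"
  and conj_poisson_kernel_measurable [measurable]: "conj_poisson_kernel e \<in> borel_measurable borel"
  unfolding poisson_kernel_def conj_poisson_kernel_def by measurable

lemma poisson_kernel_nonneg: "e > 0 \<Longrightarrow> poisson_kernel e x \<ge> 0"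
  by (simp add: poisson_kernel_def)

lemma poisson_kernel_pos: "e > 0 \<Longrightarrow> poisson_kernel e x > 0"
  by (simp add: poisson_kernel_def sum_power2_gt_zero_iff)

lemma poisson_kernel_le: "e > 0 \<Longrightarrow> poisson_kernel e x \<le> 1 / e"
proof -
  assume e: "e > 0"
  have "e * e \<le> x^2 + e^2" by (simp add: power2_eq_square)
  then show ?thesis using e by (simp add: poisson_kernel_def field_simps sum_power2_gt_zero_iff)
qed

lemma conj_poisson_kernel_le: "e > 0 \<Longrightarrow> \<bar>conj_poisson_kernel e x\<bar> \<le> 1 / e"
proof -
  assume e: "e > 0"
  have "2 * (e * \<bar>x\<bar>) \<le> x^2 + e^2" using sum_squares_bound[of e "\<bar>x\<bar>"] by simp
  moreover have "0 \<le> e * \<bar>x\<bar>" using e by simp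
  ultimately have "e * \<bar>x\<bar> \<le> x^2 + e^2" by linarith
  then show ?thesis
    using e by (simp add: conj_poisson_kernel_def abs_div field_simps sum_power2_gt_zero_iff)
qed

lemma nn_integral_poisson_kernel:
  assumes e: "e > 0"
  shows "(\<integral>\<^sup>+x. ennreal (poisson_kernel e x)) = ennreal pi"
proof -
  have "(\<integral>\<^sup>+x. ennreal (poisson_kernel e x) * indicator {0..} x) = ennreal (pi / 2 - arctan (0 / e))"
  proof (rule nn_integral_FTC_atLeast)
    show "((\<lambda>x. arctan (x / e)) has_real_derivative poisson_kernel e x) (at x)" for x
      using e unfolding poisson_kernel_def
      by (auto intro!: derivative_eq_intros simp: field_simps power2_eq_square)
    show "((\<lambda>x. arctan (x / e)) \<longlongrightarrow> pi / 2) at_top"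
    proof (rule filterlim_compose[OF tendsto_arctan_at_top])
      show "filterlim (\<lambda>x. x / e) at_top at_top"
        using filterlim_tendsto_pos_mult_at_top[OF tendsto_const[of "1 / e"] _ filterlim_ident[of at_top]] e
        by simp
    qed
  qed (use poisson_kernel_nonneg[OF e] in auto)
  moreover have "(\<integral>\<^sup>+x. ennreal (poisson_kernel e x))
      = 2 * (\<integral>\<^sup>+x. ennreal (poisson_kernel e x) * indicator {0..} x)"
    by (rule nn_integral_even) (auto simp: poisson_kernel_def)
  ultimately have "(\<integral>\<^sup>+x. ennreal (poisson_kernel e x)) = 2 * ennreal (pi / 2)" by simp
  also have "\<dots> = ennreal (2 * (pi / 2))" by (subst ennreal_mult') auto
  finally show ?thesis by simp
qed

lemma integrable_poisson_kernel:
  assumes e: "e > 0"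
  shows "integrable lborel (\<lambda>t. poisson_kernel e (x - t))" "(\<integral>t. poisson_kernel e (x - t)) = pi"
proof -
  have "(\<integral>\<^sup>+t. ennreal (poisson_kernel e (x - t))) = (\<integral>\<^sup>+t. ennreal (poisson_kernel e (t - x)))"
    by (intro nn_integral_cong) (simp add: poisson_kernel_def power2_commute)
  also have "\<dots> = ennreal pi"
    using nn_integral_translate_diff[of "\<lambda>t. ennreal (poisson_kernel e t)" x]
    by (simp add: nn_integral_poisson_kernel[OF e])
  finally have *: "(\<integral>\<^sup>+t. ennreal (poisson_kernel e (x - t))) = ennreal pi" .
  show "integrable lborel (\<lambda>t. poisson_kernel e (x - t))"
    using * poisson_kernel_nonneg[OF e] by (intro integrableI_nonneg) auto
  show "(\<integral>t. poisson_kernel e (x - t)) = pi"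
    using * poisson_kernel_nonneg[OF e] by (subst integral_eq_nn_integral) auto
qed

text \<open>
  Jensen's inequality and Fubini's theorem, as the Poisson kernel is positive with total mass \<open>\<pi>\<close>.
\<close>

lemma poisson_Lp_bound:
  assumes p: "1 < p" and e: "e > 0" and f: "bdd_supp f" and f0: "\<And>x. f x \<ge> 0"
  shows "(\<integral>\<^sup>+x. ennreal ((\<integral>t. f t * poisson_kernel e (x - t)) powr p))
     \<le> ennreal (pi powr p) * (\<integral>\<^sup>+x. ennreal (f x powr p))"
proof -
  have fm[measurable]: "f \<in> borel_measurable borel" using f by (rule bdd_supp_measurable)
  have fp: "bdd_supp (\<lambda>x. f x powr p)" using bdd_supp_powr[OF f, of p] p f0 by simp
  have bd: "\<bar>poisson_kernel e y\<bar> \<le> 1 / e" for y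
    using poisson_kernel_le[OF e, of y] poisson_kernel_nonneg[OF e, of y] by simp
  have i1: "integrable lborel (\<lambda>t. f t * poisson_kernel e (x - t))" for x
    by (rule integrable_bdd_supp_mult[OF f _ bd]) simp
  have i2: "integrable lborel (\<lambda>t. f t powr p * poisson_kernel e (x - t))" for x
    by (rule integrable_bdd_supp_mult[OF fp _ bd]) simp
  have "(\<integral>\<^sup>+x. ennreal ((\<integral>t. f t * poisson_kernel e (x - t)) powr p))
     \<le> (\<integral>\<^sup>+x. ennreal (pi powr (p - 1)) * (\<integral>\<^sup>+t. ennreal (f t powr p * poisson_kernel e (x - t))))"
  proof (intro nn_integral_mono)
    fix x
    have "(\<integral>t. f t * poisson_kernel e (x - t)) powr p
      \<le> pi powr (p - 1) * (\<integral>t. f t powr p * poisson_kernel e (x - t))"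
      using powr_integral_le[OF p integrable_poisson_kernel(1)[OF e, of x] _ _ f0 i1 i2]
      by (simp add: integrable_poisson_kernel(2)[OF e] poisson_kernel_nonneg[OF e])
    then have "ennreal ((\<integral>t. f t * poisson_kernel e (x - t)) powr p)
      \<le> ennreal (pi powr (p - 1) * (\<integral>t. f t powr p * poisson_kernel e (x - t)))"
      by (rule ennreal_leI)
    also have "\<dots> = ennreal (pi powr (p - 1)) * (\<integral>\<^sup>+t. ennreal (f t powr p * poisson_kernel e (x - t)))"
      using i2[of x] by (subst nn_integral_eq_integral)
        (auto simp: ennreal_mult' poisson_kernel_nonneg[OF e])
    finally show "ennreal ((\<integral>t. f t * poisson_kernel e (x - t)) powr p)
      \<le> ennreal (pi powr (p - 1)) * (\<integral>\<^sup>+t. ennreal (f t powr p * poisson_kernel e (x - t)))" .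
  qed
  also have "\<dots> = ennreal (pi powr (p - 1)) * (\<integral>\<^sup>+x. (\<integral>\<^sup>+t. ennreal (f t powr p * poisson_kernel e (x - t))))"
    by (rule nn_integral_cmult) measurable
  also have "(\<integral>\<^sup>+x. (\<integral>\<^sup>+t. ennreal (f t powr p * poisson_kernel e (x - t))))
     = (\<integral>\<^sup>+t. (\<integral>\<^sup>+x. ennreal (f t powr p * poisson_kernel e (x - t))))"
    by (rule lborel_pair.Fubini') measurable
  also have "\<dots> = (\<integral>\<^sup>+t. ennreal (f t powr p) * ennreal pi)"
  proof (intro nn_integral_cong)
    fix t
    have "(\<integral>\<^sup>+x. ennreal (f t powr p * poisson_kernel e (x - t)))
       = (\<integral>\<^sup>+x. ennreal (f t powr p) * ennreal (poisson_kernel e (x - t)))"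
      by (intro nn_integral_cong ennreal_mult) (auto simp: poisson_kernel_nonneg[OF e])
    also have "\<dots> = ennreal (f t powr p) * (\<integral>\<^sup>+x. ennreal (poisson_kernel e (x - t)))"
      by (rule nn_integral_cmult) measurable
    also have "(\<integral>\<^sup>+x. ennreal (poisson_kernel e (x - t))) = ennreal pi"
      using nn_integral_translate_diff[of "\<lambda>t. ennreal (poisson_kernel e t)" t]
      by (simp add: nn_integral_poisson_kernel[OF e])
    finally show "(\<integral>\<^sup>+x. ennreal (f t powr p * poisson_kernel e (x - t))) = ennreal (f t powr p) * ennreal pi" .
  qed
  also have "\<dots> = (\<integral>\<^sup>+t. ennreal (f t powr p)) * ennreal pi"
    by (rule nn_integral_multc) measurable
  also have "ennreal (pi powr (p - 1)) * ((\<integral>\<^sup>+t. ennreal (f t powr p)) * ennreal pi)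
     = ennreal (pi powr (p - 1) * pi) * (\<integral>\<^sup>+t. ennreal (f t powr p))"
    by (simp add: ennreal_mult' mult_ac)
  also have "pi powr (p - 1) * pi = pi powr p" by (simp add: powr_diff)
  finally show ?thesis .
qed

lemma cauchy_ext_Complex:
  assumes f: "integrable lborel f" and e: "e > 0"
  shows "Re (cauchy_ext f (Complex x e)) = (\<integral>t. f t * poisson_kernel e (x - t))"
    and "Im (cauchy_ext f (Complex x e)) = (\<integral>t. f t * conj_poisson_kernel e (x - t))"
proof -
  have eq: "\<i> / (Complex x e - complex_of_real t) = Complex (poisson_kernel e (x - t)) (conj_poisson_kernel e (x - t))" for t
    using e by (simp add: complex_eq_iff Re_divide Im_divide poisson_kernel_def conj_poisson_kernel_def)
  have i: "integrable lborel (\<lambda>t. complex_of_real (f t) * (\<i> / (Complex x e - complex_of_real t)))"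
    by (rule cauchy_ext_integrable[OF f]) (use e in simp)
  show "Re (cauchy_ext f (Complex x e)) = (\<integral>t. f t * poisson_kernel e (x - t))"
    unfolding cauchy_ext_def integral_Re[OF i, symmetric] by (simp add: eq)
  show "Im (cauchy_ext f (Complex x e)) = (\<integral>t. f t * conj_poisson_kernel e (x - t))"
    unfolding cauchy_ext_def integral_Im[OF i, symmetric] by (simp add: eq)
qed

lemma Re_cauchy_ext_pos:
  assumes f: "integrable lborel f" and f0: "\<And>x. f x \<ge> 0" and L: "(\<integral>t. f t) > 0" and z: "Im z > 0"
  shows "Re (cauchy_ext f z) > 0"
proof -
  define e x where "e = Im z" and "x = Re z"
  have z': "z = Complex x e" by (simp add: e_def x_def)
  have e: "e > 0" using z by (simp add: e_def)
  have [measurable]: "f \<in> borel_measurable borel" using f by auto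
  have i: "integrable lborel (\<lambda>t. f t * poisson_kernel e (x - t))"
  proof (rule Bochner_Integration.integrable_bound)
    show "integrable lborel (\<lambda>t. f t * (1 / e))" using f by simp
    show "AE t in lborel. norm (f t * poisson_kernel e (x - t)) \<le> norm (f t * (1 / e))"
    proof (rule AE_I2)
      fix t
      have "f t * poisson_kernel e (x - t) \<le> f t * (1 / e)"
        by (intro mult_left_mono poisson_kernel_le e f0)
      then show "norm (f t * poisson_kernel e (x - t)) \<le> norm (f t * (1 / e))"
        using f0 e poisson_kernel_nonneg[OF e] by (simp add: abs_mult)
    qed
  qed measurable
  have ge: "(\<integral>t. f t * poisson_kernel e (x - t)) \<ge> 0"
    using f0 poisson_kernel_nonneg[OF e] by (intro integral_nonneg_AE) auto
  have "(\<integral>t. f t * poisson_kernel e (x - t)) \<noteq> 0"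
  proof
    assume "(\<integral>t. f t * poisson_kernel e (x - t)) = 0"
    then have "AE t in lborel. f t * poisson_kernel e (x - t) = 0"
      using integral_nonneg_eq_0_iff_AE[OF i] f0 poisson_kernel_nonneg[OF e] by simp
    then have "AE t in lborel. f t = 0"
      by eventually_elim (use poisson_kernel_pos[OF e] in \<open>auto simp: less_le\<close>)
    then have "(\<integral>t. f t) = 0" by (rule integral_eq_zero_AE)
    with L show False by simp
  qed
  with ge show ?thesis unfolding z' cauchy_ext_Complex(1)[OF f e] by linarith
qed

lemma norm_cauchy_ext_le:
  assumes f: "integrable lborel f" and M: "\<And>x. \<bar>x\<bar> > M \<Longrightarrow> f x = 0" and z: "Im z > 0" "norm z > M"
  shows "norm (cauchy_ext f z) \<le> (\<integral>t. \<bar>f t\<bar>) / (norm z - M)"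
proof -
  have "norm (cauchy_ext f z) \<le> (\<integral>t. \<bar>f t\<bar> * (1 / (norm z - M)))"
    unfolding cauchy_ext_def
  proof (rule Bochner_Integration.integral_norm_bound_integral)
    fix t
    show "norm (complex_of_real (f t) * (\<i> / (z - complex_of_real t))) \<le> \<bar>f t\<bar> * (1 / (norm z - M))"
    proof (cases "\<bar>t\<bar> > M")
      case False
      have "norm z - M \<le> norm (z - complex_of_real t)"
        using norm_triangle_ineq2[of z "complex_of_real t"] False by simp
      then show ?thesis unfolding norm_mult norm_divide using z
        by (intro mult_mono) (auto intro!: divide_left_mono mult_pos_pos)
    qed (use M in simp)
  qed (use f cauchy_ext_integrable[OF f z(1)] in auto)
  then show ?thesis by simp
qed

text \<open>
  The power is holomorphic because the Cauchy extension has positive real part. By Cauchy's theorem the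
  integral over the segment is the negative of the one over the upper half-circle, whose length \<open>\<pi> R\<close> is
  outweighed by the bound \<open>(2 L / R) powr p\<close> for the integrand, \<open>L\<close> being the integral of \<open>f\<close>.
\<close>

lemma cauchy_ext_powr_integral_le:
  assumes f: "integrable lborel f" and f0: "\<And>x. f x \<ge> 0" and M: "\<And>x. \<bar>x\<bar> > M \<Longrightarrow> f x = 0"
    and L: "(\<integral>t. f t) > 0" and e: "e > 0" and R: "R > 0" "R \<ge> 2 * M" and p: "p > 1"
  shows "norm (integral {-R..R} (\<lambda>x. cauchy_ext f (Complex x e) powr complex_of_real p))
    \<le> (2 * (\<integral>t. f t)) powr p * pi * R powr (1 - p)"
proof -
  define L where "L = (\<integral>t. f t)"
  define S where "S = {z. Im z > - e}"
  define G where "G z = cauchy_ext f (z + \<i> * complex_of_real e) powr complex_of_real p" for z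
  define \<gamma> where "\<gamma> = linepath (complex_of_real (-R)) (complex_of_real R) +++ part_circlepath 0 R 0 pi"
  have L0: "L > 0" using L by (simp add: L_def)
  have S: "convex S" unfolding S_def using convex_halfspace_Im_gt by blast
  have holF: "(\<lambda>z. cauchy_ext f (z + \<i> * complex_of_real e)) holomorphic_on S"
    by (rule holomorphic_on_compose_gen[OF _ cauchy_ext_holomorphic[OF f], unfolded o_def])
      (auto intro!: holomorphic_intros simp: S_def)
  have ReF: "Re (cauchy_ext f (z + \<i> * complex_of_real e)) > 0" if "z \<in> S" for z
    using that by (intro Re_cauchy_ext_pos f f0 L) (auto simp: S_def)
  have holG: "G holomorphic_on S"
    unfolding G_def
  proof (intro holomorphic_intros holF)
    show "cauchy_ext f (z + \<i> * complex_of_real e) \<notin> \<real>\<^sub>\<le>\<^sub>0" if "z \<in> S" for z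
      using ReF[OF that] by (auto simp: complex_nonpos_Reals_iff)
  qed
  have circ: "path_image (part_circlepath 0 R 0 pi) \<subseteq> {z. norm z = R \<and> Im z \<ge> 0}"
    using R by (auto simp: path_image_part_circlepath norm_mult Im_exp intro!: mult_nonneg_nonneg sin_ge_zero)
  have seg: "path_image (linepath (complex_of_real (-R)) (complex_of_real R)) \<subseteq> {z. Im z = 0}"
    by (auto simp: closed_segment_def)
  have v: "valid_path \<gamma>" unfolding \<gamma>_def by (rule valid_path_join) auto
  have im: "path_image \<gamma> \<subseteq> S"
    unfolding \<gamma>_def using circ seg e by (auto simp: S_def path_image_join)
  have "(G has_contour_integral 0) \<gamma>"
  proof (rule Cauchy_theorem_convex_simple[OF holG S v im])
    show "pathfinish \<gamma> = pathstart \<gamma>"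
      by (simp add: \<gamma>_def exp_eq_polar pathstart_part_circlepath pathfinish_part_circlepath)
  qed
  then have 0: "contour_integral \<gamma> G = 0" by (rule contour_integral_unique)
  have c1: "G contour_integrable_on linepath (complex_of_real (-R)) (complex_of_real R)"
    using seg e by (intro contour_integrable_continuous_linepath continuous_on_subset[OF holomorphic_on_imp_continuous_on[OF holG]])
      (auto simp: S_def)
  have c2: "G contour_integrable_on part_circlepath 0 R 0 pi"
    using circ e by (intro contour_integrable_continuous_part_circlepath continuous_on_subset[OF holomorphic_on_imp_continuous_on[OF holG]])
      (auto simp: S_def)
  have "contour_integral (linepath (complex_of_real (-R)) (complex_of_real R)) G + contour_integral (part_circlepath 0 R 0 pi) G = 0"
    using 0 c1 c2 unfolding \<gamma>_def by (subst (asm) contour_integral_join) auto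
  moreover have "contour_integral (linepath (complex_of_real (-R)) (complex_of_real R)) G
      = integral {-R..R} (\<lambda>x. G (complex_of_real x))"
    using R by (subst contour_integral_linepath_Reals_eq) auto
  moreover have "G (complex_of_real x) = cauchy_ext f (Complex x e) powr complex_of_real p" for x
    by (simp add: G_def Complex_eq)
  ultimately have eq: "integral {-R..R} (\<lambda>x. cauchy_ext f (Complex x e) powr complex_of_real p)
      = - contour_integral (part_circlepath 0 R 0 pi) G"
    by (simp add: eq_neg_iff_add_eq_0)
  have "norm (contour_integral (part_circlepath 0 R 0 pi) G) \<le> (2 * L / R) powr p * R * \<bar>pi - 0\<bar>"
  proof (rule contour_integral_bound_part_circlepath[OF c2])
    fix z assume "z \<in> path_image (part_circlepath 0 R 0 pi)"
    then have z: "norm z = R" "Im z \<ge> 0" using circ by auto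
    define w where "w = z + \<i> * complex_of_real e"
    have Iw: "Im w > 0" using z e by (simp add: w_def)
    \<comment> \<open>Moving a point of the upper half-plane upwards does not decrease its modulus.\<close>
    have "(norm z)^2 \<le> (norm w)^2"
      using z e power_mono[of "Im z" "Im z + e" 2] unfolding cmod_power2 by (simp add: w_def)
    then have nw: "R \<le> norm w" using z by (simp add: power2_le_iff_abs_le)
    have "norm (cauchy_ext f w) \<le> (\<integral>t. \<bar>f t\<bar>) / (norm w - M)"
      by (rule norm_cauchy_ext_le[OF f M Iw]) (use nw R in linarith)+
    also have "\<dots> = L / (norm w - M)" using f0 by (simp add: L_def)
    also have "\<dots> \<le> L / (R / 2)"
      using nw R L0 by (intro divide_left_mono mult_pos_pos) linarith+
    finally have "norm (cauchy_ext f w) \<le> 2 * L / R" by (simp add: mult.commute)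
    moreover have "norm (G z) = norm (cauchy_ext f w) powr p"
      by (simp add: G_def w_def norm_powr_real_powr')
    ultimately show "norm (G z) \<le> (2 * L / R) powr p" using p by (simp add: powr_mono2)
  qed (use R in auto)
  also have "(2 * L / R) powr p * R * \<bar>pi - 0\<bar> = (2 * L) powr p * pi * (R powr (1 - p))"
    using R L0 by (simp add: powr_divide powr_diff)
  finally show ?thesis unfolding eq L_def by simp
qed

text \<open>
  The pointwise inequality \<open>riesz_pointwise\<close> is integrated over growing segments at height \<open>e\<close>. The
  holomorphic term tends to zero by \<open>cauchy_ext_powr_integral_le\<close>, and the real part is a Poisson
  integral, which \<open>poisson_Lp_bound\<close> controls by \<open>f\<close>.
\<close>

lemma riesz_nonneg:
  fixes p :: real
  assumes p: "1 < p" "p \<le> 2"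
  obtains C where "C \<ge> 0"
    "\<And>f e. e > 0 \<Longrightarrow> bdd_supp f \<Longrightarrow> (\<And>x. f x \<ge> 0) \<Longrightarrow>
      (\<integral>\<^sup>+x. ennreal (\<bar>\<integral>t. f t * conj_poisson_kernel e (x - t)\<bar> powr p))
        \<le> ennreal C * (\<integral>\<^sup>+x. ennreal (f x powr p))"
proof -
  obtain A B where A: "A \<ge> 0" and B: "B \<ge> 0" and
    AB: "\<And>z. Re z > 0 \<Longrightarrow> norm z powr p \<le> A * Re z powr p - B * Re (z powr complex_of_real p)"
    using riesz_pointwise[OF p] by blast
  have main: "(\<integral>\<^sup>+x. ennreal (\<bar>\<integral>t. f t * conj_poisson_kernel e (x - t)\<bar> powr p))
        \<le> ennreal (A * pi powr p) * (\<integral>\<^sup>+x. ennreal (f x powr p))"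
    if e: "e > 0" and f: "bdd_supp f" and f0: "\<And>x. f x \<ge> 0" for f e
  proof (cases "(\<integral>t. f t) > 0")
    case False
    have i: "integrable lborel f" using f by (rule bdd_supp_integrable)
    have "(\<integral>t. f t) \<ge> 0" by (rule integral_nonneg_AE) (simp add: f0)
    with False have "(\<integral>t. f t) = 0" by linarith
    then have ae: "AE t in lborel. f t = 0"
      using integral_nonneg_eq_0_iff_AE[OF i] f0 by simp
    have "(\<integral>t. f t * conj_poisson_kernel e (x - t)) = 0" for x
      by (rule integral_eq_zero_AE) (use ae in eventually_elim, simp)
    then show ?thesis using p by simp
  next
    case True
    define L where "L = (\<integral>t. f t)"
    have i: "integrable lborel f" using f by (rule bdd_supp_integrable)
    have [measurable]: "f \<in> borel_measurable borel" using f by (rule bdd_supp_measurable)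
    obtain M where M: "\<And>x. \<bar>x\<bar> > M \<Longrightarrow> f x = 0" using f by (auto simp: bdd_supp_def)
    define F where "F x = cauchy_ext f (Complex x e)" for x
    define a where "a = ennreal (A * pi powr p) * (\<integral>\<^sup>+x. ennreal (f x powr p))"
    \<comment> \<open>\<open>\<delta> n\<close> bounds the contribution of the holomorphic term on \<open>[-n, n]\<close>.\<close>
    define \<delta> where "\<delta> n = B * ((2 * L) powr p * pi * real n powr (1 - p))" for n
    have ReF: "Re (F x) > 0" for x
      unfolding F_def by (rule Re_cauchy_ext_pos[OF i f0 True]) (use e in simp)
    have contF: "continuous_on S F" for S
    proof -
      have "continuous_on {z. Im z > 0} (cauchy_ext f)"
        by (intro holomorphic_on_imp_continuous_on cauchy_ext_holomorphic i)
      moreover have "continuous_on S (\<lambda>x. Complex x e)"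
        unfolding Complex_eq by (intro continuous_intros)
      moreover have "(\<lambda>x. Complex x e) ` S \<subseteq> {z. Im z > 0}" using e by auto
      ultimately show ?thesis unfolding F_def by (rule continuous_on_compose2)
    qed
    have contFp: "continuous_on S (\<lambda>x. F x powr complex_of_real p)" for S
    proof (rule continuous_on_powr_complex[OF _ _ contF continuous_on_const])
      show "S \<subseteq> {x. 0 \<le> Re (F x) \<or> Im (F x) \<noteq> 0}" using ReF by (auto simp: less_imp_le)
      show "0 < Re (complex_of_real p)" if "F x = 0" for x using ReF[of x] that by simp
    qed
    have cRe: "continuous_on S (\<lambda>x. Re (F x) powr p)" for S
      using ReF p by (intro continuous_on_powr' continuous_on_const continuous_intros contF)
        (auto simp: less_imp_le)
    have cN: "continuous_on S (\<lambda>x. norm (F x) powr p)" for S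
      using p by (intro continuous_on_powr' continuous_on_const continuous_intros contF) auto
    have Fm[measurable]: "F \<in> borel_measurable borel"
      using contF[of UNIV] by (rule borel_measurable_continuous_onI)
    have ev: "\<forall>\<^sub>F n in sequentially. (\<integral>\<^sup>+x. ennreal (\<bar>Im (F x)\<bar> powr p) * indicator {- real n..real n} x)
        \<le> a + ennreal (\<delta> n)"
      using eventually_ge_at_top[of "nat \<lceil>2 * M\<rceil>"] eventually_gt_at_top[of 0]
    proof eventually_elim
      case (elim n)
      define R where "R = real n"
      have R: "R > 0" "R \<ge> 2 * M" using elim by (auto simp: R_def nat_ceiling_le_eq)
      define S where "S = {-R..R}"
      have int_Re: "(\<lambda>x. Re (F x) powr p) integrable_on S" and int_N: "(\<lambda>x. norm (F x) powr p) integrable_on S"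
        and int_F: "(\<lambda>x. F x powr complex_of_real p) integrable_on S"
        unfolding S_def by (intro integrable_continuous_real cRe cN contFp)+
      have Re_int: "((\<lambda>x. Re (F x powr complex_of_real p)) has_integral Re (integral S (\<lambda>x. F x powr complex_of_real p))) S"
        using has_integral_linear[OF integrable_integral[OF int_F] bounded_linear_Re] by (simp add: o_def)
      have "integral S (\<lambda>x. norm (F x) powr p) \<le> integral S (\<lambda>x. A * Re (F x) powr p - B * Re (F x powr complex_of_real p))"
        using int_Re Re_int by (intro integral_le int_N integrable_diff integrable_on_mult_right AB ReF) auto
      also have "\<dots> = A * integral S (\<lambda>x. Re (F x) powr p) - B * Re (integral S (\<lambda>x. F x powr complex_of_real p))"
        using int_Re Re_int by (subst Henstock_Kurzweil_Integration.integral_diff)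
          (auto intro!: integrable_on_mult_right simp: integral_unique)
      finally have le1: "integral S (\<lambda>x. norm (F x) powr p)
        \<le> A * integral S (\<lambda>x. Re (F x) powr p) - B * Re (integral S (\<lambda>x. F x powr complex_of_real p))" .
      have "norm (integral S (\<lambda>x. F x powr complex_of_real p)) \<le> (2 * L) powr p * pi * R powr (1 - p)"
        unfolding S_def F_def L_def by (rule cauchy_ext_powr_integral_le[OF i f0 M True e R p(1)])
      then have "- Re (integral S (\<lambda>x. F x powr complex_of_real p)) \<le> (2 * L) powr p * pi * R powr (1 - p)"
        using abs_Re_le_cmod[of "integral S (\<lambda>x. F x powr complex_of_real p)"] by linarith
      then have "B * (- Re (integral S (\<lambda>x. F x powr complex_of_real p))) \<le> \<delta> n"
        unfolding \<delta>_def R_def[symmetric] using B by (rule mult_left_mono)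
      with le1 have le: "integral S (\<lambda>x. norm (F x) powr p) \<le> A * integral S (\<lambda>x. Re (F x) powr p) + \<delta> n"
        by simp
      have "(\<integral>\<^sup>+x. ennreal (\<bar>Im (F x)\<bar> powr p) * indicator S x)
         \<le> (\<integral>\<^sup>+x. ennreal (norm (F x) powr p) * indicator S x)"
        using p by (intro nn_integral_mono mult_right_mono ennreal_leI powr_mono2 abs_Im_le_cmod) auto
      also have "\<dots> = ennreal (integral S (\<lambda>x. norm (F x) powr p))"
        unfolding S_def by (intro nn_integral_continuous_interval cN) auto
      also have "\<dots> \<le> ennreal (A * integral S (\<lambda>x. Re (F x) powr p) + \<delta> n)"
        by (rule ennreal_leI[OF le])
      also have "\<dots> = ennreal A * ennreal (integral S (\<lambda>x. Re (F x) powr p)) + ennreal (\<delta> n)"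
        using A B by (subst ennreal_plus) (auto simp: \<delta>_def ennreal_mult' intro!: mult_nonneg_nonneg Henstock_Kurzweil_Integration.integral_nonneg int_Re)
      also have "ennreal (integral S (\<lambda>x. Re (F x) powr p)) = (\<integral>\<^sup>+x. ennreal (Re (F x) powr p) * indicator S x)"
        unfolding S_def by (intro nn_integral_continuous_interval[symmetric] cRe) auto
      also have "\<dots> \<le> (\<integral>\<^sup>+x. ennreal (Re (F x) powr p))"
        by (intro nn_integral_mono) (auto simp: indicator_def)
      also have "\<dots> \<le> ennreal (pi powr p) * (\<integral>\<^sup>+x. ennreal (f x powr p))"
        unfolding F_def cauchy_ext_Complex(1)[OF i e] by (rule poisson_Lp_bound[OF p(1) e f f0])
      also have "ennreal A * (ennreal (pi powr p) * (\<integral>\<^sup>+x. ennreal (f x powr p))) = a"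
        using A by (simp add: a_def ennreal_mult' mult.assoc)
      finally show ?case by (simp add: S_def R_def mult_left_mono add_right_mono)
    qed
    have lim: "(\<lambda>n. a + ennreal (\<delta> n)) \<longlonglongrightarrow> a"
    proof -
      have "(\<lambda>n. real n powr (1 - p)) \<longlonglongrightarrow> 0"
        using p by (intro tendsto_neg_powr filterlim_real_sequentially) auto
      then have "\<delta> \<longlonglongrightarrow> B * ((2 * L) powr p * pi * 0)" unfolding \<delta>_def by (intro tendsto_intros)
      then have "(\<lambda>n. a + ennreal (\<delta> n)) \<longlonglongrightarrow> a + ennreal 0"
        by (intro tendsto_add tendsto_const tendsto_ennrealI) simp
      then show ?thesis by simp
    qed
    have "(\<integral>\<^sup>+x. ennreal (\<bar>Im (F x)\<bar> powr p)) \<le> a"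
      by (rule nn_integral_le_of_fatou[OF _ _ ev lim]) (auto intro: tendsto_mult_indicator_exhaust)
    then show ?thesis unfolding F_def cauchy_ext_Complex(2)[OF i e] a_def .
  qed
  show ?thesis by (rule that[OF _ main]) (use A in auto)
qed

lemma powr_sum4_le:
  fixes a b c d p :: real
  assumes "0 \<le> a" "0 \<le> b" "0 \<le> c" "0 \<le> d" "p > 0"
  shows "(a + b + c + d) powr p \<le> 4 powr p * (a powr p + b powr p + c powr p + d powr p)"
proof -
  define m where "m = max (max a b) (max c d)"
  have "(a + b + c + d) powr p \<le> (4 * m) powr p"
    using assms by (intro powr_mono2) (auto simp: m_def)
  also have "\<dots> = 4 powr p * m powr p" using assms by (simp add: powr_mult m_def)
  also have "m powr p \<le> a powr p + b powr p + c powr p + d powr p"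
    unfolding m_def max_def by (simp add: add_increasing add_increasing2)
  finally show ?thesis by simp
qed

text \<open>
  A complex function is a combination of four nonnegative ones, each bounded by its absolute value.
\<close>

lemma riesz_conj_poisson:
  fixes p :: real
  assumes p: "1 < p" "p \<le> 2"
  obtains C where "C \<ge> 0"
    "\<And>f e. e > 0 \<Longrightarrow> bdd_supp (f :: real \<Rightarrow> complex) \<Longrightarrow>
      Lp_mass p (\<lambda>x. \<integral>t. f t * complex_of_real (conj_poisson_kernel e (x - t)))
        \<le> ennreal C * Lp_mass p f"
proof -
  obtain C where C: "C \<ge> 0" and riesz: "\<And>f e. e > 0 \<Longrightarrow> bdd_supp f \<Longrightarrow> (\<And>x. f x \<ge> 0) \<Longrightarrow>
      (\<integral>\<^sup>+x. ennreal (\<bar>\<integral>t. f t * conj_poisson_kernel e (x - t)\<bar> powr p))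
        \<le> ennreal C * (\<integral>\<^sup>+x. ennreal (f x powr p))"
    using riesz_nonneg[OF p] by blast
  have main: "Lp_mass p (\<lambda>x. \<integral>t. f t * complex_of_real (conj_poisson_kernel e (x - t)))
        \<le> ennreal (4 powr p * (4 * C)) * Lp_mass p f"
    if e: "e > 0" and f: "bdd_supp (f :: real \<Rightarrow> complex)" for f e
  proof -
    define T where "T g x = (\<integral>t. g t * conj_poisson_kernel e (x - t))" for g x
    define I where "I = Lp_mass p f"
    have fm[measurable]: "f \<in> borel_measurable borel" using f by (rule bdd_supp_measurable)
    have part: "bdd_supp g" "(\<integral>\<^sup>+x. ennreal (\<bar>T g x\<bar> powr p)) \<le> ennreal C * I"
      if [measurable]: "g \<in> borel_measurable borel" and g: "\<And>x. 0 \<le> g x" "\<And>x. g x \<le> norm (f x)" for g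
    proof -
      obtain B M where BM: "\<And>x. norm (f x) \<le> B" "\<And>x. norm x > M \<Longrightarrow> f x = 0"
        using f by (auto simp: bdd_supp_def)
      have "norm (g x) \<le> B" for x using g[of x] BM(1)[of x] by simp
      moreover have "g x = 0" if "norm x > M" for x using g[of x] BM(2)[OF that] by simp
      ultimately show g': "bdd_supp g" unfolding bdd_supp_def by auto
      have "(\<integral>\<^sup>+x. ennreal (\<bar>T g x\<bar> powr p)) \<le> ennreal C * (\<integral>\<^sup>+x. ennreal (g x powr p))"
        unfolding T_def by (rule riesz[OF e g' g(1)])
      also have "\<dots> \<le> ennreal C * I"
        unfolding I_def using g p by (intro mult_left_mono nn_integral_mono ennreal_leI powr_mono2) auto
      finally show "(\<integral>\<^sup>+x. ennreal (\<bar>T g x\<bar> powr p)) \<le> ennreal C * I" .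
    qed
    define g1 g2 g3 g4 where "g1 x = max 0 (Re (f x))" and "g2 x = max 0 (- Re (f x))"
      and "g3 x = max 0 (Im (f x))" and "g4 x = max 0 (- Im (f x))" for x
    have [measurable]: "g1 \<in> borel_measurable borel" "g2 \<in> borel_measurable borel"
      "g3 \<in> borel_measurable borel" "g4 \<in> borel_measurable borel"
      unfolding g1_def g2_def g3_def g4_def by measurable
    have le: "g1 x \<le> norm (f x)" "g2 x \<le> norm (f x)" "g3 x \<le> norm (f x)" "g4 x \<le> norm (f x)" for x
      using abs_Re_le_cmod[of "f x"] abs_Im_le_cmod[of "f x"] by (auto simp: g1_def g2_def g3_def g4_def)
    have nn: "0 \<le> g1 x" "0 \<le> g2 x" "0 \<le> g3 x" "0 \<le> g4 x" for x
      by (auto simp: g1_def g2_def g3_def g4_def)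
    note t1 = part[of g1, OF _ nn(1) le(1), simplified] and t2 = part[of g2, OF _ nn(2) le(2), simplified]
      and t3 = part[of g3, OF _ nn(3) le(3), simplified] and t4 = part[of g4, OF _ nn(4) le(4), simplified]
    have int: "integrable lborel (\<lambda>t. g t * conj_poisson_kernel e (x - t))" if "bdd_supp g" for g x
      by (rule integrable_bdd_supp_mult[OF that _ conj_poisson_kernel_le[OF e]]) simp
    have fdec: "f t = complex_of_real (g1 t) - complex_of_real (g2 t) + \<i> * (complex_of_real (g3 t) - complex_of_real (g4 t))" for t
      by (auto simp: complex_eq_iff g1_def g2_def g3_def g4_def)
    have dec: "(\<integral>t. f t * complex_of_real (conj_poisson_kernel e (x - t)))
       = complex_of_real (T g1 x) - complex_of_real (T g2 x) + \<i> * (complex_of_real (T g3 x) - complex_of_real (T g4 x))" for x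
    proof -
      have "(\<integral>t. f t * complex_of_real (conj_poisson_kernel e (x - t)))
         = (\<integral>t. complex_of_real (g1 t * conj_poisson_kernel e (x - t)) - complex_of_real (g2 t * conj_poisson_kernel e (x - t))
           + \<i> * (complex_of_real (g3 t * conj_poisson_kernel e (x - t)) - complex_of_real (g4 t * conj_poisson_kernel e (x - t))))"
        by (intro Bochner_Integration.integral_cong refl, subst fdec) (simp add: algebra_simps)
      also have "\<dots> = complex_of_real (T g1 x) - complex_of_real (T g2 x) + \<i> * (complex_of_real (T g3 x) - complex_of_real (T g4 x))"
        using int[OF t1(1), of x] int[OF t2(1), of x] int[OF t3(1), of x] int[OF t4(1), of x]
        unfolding T_def by (simp del: of_real_mult)
      finally show ?thesis .
    qed
    have [measurable]: "T g \<in> borel_measurable borel" if [measurable]: "g \<in> borel_measurable borel" for g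
      unfolding T_def by measurable
    have "Lp_mass p (\<lambda>x. \<integral>t. f t * complex_of_real (conj_poisson_kernel e (x - t)))
      \<le> (\<integral>\<^sup>+x. ennreal (4 powr p) * (ennreal (\<bar>T g1 x\<bar> powr p) + ennreal (\<bar>T g2 x\<bar> powr p)
           + ennreal (\<bar>T g3 x\<bar> powr p) + ennreal (\<bar>T g4 x\<bar> powr p)))"
    proof (intro nn_integral_mono)
      fix x
      have "norm (\<integral>t. f t * complex_of_real (conj_poisson_kernel e (x - t)))
        \<le> norm (complex_of_real (T g1 x) - complex_of_real (T g2 x)) + norm (\<i> * (complex_of_real (T g3 x) - complex_of_real (T g4 x)))"
        unfolding dec by (rule norm_triangle_ineq)
      also have "\<dots> \<le> \<bar>T g1 x\<bar> + \<bar>T g2 x\<bar> + \<bar>T g3 x\<bar> + \<bar>T g4 x\<bar>"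
        using norm_triangle_ineq4[of "complex_of_real (T g1 x)" "complex_of_real (T g2 x)"]
          norm_triangle_ineq4[of "complex_of_real (T g3 x)" "complex_of_real (T g4 x)"]
        by (simp add: norm_mult)
      finally have "norm (\<integral>t. f t * complex_of_real (conj_poisson_kernel e (x - t))) powr p
         \<le> (\<bar>T g1 x\<bar> + \<bar>T g2 x\<bar> + \<bar>T g3 x\<bar> + \<bar>T g4 x\<bar>) powr p"
        using p by (intro powr_mono2) auto
      also have "\<dots> \<le> 4 powr p * (\<bar>T g1 x\<bar> powr p + \<bar>T g2 x\<bar> powr p + \<bar>T g3 x\<bar> powr p + \<bar>T g4 x\<bar> powr p)"
        using p by (intro powr_sum4_le) auto
      finally show "ennreal (norm (\<integral>t. f t * complex_of_real (conj_poisson_kernel e (x - t))) powr p)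
         \<le> ennreal (4 powr p) * (ennreal (\<bar>T g1 x\<bar> powr p) + ennreal (\<bar>T g2 x\<bar> powr p)
           + ennreal (\<bar>T g3 x\<bar> powr p) + ennreal (\<bar>T g4 x\<bar> powr p))"
        by (simp add: ennreal_mult'[symmetric] ennreal_plus[symmetric] del: ennreal_plus)
    qed
    also have "\<dots> = ennreal (4 powr p) * ((\<integral>\<^sup>+x. ennreal (\<bar>T g1 x\<bar> powr p)) + (\<integral>\<^sup>+x. ennreal (\<bar>T g2 x\<bar> powr p))
           + (\<integral>\<^sup>+x. ennreal (\<bar>T g3 x\<bar> powr p)) + (\<integral>\<^sup>+x. ennreal (\<bar>T g4 x\<bar> powr p)))"
      by (subst nn_integral_cmult, measurable)+ (subst nn_integral_add, measurable)+
    also have "\<dots> \<le> ennreal (4 powr p) * (ennreal C * I + ennreal C * I + ennreal C * I + ennreal C * I)"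
      by (intro mult_left_mono add_mono t1(2) t2(2) t3(2) t4(2)) simp
    also have "ennreal C * I + ennreal C * I + ennreal C * I + ennreal C * I = ennreal (4 * C) * I"
    proof -
      have "ennreal (4 * C) = ennreal C + ennreal C + ennreal C + ennreal C"
        using C by (simp add: ennreal_plus[symmetric] del: ennreal_plus)
      then show ?thesis by (simp add: distrib_right)
    qed
    also have "ennreal (4 powr p) * (ennreal (4 * C) * I) = ennreal (4 powr p * (4 * C)) * I"
      by (simp add: ennreal_mult' mult.assoc)
    finally show ?thesis unfolding I_def .
  qed
  show ?thesis by (rule that[OF _ main]) (use C in auto)
qed

section \<open>Kernels whose Fourier transform has bounded variation\<close>

lemma (in pair_sigma_finite) integrable_pair_mult:
  fixes f :: "'a \<Rightarrow> complex" and g :: "'b \<Rightarrow> complex"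
  assumes f: "integrable M1 f" and g: "integrable M2 g"
  shows "integrable (M1 \<Otimes>\<^sub>M M2) (\<lambda>z. f (fst z) * g (snd z))"
proof (rule Fubini_integrable)
  have [measurable]: "f \<in> borel_measurable M1" "g \<in> borel_measurable M2" using f g by auto
  show "(\<lambda>z. f (fst z) * g (snd z)) \<in> borel_measurable (M1 \<Otimes>\<^sub>M M2)" by measurable
  show "integrable M1 (\<lambda>x. \<integral>y. norm (f (fst (x, y)) * g (snd (x, y))) \<partial>M2)"
    using f g by (simp add: norm_mult)
  show "AE x in M1. integrable M2 (\<lambda>y. f (fst (x, y)) * g (snd (x, y)))"
    using g by simp
qed

definition kernel_form :: "(real \<Rightarrow> complex) \<Rightarrow> (real \<Rightarrow> complex) \<Rightarrow> (real \<Rightarrow> complex) \<Rightarrow> complex" where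
  "kernel_form k f g = (\<integral>x. (\<integral>y. f y * k (x - y)) * g x)"

lemma cis_measurable [measurable]: "cis \<in> borel_measurable borel"
  by (intro borel_measurable_continuous_onI continuous_on_cis continuous_on_id)

lemma cis_linear_measurable: "(\<lambda>y. cis (y * t)) \<in> borel_measurable borel"
  and cis_linear_measurable': "(\<lambda>y. cis (- (y * t))) \<in> borel_measurable borel"
  by (intro borel_measurable_continuous_onI continuous_on_cis continuous_intros)+

lemma kernel_form_integrable:
  fixes f g :: "real \<Rightarrow> complex"
  assumes f: "integrable lborel f" and g: "integrable lborel g"
    and [measurable]: "k \<in> borel_measurable borel" and B: "\<And>s. norm (k s) \<le> B"
  shows "integrable (lborel \<Otimes>\<^sub>M lborel) (\<lambda>z. (g (fst z) * f (snd z)) * k (fst z - snd z :: real))"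
  by (rule integrable_mult_bounded[OF lborel_pair.integrable_pair_mult[OF g f] _ B]) measurable

lemma kernel_form_eq_pair:
  assumes f: "integrable lborel f" and g: "integrable lborel g"
    and k: "k \<in> borel_measurable borel" and B: "\<And>s. norm (k s) \<le> B"
  shows "kernel_form k f g = (\<integral>z. (g (fst z) * f (snd z)) * k (fst z - snd z) \<partial>(lborel \<Otimes>\<^sub>M lborel))"
  unfolding lborel_pair.integral_fst'[OF kernel_form_integrable[OF assms], symmetric] kernel_form_def
  by (simp add: mult.assoc) (simp add: mult.commute)

lemma kernel_form_commute:
  assumes f: "integrable lborel f" and g: "integrable lborel g"
    and k[measurable]: "k \<in> borel_measurable borel" and B: "\<And>s. norm (k s) \<le> B" and even: "\<And>s. k (- s) = k s"
  shows "kernel_form k f g = kernel_form k g f"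
proof -
  have [measurable]: "f \<in> borel_measurable borel" "g \<in> borel_measurable borel" using f g by auto
  have "kernel_form k f g = (\<integral>z. (g (fst z) * f (snd z)) * k (fst z - snd z) \<partial>(lborel \<Otimes>\<^sub>M lborel))"
    by (rule kernel_form_eq_pair[OF f g k B])
  also have "\<dots> = (\<integral>(x,y). (g (fst (y,x)) * f (snd (y,x))) * k (fst (y,x) - snd (y,x)) \<partial>(lborel \<Otimes>\<^sub>M lborel))"
    by (rule lborel_pair.integral_product_swap[symmetric]) measurable
  also have "\<dots> = (\<integral>z. (f (fst z) * g (snd z)) * k (fst z - snd z) \<partial>(lborel \<Otimes>\<^sub>M lborel))"
    using even[of "snd z - fst z" for z] by (intro Bochner_Integration.integral_cong refl) (auto simp: mult_ac)
  also have "\<dots> = kernel_form k g f" by (rule kernel_form_eq_pair[OF g f k B, symmetric])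
  finally show ?thesis .
qed

text \<open>
  Each character \<open>cis ((x - y) * t)\<close> splits into a factor in \<open>x\<close> and a factor in \<open>y\<close>. These are absorbed
  into \<open>g\<close> and \<open>f\<close> without changing absolute values, so that a bound for the form with kernel \<open>q\<close> carries
  over to \<open>q\<close> times any superposition of characters.
\<close>

lemma kernel_form_modulated_superposition:
  assumes f: "integrable lborel f" and g: "integrable lborel g"
    and q[measurable]: "q \<in> borel_measurable borel" and B: "\<And>s. norm (q s) \<le> B"
    and \<phi>: "integrable lborel \<phi>"
  shows "kernel_form (\<lambda>s. q s * (\<integral>t. \<phi> t * cis (s * t))) f g
    = (\<integral>t. \<phi> t * kernel_form q (\<lambda>y. f y * cis (- (y * t))) (\<lambda>x. g x * cis (x * t)))"
proof -
  interpret P: pair_sigma_finite "lborel \<Otimes>\<^sub>M lborel :: (real \<times> real) measure" "lborel :: real measure"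
    by (simp add: pair_sigma_finite_def lborel_prod lborel.sigma_finite_measure_axioms)
  have [measurable]: "f \<in> borel_measurable borel" "g \<in> borel_measurable borel" "\<phi> \<in> borel_measurable borel"
    using f g \<phi> by auto
  define h where "h z = (g (fst z) * f (snd z)) * q (fst z - snd z)" for z
  have h: "integrable (lborel \<Otimes>\<^sub>M lborel) h"
    unfolding h_def by (rule kernel_form_integrable[OF f g q B])
  then have [measurable]: "h \<in> borel_measurable (lborel \<Otimes>\<^sub>M lborel)" by auto
  define \<psi> where "\<psi> s = (\<integral>t. \<phi> t * cis (s * t))" for s
  have m[measurable]: "(\<lambda>s. q s * \<psi> s) \<in> borel_measurable borel" unfolding \<psi>_def by measurable
  have "norm (\<psi> s) \<le> (\<integral>t. norm (\<phi> t))" for s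
    unfolding \<psi>_def by (rule order_trans[OF integral_norm_bound]) (simp add: norm_mult)
  then have bd: "norm (q s * \<psi> s) \<le> B * (\<integral>t. norm (\<phi> t))" for s
    unfolding norm_mult using B order_trans[OF norm_ge_zero B] by (intro mult_mono) auto
  have "kernel_form (\<lambda>s. q s * \<psi> s) f g = (\<integral>z. h z * \<psi> (fst z - snd z) \<partial>(lborel \<Otimes>\<^sub>M lborel))"
    by (subst kernel_form_eq_pair[OF f g m bd]) (simp add: h_def mult.assoc)
  also have "\<dots> = (\<integral>z. (\<integral>t. h z * \<phi> t * cis ((fst z - snd z) * t)) \<partial>(lborel \<Otimes>\<^sub>M lborel))"
    unfolding \<psi>_def by (simp add: mult.assoc)
  also have "\<dots> = (\<integral>t. (\<integral>z. h z * \<phi> t * cis ((fst z - snd z) * t) \<partial>(lborel \<Otimes>\<^sub>M lborel)))"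
  proof (rule P.Fubini_integral[symmetric])
    have "integrable ((lborel \<Otimes>\<^sub>M lborel) \<Otimes>\<^sub>M lborel)
       (\<lambda>w. (h (fst w) * \<phi> (snd w)) * cis ((fst (fst w) - snd (fst w)) * snd w))"
    proof (rule integrable_mult_bounded[OF P.integrable_pair_mult[OF h \<phi>], where B=1])
      have "(\<lambda>w::(real \<times> real) \<times> real. cis ((fst (fst w) - snd (fst w)) * snd w)) \<in> borel_measurable borel"
        by (intro borel_measurable_continuous_onI continuous_on_cis continuous_intros)
      then show "(\<lambda>w::(real \<times> real) \<times> real. cis ((fst (fst w) - snd (fst w)) * snd w))
          \<in> borel_measurable ((lborel \<Otimes>\<^sub>M lborel) \<Otimes>\<^sub>M lborel)"
        by (simp add: lborel_prod)
    qed simp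
    then show "integrable ((lborel \<Otimes>\<^sub>M lborel) \<Otimes>\<^sub>M lborel)
       (\<lambda>(z, t). h z * \<phi> t * cis ((fst z - snd z) * t))"
      by (simp add: case_prod_unfold)
  qed
  also have "\<dots> = (\<integral>t. \<phi> t * kernel_form q (\<lambda>y. f y * cis (- (y * t))) (\<lambda>x. g x * cis (x * t)))"
  proof (intro Bochner_Integration.integral_cong refl)
    fix t
    have f': "integrable lborel (\<lambda>y. f y * cis (- (y * t)))"
      by (rule integrable_mult_bounded[OF f, where B=1]) (simp_all add: cis_linear_measurable cis_linear_measurable'[simplified])
    have g': "integrable lborel (\<lambda>y. g y * cis (y * t))"
      by (rule integrable_mult_bounded[OF g, where B=1]) (simp_all add: cis_linear_measurable cis_linear_measurable'[simplified])
    have eq: "h z * \<phi> t * cis ((fst z - snd z) * t)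
       = \<phi> t * (((g (fst z) * cis (fst z * t)) * (f (snd z) * cis (- (snd z * t)))) * q (fst z - snd z))" for z
      using cis_mult[of "fst z * t" "- (snd z * t)"] by (simp add: h_def algebra_simps)
    have "(\<integral>z. h z * \<phi> t * cis ((fst z - snd z) * t) \<partial>(lborel \<Otimes>\<^sub>M lborel))
       = \<phi> t * (\<integral>z. ((g (fst z) * cis (fst z * t)) * (f (snd z) * cis (- (snd z * t)))) * q (fst z - snd z) \<partial>(lborel \<Otimes>\<^sub>M lborel))"
      by (simp only: eq integral_mult_right_zero)
    then show "(\<integral>z. h z * \<phi> t * cis ((fst z - snd z) * t) \<partial>(lborel \<Otimes>\<^sub>M lborel))
      = \<phi> t * kernel_form q (\<lambda>y. f y * cis (- (y * t))) (\<lambda>x. g x * cis (x * t))"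
      by (simp add: kernel_form_eq_pair[OF f' g' q B])
  qed
  finally show ?thesis unfolding \<psi>_def .
qed

definition Lp_integral :: "real \<Rightarrow> (real \<Rightarrow> complex) \<Rightarrow> real" where
  "Lp_integral p f = (\<integral>x. norm (f x) powr p)"

lemma Lp_integral_nonneg: "Lp_integral p f \<ge> 0"
  by (simp add: Lp_integral_def)

lemma nn_integral_eq_Lp_integral:
  assumes "bdd_supp f" "p > 0"
  shows "Lp_mass p f = ennreal (Lp_integral p f)"
  unfolding Lp_integral_def
  by (rule nn_integral_eq_integral) (auto intro: bdd_supp_integrable bdd_supp_powr assms)

lemma bdd_supp_mult_unimodular:
  fixes f :: "real \<Rightarrow> complex"
  assumes "bdd_supp f" "u \<in> borel_measurable borel" "\<And>x. norm (u x) = 1"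
  shows "bdd_supp (\<lambda>x. f x * u x)"
  using assms unfolding bdd_supp_def by (auto simp: norm_mult)

text \<open>
  Young's inequality replaces the inequality of Hoelder: the sum of the two integrals on the right is
  weaker than the product of norms, but the product is recovered later by scaling one of the functions.
\<close>

lemma conj_poisson_form_bound:
  fixes p q :: real
  assumes p: "1 < p" "p \<le> 2" and pq: "1 / p + 1 / q = 1"
  obtains C where "C \<ge> 0"
    "\<And>f g e. e > 0 \<Longrightarrow> bdd_supp f \<Longrightarrow> bdd_supp g \<Longrightarrow>
       norm (kernel_form (\<lambda>s. complex_of_real (conj_poisson_kernel e s)) f g) \<le> C * (Lp_integral p f + Lp_integral q g)"
proof -
  obtain C where C: "C \<ge> 0" and riesz:
    "\<And>f e. e > 0 \<Longrightarrow> bdd_supp (f :: real \<Rightarrow> complex) \<Longrightarrow>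
      Lp_mass p (\<lambda>x. \<integral>t. f t * complex_of_real (conj_poisson_kernel e (x - t)))
        \<le> ennreal C * Lp_mass p f"
    using riesz_conj_poisson[OF p] by blast
  have "1 / p < 1" "1 / p > 0" using p by auto
  then have q': "1 / q > 0" "1 / q < 1" using pq by linarith+
  then have "q > 0" by simp
  with q'(2) have q: "q > 1" by simp
  have "norm (kernel_form (\<lambda>s. complex_of_real (conj_poisson_kernel e s)) f g)
     \<le> (C + 1) * (Lp_integral p f + Lp_integral q g)"
    if e: "e > 0" and f: "bdd_supp f" and g: "bdd_supp g" for f g e
  proof -
    define T where "T x = (\<integral>t. f t * complex_of_real (conj_poisson_kernel e (x - t)))" for x
    have [measurable]: "f \<in> borel_measurable borel" "g \<in> borel_measurable borel"
      using f g by (auto intro: bdd_supp_measurable)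
    have [measurable]: "T \<in> borel_measurable borel" unfolding T_def by measurable
    have "ennreal (norm (\<integral>x. T x * g x)) \<le> L1_mass (\<lambda>x. T x * g x)"
      by (cases "integrable lborel (\<lambda>x. T x * g x)")
        (auto intro: integral_norm_bound_ennreal simp: not_integrable_integral_eq)
    also have "\<dots> \<le> (\<integral>\<^sup>+x. ennreal (norm (T x) powr p) + ennreal (norm (g x) powr q))"
    proof (rule nn_integral_mono)
      fix x
      have "norm (T x * g x) \<le> norm (T x) powr p / p + norm (g x) powr q / q"
        unfolding norm_mult using p q pq by (intro Youngs_inequality) auto
      also have "\<dots> \<le> norm (T x) powr p + norm (g x) powr q"
        using p q by (intro add_mono) (auto simp: divide_le_eq mult_le_cancel_left1)
      finally show "ennreal (norm (T x * g x)) \<le> ennreal (norm (T x) powr p) + ennreal (norm (g x) powr q)"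
        by (simp add: ennreal_plus[symmetric] del: ennreal_plus)
    qed
    also have "\<dots> = Lp_mass p T + Lp_mass q g"
      by (rule nn_integral_add) measurable
    also have "\<dots> \<le> ennreal C * ennreal (Lp_integral p f) + ennreal (Lp_integral q g)"
      using riesz[OF e f] p q unfolding T_def
      by (intro add_mono) (simp_all add: nn_integral_eq_Lp_integral f g)
    also have "\<dots> = ennreal (C * Lp_integral p f + Lp_integral q g)"
      using C by (simp add: ennreal_mult' ennreal_plus Lp_integral_nonneg)
    finally have "norm (\<integral>x. T x * g x) \<le> C * Lp_integral p f + Lp_integral q g"
      using C by (subst (asm) ennreal_le_iff) (auto simp: Lp_integral_nonneg)
    also have "\<dots> \<le> (C + 1) * (Lp_integral p f + Lp_integral q g)"
      using C Lp_integral_nonneg[of p f] Lp_integral_nonneg[of q g] by (simp add: algebra_simps)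
    finally show ?thesis by (simp add: kernel_form_def T_def)
  qed
  with C that[of "C + 1"] show ?thesis by auto
qed

lemma AE_pair_neq: "AE z in lborel \<Otimes>\<^sub>M lborel. fst z \<noteq> (snd z :: real)"
proof (rule lborel_pair.AE_pair_measure)
  show "{x \<in> space (lborel \<Otimes>\<^sub>M lborel). fst x \<noteq> (snd x :: real)} \<in> sets (lborel \<Otimes>\<^sub>M lborel)"
    by measurable
  show "AE x in lborel. AE y in lborel. fst (x, y) \<noteq> (snd (x, y) :: real)"
  proof (rule AE_I2)
    fix x :: real
    show "AE y in lborel. fst (x, y) \<noteq> (snd (x, y) :: real)"
      using AE_lborel_singleton[of x] by eventually_elim auto
  qed
qed

text \<open>
  When \<open>k\<close> is the inverse Fourier transform of \<open>m\<close>, integration by parts gives such a \<open>\<phi>\<close>, namely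
  \<open>\<i> / (2 * \<pi>)\<close> times the derivative of \<open>m\<close>. Thus \<open>V\<close> bounds the total variation of \<open>m\<close>, divided by
  \<open>2 * \<pi>\<close>.
\<close>

definition bv_kernel :: "real \<Rightarrow> (real \<Rightarrow> complex) \<Rightarrow> bool" where
  "bv_kernel V k \<longleftrightarrow> k \<in> borel_measurable borel \<and> bounded (range k) \<and> (\<forall>s. k (- s) = k s) \<and>
     (\<exists>\<phi>. integrable lborel \<phi> \<and> (\<integral>t. norm (\<phi> t)) \<le> V \<and>
        (\<forall>s. complex_of_real s * k s = (\<integral>t. \<phi> t * cis (s * t))))"

text \<open>
  The kernels \<open>k s * s\<^sup>2 / (s\<^sup>2 + e\<^sup>2)\<close> converge to \<open>k\<close> as \<open>e\<close> tends to zero, and they are products of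
  \<open>s * k s\<close>, a superposition of characters, with the conjugate Poisson kernel. The bound for the latter
  does not depend on \<open>e\<close>.
\<close>

lemma kernel_form_bv_bound_le2:
  fixes p q :: real
  assumes p: "1 < p" "p \<le> 2" and pq: "1 / p + 1 / q = 1"
  obtains C where "C \<ge> 0"
    "\<And>V k f g. bv_kernel V k \<Longrightarrow> bdd_supp f \<Longrightarrow> bdd_supp g \<Longrightarrow>
       norm (kernel_form k f g) \<le> V * (C * (Lp_integral p f + Lp_integral q g))"
proof -
  obtain C where C: "C \<ge> 0" and bound:
    "\<And>f g e. e > 0 \<Longrightarrow> bdd_supp f \<Longrightarrow> bdd_supp g \<Longrightarrow>
       norm (kernel_form (\<lambda>s. complex_of_real (conj_poisson_kernel e s)) f g) \<le> C * (Lp_integral p f + Lp_integral q g)"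
    using conj_poisson_form_bound[OF p pq] by blast
  have "norm (kernel_form k f g) \<le> V * (C * (Lp_integral p f + Lp_integral q g))"
    if kern: "bv_kernel V k" and f: "bdd_supp f" and g: "bdd_supp g" for V k f g
  proof -
    obtain \<phi> where k[measurable]: "k \<in> borel_measurable borel" and bdd: "bounded (range k)"
      and \<phi>: "integrable lborel \<phi>" and \<phi>V: "(\<integral>t. norm (\<phi> t)) \<le> V"
      and rep: "\<And>s. complex_of_real s * k s = (\<integral>t. \<phi> t * cis (s * t))"
      using kern unfolding bv_kernel_def by blast
    define W where "W = C * (Lp_integral p f + Lp_integral q g)"
    define e where "e n = 1 / real (Suc n)" for n
    define Q where "Q n s = complex_of_real (conj_poisson_kernel (e n) s)" for n s
    define ke where "ke n s = k s * complex_of_real (s^2 / (s^2 + (e n)^2))" for n s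
    have e: "e n > 0" for n by (simp add: e_def)
    have e_lim: "e \<longlonglongrightarrow> 0" unfolding e_def by (rule LIMSEQ_inverse_real_of_nat[unfolded inverse_eq_divide])
    obtain B where B: "\<And>s. norm (k s) \<le> B" using bdd by (auto simp: bounded_iff)
    have [measurable]: "f \<in> borel_measurable borel" "g \<in> borel_measurable borel" "\<phi> \<in> borel_measurable borel"
      using f g \<phi> by (auto intro: bdd_supp_measurable)
    have fi: "integrable lborel f" and gi: "integrable lborel g"
      using f g by (auto intro: bdd_supp_integrable)
    have ratio: "0 \<le> s^2 / (s^2 + (e n)^2)" "s^2 / (s^2 + (e n)^2) \<le> 1" for s n
      using e[of n] by (simp_all add: divide_le_eq_1 sum_power2_gt_zero_iff)
    have ke_le: "norm (ke n s) \<le> B" for n s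
    proof -
      have "norm (ke n s) = norm (k s) * (s^2 / (s^2 + (e n)^2))"
        unfolding ke_def norm_mult using ratio(1)[of s n] by (simp only: norm_of_real abs_of_nonneg)
      also have "\<dots> \<le> norm (k s) * 1" by (intro mult_left_mono ratio) simp
      finally show ?thesis using B[of s] by simp
    qed
    have kem[measurable]: "ke n \<in> borel_measurable borel" for n unfolding ke_def by measurable
    have Qm: "Q n \<in> borel_measurable borel" for n unfolding Q_def by measurable
    have QB: "norm (Q n s) \<le> 1 / e n" for n s
      unfolding Q_def using conj_poisson_kernel_le[OF e] by simp
    have ke_eq: "ke n = (\<lambda>s. Q n s * (\<integral>t. \<phi> t * cis (s * t)))" for n
      by (rule ext) (simp add: ke_def Q_def conj_poisson_kernel_def rep[symmetric] power2_eq_square)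
    have bd: "norm (kernel_form (ke n) f g) \<le> V * W" for n
    proof -
      have W: "norm (kernel_form (Q n) (\<lambda>y. f y * cis (- (y * t))) (\<lambda>x. g x * cis (x * t))) \<le> W" for t
      proof -
        have f': "bdd_supp (\<lambda>y. f y * cis (- (y * t)))"
          by (rule bdd_supp_mult_unimodular[OF f]) (simp_all add: cis_linear_measurable cis_linear_measurable'[simplified])
        have g': "bdd_supp (\<lambda>y. g y * cis (y * t))"
          by (rule bdd_supp_mult_unimodular[OF g]) (simp_all add: cis_linear_measurable cis_linear_measurable'[simplified])
        from bound[OF e[of n] f' g'] show ?thesis
          by (simp add: Q_def[abs_def] W_def Lp_integral_def norm_mult)
      qed
      have "norm (kernel_form (ke n) f g)
        \<le> (\<integral>t. norm (\<phi> t) * W)"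
        unfolding ke_eq kernel_form_modulated_superposition[OF fi gi Qm QB \<phi>]
      proof (cases "integrable lborel (\<lambda>t. \<phi> t * kernel_form (Q n) (\<lambda>y. f y * cis (- (y * t))) (\<lambda>x. g x * cis (x * t)))")
        case True
        then show "norm (\<integral>t. \<phi> t * kernel_form (Q n) (\<lambda>y. f y * cis (- (y * t))) (\<lambda>x. g x * cis (x * t)))
          \<le> (\<integral>t. norm (\<phi> t) * W)"
          using \<phi> W by (intro Bochner_Integration.integral_norm_bound_integral) (auto simp: norm_mult mult_left_mono)
      next
        case False
        then show "norm (\<integral>t. \<phi> t * kernel_form (Q n) (\<lambda>y. f y * cis (- (y * t))) (\<lambda>x. g x * cis (x * t)))
          \<le> (\<integral>t. norm (\<phi> t) * W)"
          using order_trans[OF norm_ge_zero W] by (simp add: not_integrable_integral_eq)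
      qed
      also have "\<dots> = (\<integral>t. norm (\<phi> t)) * W" by simp
      also have "\<dots> \<le> V * W" using C by (intro mult_right_mono \<phi>V) (simp add: W_def Lp_integral_nonneg)
      finally show ?thesis .
    qed
    have "(\<lambda>n. kernel_form (ke n) f g) \<longlonglongrightarrow> kernel_form k f g"
      unfolding kernel_form_eq_pair[OF fi gi k B] kernel_form_eq_pair[OF fi gi kem ke_le]
    proof (rule integral_dominated_convergence[where w="\<lambda>z. norm (g (fst z) * f (snd z)) * B"])
      show "integrable (lborel \<Otimes>\<^sub>M lborel) (\<lambda>z. norm (g (fst z) * f (snd z)) * B)"
        using lborel_pair.integrable_pair_mult[OF gi fi] by (intro integrable_mult_left integrable_norm)
      show "AE z in lborel \<Otimes>\<^sub>M lborel. norm (g (fst z) * f (snd z) * ke n (fst z - snd z)) \<le> norm (g (fst z) * f (snd z)) * B" for n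
        unfolding norm_mult[of "_ * _" "ke n _"] by (intro AE_I2 mult_left_mono ke_le) simp
      show "AE z in lborel \<Otimes>\<^sub>M lborel. (\<lambda>n. g (fst z) * f (snd z) * ke n (fst z - snd z))
          \<longlonglongrightarrow> g (fst z) * f (snd z) * k (fst z - snd z)"
        using AE_pair_neq
      proof eventually_elim
        case (elim z)
        define s where "s = fst z - snd z"
        \<comment> \<open>Off the diagonal the factor \<open>s\<^sup>2 / (s\<^sup>2 + e\<^sup>2)\<close> tends to \<open>1\<close>.\<close>
        have s: "s \<noteq> 0" using elim by (simp add: s_def)
        have "(\<lambda>n. g (fst z) * f (snd z) * ke n s) \<longlonglongrightarrow> g (fst z) * f (snd z) * (k s * complex_of_real (s^2 / (s^2 + 0^2)))"
          unfolding ke_def using s by (intro tendsto_intros e_lim) auto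
        then show ?case using s by (simp add: s_def)
      qed
    qed measurable
    then have "(\<lambda>n. norm (kernel_form (ke n) f g)) \<longlonglongrightarrow> norm (kernel_form k f g)" by (rule tendsto_norm)
    then show ?thesis unfolding W_def[symmetric]
      by (rule LIMSEQ_le_const2) (use bd in auto)
  qed
  with C that show ?thesis by blast
qed

text \<open>
  For \<open>p > 2\<close> the conjugate exponent is below \<open>2\<close>. As the kernel is even, the form is symmetric and the
  two functions can be exchanged.
\<close>

lemma kernel_form_bv_bound:
  fixes p q :: real
  assumes p: "1 < p" and pq: "1 / p + 1 / q = 1"
  obtains C where "C \<ge> 0"
    "\<And>V k f g. bv_kernel V k \<Longrightarrow> bdd_supp f \<Longrightarrow> bdd_supp g \<Longrightarrow>
       norm (kernel_form k f g) \<le> V * (C * (Lp_integral p f + Lp_integral q g))"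
proof (cases "p \<le> 2")
  case True
  then show ?thesis using kernel_form_bv_bound_le2[OF p True pq] that by blast
next
  case False
  have "1 / p < 1 / 2" "1 / p > 0" using False p by auto
  then have q': "1 / q > 1 / 2" "1 / q < 1" using pq by linarith+
  then have q0: "q > 0" by (smt (verit) zero_less_divide_1_iff)
  then have q: "1 < q" "q \<le> 2" using q' by (simp_all add: divide_simps split: if_splits)
  have qp: "1 / q + 1 / p = 1" using pq by simp
  obtain C where C: "C \<ge> 0" and bound:
    "\<And>V k f g. bv_kernel V k \<Longrightarrow> bdd_supp f \<Longrightarrow> bdd_supp g \<Longrightarrow>
       norm (kernel_form k f g) \<le> V * (C * (Lp_integral q f + Lp_integral p g))"
    using kernel_form_bv_bound_le2[OF q qp] by blast
  show ?thesis
  proof (rule that[OF C])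
    fix V :: real and k f g :: "real \<Rightarrow> complex"
    assume kern: "bv_kernel V k" and f: "bdd_supp f" and g: "bdd_supp g"
    have k: "k \<in> borel_measurable borel" "bounded (range k)" "\<And>s. k (- s) = k s"
      using kern by (auto simp: bv_kernel_def)
    obtain B where B: "\<And>s. norm (k s) \<le> B" using k(2) by (auto simp: bounded_iff)
    have "kernel_form k f g = kernel_form k g f"
      by (rule kernel_form_commute[OF bdd_supp_integrable[OF f] bdd_supp_integrable[OF g] k(1) B k(3)])
    with bound[OF kern g f]
    show "norm (kernel_form k f g) \<le> V * (C * (Lp_integral p f + Lp_integral q g))"
      by (simp add: add.commute)
  qed
qed

text \<open>
  With \<open>h\<close> the convolution of \<open>k\<close> and \<open>f\<close>, the form is tested against \<open>g = l * \<bar>h\<bar> powr (p - 2) * cnj h\<close>.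
  Then the form is \<open>l\<close> times the integral of \<open>\<bar>h\<bar> powr p\<close>, while the integral of \<open>\<bar>g\<bar> powr q\<close> is \<open>l powr q\<close>
  times the same integral. Since \<open>q > 1\<close>, a small \<open>l\<close> allows the latter to be absorbed.
\<close>

lemma bv_kernel_Lp_bound_bdd_supp:
  fixes p V :: real
  assumes p: "1 < p" and V: "V \<ge> 0"
  obtains C where "C \<ge> 0"
    "\<And>k f. bv_kernel V k \<Longrightarrow> bdd_supp f \<Longrightarrow>
       Lp_mass p (\<lambda>x. \<integral>y. f y * k (x - y)) \<le> ennreal C * Lp_mass p f"
proof -
  define q where "q = p / (p - 1)"
  have q: "q > 1" "1 / p + 1 / q = 1" "(p - 1) * q = p" using p by (auto simp: q_def field_simps)
  obtain C0 where C0: "C0 \<ge> 0" and bound: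
    "\<And>V k f g. bv_kernel V k \<Longrightarrow> bdd_supp f \<Longrightarrow> bdd_supp g \<Longrightarrow>
       norm (kernel_form k f g) \<le> V * (C0 * (Lp_integral p f + Lp_integral q g))"
    using kernel_form_bv_bound[OF p q(2)] by blast
  define W where "W = V * C0"
  \<comment> \<open>\<open>l\<close> is chosen such that \<open>W * l powr q \<le> l / 2\<close>.\<close>
  define l where "l = (1 / (2 * (W + 1))) powr (1 / (q - 1))"
  have W: "W \<ge> 0" using V C0 by (simp add: W_def)
  have l: "l > 0" using W by (simp add: l_def)
  have "l powr (q - 1) = 1 / (2 * (W + 1))" using q W by (simp add: l_def powr_powr)
  moreover have "l powr q = l * l powr (q - 1)" using l by (simp add: powr_diff)
  ultimately have lq: "l powr q = l / (2 * (W + 1))" by simp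
  have Wlq: "W * l powr q \<le> l / 2"
    using W l unfolding lq by (simp add: field_simps)
  have "Lp_mass p (\<lambda>x. \<integral>y. f y * k (x - y)) \<le> ennreal (2 * W / l) * Lp_mass p f"
    if kern: "bv_kernel V k" and f: "bdd_supp f" for k f
  proof -
    have k[measurable]: "k \<in> borel_measurable borel" and bdd: "bounded (range k)"
      using kern by (auto simp: bv_kernel_def)
    obtain B where B: "\<And>s. norm (k s) \<le> B" using bdd by (auto simp: bounded_iff)
    have B0: "B \<ge> 0" using order_trans[OF norm_ge_zero B] by blast
    have fi: "integrable lborel f" using f by (rule bdd_supp_integrable)
    then have [measurable]: "f \<in> borel_measurable borel" by auto
    define h where "h x = (\<integral>y. f y * k (x - y))" for x
    define H where "H = B * (\<integral>y. norm (f y))"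
    have [measurable]: "h \<in> borel_measurable borel" unfolding h_def by measurable
    have hH: "norm (h x) \<le> H" for x
    proof -
      have "norm (h x) \<le> (\<integral>y. norm (f y) * B)"
        unfolding h_def
        by (intro Bochner_Integration.integral_norm_bound_integral integrable_mult_bounded[OF fi _ B])
          (use fi B in \<open>auto simp: norm_mult mult_left_mono\<close>)
      then show ?thesis by (simp add: H_def mult.commute)
    qed
    have trunc: "(\<integral>\<^sup>+x. ennreal (norm (h x) powr p) * indicator {- real n..real n} x)
       \<le> ennreal (2 * W / l) * Lp_mass p f" for n
    proof -
      define S where "S = {- real n..real n}"
      define u where "u x = norm (h x) powr p * indicator S x" for x
      define I where "I = (\<integral>x. u x)"
      define g where "g x = complex_of_real (l * norm (h x) powr (p - 2) * indicator S x) * cnj (h x)" for x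
      have [measurable]: "S \<in> sets borel" by (simp add: S_def)
      have gn: "norm (g x) = l * norm (h x) powr (p - 1) * indicator S x" for x
      proof -
        have "norm (g x) = \<bar>l * norm (h x) powr (p - 2) * indicator S x\<bar> * norm (h x)"
          unfolding g_def by (simp only: norm_mult norm_of_real complex_mod_cnj)
        then show ?thesis
          using l by (cases "h x = 0") (auto simp: abs_mult powr_diff power2_eq_square indicator_def)
      qed
      have g: "bdd_supp g"
        unfolding bdd_supp_def
      proof (intro conjI)
        have [measurable]: "(\<lambda>x. cnj (h x)) \<in> borel_measurable borel"
          by (intro measurable_compose[OF _ borel_measurable_continuous_onI[OF continuous_on_cnj[OF continuous_on_id]]]) simp
        show "g \<in> borel_measurable borel" unfolding g_def by measurable
        have "norm (g x) \<le> l * H powr (p - 1)" for x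
          unfolding gn using l p hH[of x] by (auto simp: indicator_def intro!: mult_left_mono powr_mono2)
        then show "\<exists>B. \<forall>x. norm (g x) \<le> B" by blast
        have "norm x > real n \<Longrightarrow> g x = 0" for x by (auto simp: g_def S_def indicator_def)
        then show "\<exists>M. \<forall>x. norm x > M \<longrightarrow> g x = 0" by blast
      qed
      have u: "bdd_supp u"
        unfolding bdd_supp_def
      proof (intro conjI)
        show "u \<in> borel_measurable borel" unfolding u_def by measurable
        have "norm (u x) \<le> H powr p" for x
          using p hH[of x] by (auto simp: u_def indicator_def intro!: powr_mono2)
        then show "\<exists>B. \<forall>x. norm (u x) \<le> B" by blast
        have "norm x > real n \<Longrightarrow> u x = 0" for x by (auto simp: u_def S_def indicator_def)
        then show "\<exists>M. \<forall>x. norm x > M \<longrightarrow> u x = 0" by blast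
      qed
      have I0: "I \<ge> 0" unfolding I_def by (intro integral_nonneg_AE) (simp add: u_def)
      have "h x * g x = complex_of_real (l * u x)" for x
      proof (cases "h x = 0")
        case False
        have "h x * g x = complex_of_real (l * norm (h x) powr (p - 2) * indicator S x) * (h x * cnj (h x))"
          by (simp add: g_def)
        also have "h x * cnj (h x) = complex_of_real (norm (h x) ^ 2)" by (rule complex_norm_square[symmetric])
        also have "complex_of_real (l * norm (h x) powr (p - 2) * indicator S x) * complex_of_real (norm (h x) ^ 2)
          = complex_of_real (l * u x)"
          using False by (simp add: u_def powr_diff flip: of_real_mult)
        finally show ?thesis .
      qed (simp add: u_def)
      then have "kernel_form k f g = complex_of_real (l * I)"
        unfolding kernel_form_def h_def[symmetric] I_def by simp
      then have "l * I \<le> norm (kernel_form k f g)" using l I0 by (simp add: norm_mult)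
      also have "\<dots> \<le> V * (C0 * (Lp_integral p f + Lp_integral q g))"
        by (rule bound[OF kern f g])
      also have "Lp_integral q g = l powr q * I"
      proof -
        have "norm (g x) powr q = l powr q * u x" for x
          unfolding gn u_def using l q by (auto simp: powr_mult powr_powr indicator_def)
        then show ?thesis by (simp add: Lp_integral_def I_def)
      qed
      also have "V * (C0 * (Lp_integral p f + l powr q * I)) = W * Lp_integral p f + (W * l powr q) * I"
        by (simp add: W_def algebra_simps)
      also have "\<dots> \<le> W * Lp_integral p f + l / 2 * I"
        by (intro add_left_mono mult_right_mono Wlq I0)
      finally have "I \<le> 2 * W / l * Lp_integral p f" using l by (simp add: field_simps)
      have "(\<integral>\<^sup>+x. ennreal (norm (h x) powr p) * indicator S x) = (\<integral>\<^sup>+x. ennreal (u x))"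
        by (intro nn_integral_cong) (auto simp: u_def indicator_def)
      also have "\<dots> = ennreal I"
        unfolding I_def
        by (rule nn_integral_eq_integral[OF bdd_supp_integrable[OF u]]) (simp add: u_def)
      also have "\<dots> \<le> ennreal (2 * W / l * Lp_integral p f)" by (rule ennreal_leI) fact
      also have "\<dots> = ennreal (2 * W / l) * Lp_mass p f"
        using p W l by (simp add: nn_integral_eq_Lp_integral[OF f] ennreal_mult[symmetric] Lp_integral_nonneg)
      finally show ?thesis by (simp add: S_def)
    qed
    have "Lp_mass p h
       \<le> ennreal (2 * W / l) * Lp_mass p f"
    proof (rule nn_integral_le_of_fatou[OF _ _ always_eventually tendsto_const])
      show "(\<lambda>x. ennreal (norm (h x) powr p) * indicator {- real n..real n} x) \<in> borel_measurable lborel" for n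
        by measurable
      show "AE x in lborel. (\<lambda>n. ennreal (norm (h x) powr p) * indicator {- real n..real n} x) \<longlonglongrightarrow> ennreal (norm (h x) powr p)"
        by (intro AE_I2 tendsto_mult_indicator_exhaust)
    qed (intro allI trunc)
    then show ?thesis by (simp add: h_def)
  qed
  moreover have "2 * W / l \<ge> 0" using W l by simp
  ultimately show ?thesis using that by blast
qed

lemma integrable_reflect_translate:
  fixes k :: "real \<Rightarrow> complex"
  assumes "integrable lborel k"
  shows "integrable lborel (\<lambda>y. k (x - y))"
  using lborel_integrable_real_affine[OF assms, of "-1" x] by simp

lemma tendsto_ennreal_norm_powr:
  fixes z :: "nat \<Rightarrow> complex"
  assumes "z \<longlonglongrightarrow> w" "p > 0"
  shows "(\<lambda>n. ennreal (norm (z n) powr p)) \<longlonglongrightarrow> ennreal (norm w powr p)"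
  using assms by (intro tendsto_ennrealI tendsto_powr2 tendsto_norm tendsto_const) auto

text \<open>
  For integrable \<open>k\<close> and bounded \<open>f\<close> the convolution is defined everywhere; unbounded functions are
  reached by truncation, once all coordinates have been treated.
\<close>

definition Lp_kernel_bound :: "real \<Rightarrow> real \<Rightarrow> (real \<Rightarrow> complex) \<Rightarrow> bool" where
  "Lp_kernel_bound p C k \<longleftrightarrow> (\<forall>f. f \<in> borel_measurable borel \<longrightarrow> bounded (range f) \<longrightarrow>
     (Lp_mass p (\<lambda>x. \<integral>y. f y * k (x - y)))
         \<le> ennreal C * Lp_mass p f)"

lemma bv_kernel_Lp_bound:
  fixes p V :: real
  assumes p: "1 < p" and V: "V \<ge> 0"
  obtains C where "C \<ge> 0"
    "\<And>k. bv_kernel V k \<Longrightarrow> integrable lborel k \<Longrightarrow> Lp_kernel_bound p C k"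
proof -
  obtain C where C: "C \<ge> 0" and bound:
    "\<And>k f. bv_kernel V k \<Longrightarrow> bdd_supp f \<Longrightarrow>
       Lp_mass p (\<lambda>x. \<integral>y. f y * k (x - y)) \<le> ennreal C * Lp_mass p f"
    using bv_kernel_Lp_bound_bdd_supp[OF p V] by blast
  show ?thesis
  proof (rule that[OF C], unfold Lp_kernel_bound_def, intro allI impI)
    fix k f :: "real \<Rightarrow> complex"
    assume kern: "bv_kernel V k" and ki: "integrable lborel k"
      and f[measurable]: "f \<in> borel_measurable borel" and fb: "bounded (range f)"
    have k[measurable]: "k \<in> borel_measurable borel" using ki by auto
    obtain B where B: "\<And>s. norm (f s) \<le> B" using fb by (auto simp: bounded_iff)
    define fn where "fn n y = f y * indicator {- real n..real n} y" for n y
    have [measurable]: "fn n \<in> borel_measurable borel" for n unfolding fn_def by measurable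
    have fn_le: "norm (fn n y) \<le> norm (f y)" for n y by (auto simp: fn_def indicator_def)
    have tf: "bdd_supp (fn n)" for n
      unfolding bdd_supp_def
    proof (intro conjI)
      show "\<exists>B. \<forall>x. norm (fn n x) \<le> B" using order_trans[OF fn_le B] by blast
      have "norm x > real n \<Longrightarrow> fn n x = 0" for x by (auto simp: fn_def indicator_def)
      then show "\<exists>M. \<forall>x. norm x > M \<longrightarrow> fn n x = 0" by blast
    qed simp
    show "Lp_mass p (\<lambda>x. \<integral>y. f y * k (x - y))
         \<le> ennreal C * Lp_mass p f"
    proof (rule nn_integral_le_of_fatou[OF _ _ always_eventually tendsto_const])
      show "(\<lambda>x. ennreal (norm (\<integral>y. fn n y * k (x - y)) powr p)) \<in> borel_measurable lborel" for n
        by measurable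
      show "AE x in lborel. (\<lambda>n. ennreal (norm (\<integral>y. fn n y * k (x - y)) powr p))
         \<longlonglongrightarrow> ennreal (norm (\<integral>y. f y * k (x - y)) powr p)"
      proof (intro AE_I2 tendsto_ennreal_norm_powr)
        fix x
        show "(\<lambda>n. \<integral>y. fn n y * k (x - y)) \<longlonglongrightarrow> (\<integral>y. f y * k (x - y))"
        proof (rule integral_dominated_convergence[where w="\<lambda>y. B * norm (k (x - y))"])
          show "integrable lborel (\<lambda>y. B * norm (k (x - y)))"
            using integrable_reflect_translate[OF ki] by simp
          show "AE y in lborel. norm (fn n y * k (x - y)) \<le> B * norm (k (x - y))" for n
            unfolding norm_mult by (intro AE_I2 mult_right_mono order_trans[OF fn_le B]) simp
          show "AE y in lborel. (\<lambda>n. fn n y * k (x - y)) \<longlonglongrightarrow> f y * k (x - y)"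
          proof (intro AE_I2 tendsto_mult tendsto_const)
            fix y
            obtain N where N: "\<bar>y\<bar> \<le> real N" using real_arch_simple by blast
            have "\<forall>\<^sub>F n in sequentially. fn n y = f y"
              using eventually_ge_at_top[of N]
              by eventually_elim (use N in \<open>auto simp: fn_def indicator_def abs_le_iff\<close>)
            then show "(\<lambda>n. fn n y) \<longlonglongrightarrow> f y" by (rule tendsto_eventually)
          qed
        qed measurable
      qed (use p in simp)
      show "\<forall>n. (Lp_mass p (\<lambda>x. \<integral>y. fn n y * k (x - y)))
         \<le> ennreal C * Lp_mass p f"
      proof
        fix n
        have "Lp_mass p (\<lambda>x. \<integral>y. fn n y * k (x - y))
          \<le> ennreal C * Lp_mass p (\<lambda>x. fn n x)"
          by (rule bound[OF kern tf])
        also have "\<dots> \<le> ennreal C * Lp_mass p f"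
          using p by (intro mult_left_mono nn_integral_mono ennreal_leI powr_mono2 fn_le) auto
        finally show "Lp_mass p (\<lambda>x. \<integral>y. fn n y * k (x - y))
          \<le> ennreal C * Lp_mass p f" .
      qed
    qed
  qed
qed

section \<open>Tensor products of one-dimensional kernels\<close>

interpretation lborel_PiM: product_sigma_finite "\<lambda>_. lborel :: real measure" ..

definition from_coords :: "'a set \<Rightarrow> ('a::euclidean_space \<Rightarrow> real) \<Rightarrow> 'a" where
  "from_coords I s = (\<Sum>b\<in>I. s b *\<^sub>R b)"

lemma from_coords_measurable [measurable]:
  "from_coords I \<in> borel_measurable (Pi\<^sub>M I (\<lambda>_. lborel))"
  unfolding from_coords_def by measurable

lemma from_coords_inner: "b \<in> Basis \<Longrightarrow> from_coords Basis s \<bullet> b = s b"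
  by (simp add: from_coords_def)

lemma lborel_eq_from_coords:
  "(lborel :: 'a::euclidean_space measure) = distr (Pi\<^sub>M Basis (\<lambda>_. lborel)) borel (from_coords Basis)"
  unfolding from_coords_def by (rule lborel_eq)

lemma nn_integral_from_coords:
  fixes G :: "'a::euclidean_space \<Rightarrow> ennreal"
  assumes [measurable]: "G \<in> borel_measurable borel"
  shows "(\<integral>\<^sup>+x. G x) = (\<integral>\<^sup>+s. G (from_coords Basis s) \<partial>(Pi\<^sub>M Basis (\<lambda>_. lborel)))"
  by (subst lborel_eq_from_coords, subst nn_integral_distr) auto

lemma integral_from_coords:
  fixes G :: "'a::euclidean_space \<Rightarrow> complex"
  assumes [measurable]: "G \<in> borel_measurable borel"
  shows "(\<integral>x. G x) = (\<integral>s. G (from_coords Basis s) \<partial>(Pi\<^sub>M Basis (\<lambda>_. lborel)))"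
  by (subst lborel_eq_from_coords, subst integral_distr) auto

lemma integrable_from_coords:
  fixes G :: "'a::euclidean_space \<Rightarrow> complex"
  assumes [measurable]: "G \<in> borel_measurable borel"
  shows "integrable lborel G \<longleftrightarrow> integrable (Pi\<^sub>M Basis (\<lambda>_. lborel)) (\<lambda>s. G (from_coords Basis s))"
  by (subst lborel_eq_from_coords, subst integrable_distr_eq) auto

lemma integrable_prod_Basis:
  fixes f :: "'a::euclidean_space \<Rightarrow> real \<Rightarrow> complex"
  assumes f: "\<And>b. b \<in> Basis \<Longrightarrow> integrable lborel (f b)"
  shows "integrable lborel (\<lambda>x. \<Prod>b\<in>Basis. f b (x \<bullet> b))"
proof -
  have [measurable]: "\<And>b. b \<in> Basis \<Longrightarrow> f b \<in> borel_measurable borel" using f by auto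
  have "integrable (Pi\<^sub>M Basis (\<lambda>_. lborel)) (\<lambda>s. \<Prod>b\<in>Basis. f b (s b))"
    by (intro lborel_PiM.product_integrable_prod f) auto
  then show ?thesis
    by (subst integrable_from_coords) (auto simp: from_coords_inner)
qed

lemma integral_prod_Basis:
  fixes f :: "'a::euclidean_space \<Rightarrow> real \<Rightarrow> complex"
  assumes f: "\<And>b. b \<in> Basis \<Longrightarrow> integrable lborel (f b)"
  shows "(\<integral>x. (\<Prod>b\<in>Basis. f b (x \<bullet> b))) = (\<Prod>b\<in>Basis. \<integral>t. f b t)"
proof -
  have [measurable]: "\<And>b. b \<in> Basis \<Longrightarrow> f b \<in> borel_measurable borel" using f by auto
  have "(\<integral>x. (\<Prod>b\<in>Basis. f b (x \<bullet> b))) = (\<integral>s. (\<Prod>b\<in>Basis. f b (s b)) \<partial>(Pi\<^sub>M Basis (\<lambda>_. lborel)))"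
    by (subst integral_from_coords) (auto simp: from_coords_inner)
  also have "\<dots> = (\<Prod>b\<in>Basis. \<integral>t. f b t)"
    by (intro lborel_PiM.product_integral_prod f) auto
  finally show ?thesis .
qed

lemma nn_integral_split_coordinate:
  fixes G :: "'a::euclidean_space \<Rightarrow> ennreal"
  assumes [measurable]: "G \<in> borel_measurable borel" and b: "b \<in> Basis"
  shows "(\<integral>\<^sup>+x. G x)
    = (\<integral>\<^sup>+s. (\<integral>\<^sup>+y. G (from_coords (Basis - {b}) s + y *\<^sub>R b)) \<partial>(Pi\<^sub>M (Basis - {b}) (\<lambda>_. lborel)))"
proof -
  define I where "I = Basis - {b}"
  have I: "finite I" "b \<notin> I" "insert b I = Basis" using b by (auto simp: I_def)
  have fc: "from_coords (insert b I) (s(b := y)) = from_coords I s + y *\<^sub>R b" for s y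
  proof -
    have "(\<Sum>c\<in>I. (s(b := y)) c *\<^sub>R c) = (\<Sum>c\<in>I. s c *\<^sub>R c)" using I(2) by (intro sum.cong) auto
    then show ?thesis unfolding from_coords_def sum.insert[OF I(1,2)] by simp
  qed
  have "(\<integral>\<^sup>+x. G x) = (\<integral>\<^sup>+s. G (from_coords (insert b I) s) \<partial>(Pi\<^sub>M (insert b I) (\<lambda>_. lborel)))"
    unfolding I by (rule nn_integral_from_coords) measurable
  also have "\<dots> = (\<integral>\<^sup>+s. (\<integral>\<^sup>+y. G (from_coords (insert b I) (s(b := y)))) \<partial>(Pi\<^sub>M I (\<lambda>_. lborel)))"
    by (rule lborel_PiM.product_nn_integral_insert[OF I(1,2)]) measurable
  finally show ?thesis unfolding fc unfolding I_def .
qed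

definition line_conv :: "(real \<Rightarrow> complex) \<Rightarrow> 'a::euclidean_space \<Rightarrow> ('a \<Rightarrow> complex) \<Rightarrow> 'a \<Rightarrow> complex" where
  "line_conv k b F x = (\<integral>s. k s * F (x - s *\<^sub>R b))"

lemma integral_reflect_translate:
  fixes g :: "real \<Rightarrow> complex"
  shows "(\<integral>s. g s) = (\<integral>y. g (x - y))"
  using lborel_integral_real_affine[of "-1" g x] by simp

lemma line_conv_measurable:
  fixes F :: "'a::euclidean_space \<Rightarrow> complex"
  assumes [measurable]: "k \<in> borel_measurable borel" "F \<in> borel_measurable borel"
  shows "line_conv k b F \<in> borel_measurable borel"
  unfolding line_conv_def by measurable

lemma line_conv_bounded:
  fixes F :: "'a::euclidean_space \<Rightarrow> complex"
  assumes k: "integrable lborel k" and [measurable]: "F \<in> borel_measurable borel" and F: "bounded (range F)"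
  shows "bounded (range (line_conv k b F))"
proof -
  obtain B where B: "\<And>x. norm (F x) \<le> B" using F by (auto simp: bounded_iff)
  have [measurable]: "k \<in> borel_measurable borel" using k by auto
  have "norm (line_conv k b F x) \<le> (\<integral>s. norm (k s) * B)" for x
    unfolding line_conv_def
    by (intro Bochner_Integration.integral_norm_bound_integral integrable_mult_bounded[OF k _ B])
      (use k B in \<open>auto simp: norm_mult mult_left_mono\<close>)
  then show ?thesis unfolding bounded_iff by blast
qed

text \<open>
  On every line parallel to \<open>b\<close> the operator is the one-dimensional convolution.
\<close>

lemma line_conv_Lp_bound:
  fixes F :: "'a::euclidean_space \<Rightarrow> complex"
  assumes k: "Lp_kernel_bound p C k" "k \<in> borel_measurable borel" and b: "b \<in> Basis"
    and [measurable]: "F \<in> borel_measurable borel" and F: "bounded (range F)"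
  shows "Lp_mass p (line_conv k b F) \<le> ennreal C * Lp_mass p F"
proof -
  have [measurable]: "k \<in> borel_measurable borel" "line_conv k b F \<in> borel_measurable borel"
    using k(2) by (auto intro: line_conv_measurable)
  let ?P = "Pi\<^sub>M (Basis - {b}) (\<lambda>_. lborel :: real measure)"
  have "Lp_mass p (line_conv k b F)
    = (\<integral>\<^sup>+s. (Lp_mass p (\<lambda>y. line_conv k b F (from_coords (Basis - {b}) s + y *\<^sub>R b))) \<partial>?P)"
    by (rule nn_integral_split_coordinate[OF _ b]) measurable
  also have "\<dots> \<le> (\<integral>\<^sup>+s. ennreal C * Lp_mass p (\<lambda>y. F (from_coords (Basis - {b}) s + y *\<^sub>R b)) \<partial>?P)"
  proof (rule nn_integral_mono)
    fix s
    define w where "w = from_coords (Basis - {b}) s"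
    define f where "f y = F (w + y *\<^sub>R b)" for y
    have "f \<in> borel_measurable borel" unfolding f_def by measurable
    moreover have "bounded (range f)" using F by (rule bounded_subset) (auto simp: f_def)
    ultimately have "Lp_mass p (\<lambda>x. \<integral>y. f y * k (x - y))
         \<le> ennreal C * Lp_mass p f"
      using k(1) by (simp add: Lp_kernel_bound_def)
    moreover have "(\<integral>y. f y * k (x - y)) = line_conv k b F (w + x *\<^sub>R b)" for x
      unfolding line_conv_def
      by (subst (2) integral_reflect_translate[of _ x]) (simp add: f_def algebra_simps)
    ultimately show "Lp_mass p (\<lambda>y. line_conv k b F (from_coords (Basis - {b}) s + y *\<^sub>R b))
      \<le> ennreal C * Lp_mass p (\<lambda>y. F (from_coords (Basis - {b}) s + y *\<^sub>R b))"
      by (simp add: f_def w_def)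
  qed
  also have "\<dots> = ennreal C * (\<integral>\<^sup>+s. (Lp_mass p (\<lambda>y. F (from_coords (Basis - {b}) s + y *\<^sub>R b))) \<partial>?P)"
    by (rule nn_integral_cmult) measurable
  also have "(\<integral>\<^sup>+s. (Lp_mass p (\<lambda>y. F (from_coords (Basis - {b}) s + y *\<^sub>R b))) \<partial>?P)
    = Lp_mass p F"
    by (rule nn_integral_split_coordinate[OF _ b, symmetric]) measurable
  finally show ?thesis .
qed

text \<open>
  Integrating out the coordinate \<open>b\<close> first shows that the operator for \<open>insert b I\<close> is the operator for
  \<open>I\<close> applied to a convolution along \<open>b\<close>.
\<close>

lemma iterated_line_conv_Lp_bound:
  fixes F :: "'a::euclidean_space \<Rightarrow> complex"
  assumes k: "Lp_kernel_bound p C k" "integrable lborel k" and C: "C \<ge> 0" and I: "finite I" "I \<subseteq> Basis"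
    and F: "F \<in> borel_measurable borel" "bounded (range F)"
  shows "Lp_mass p (\<lambda>x. \<integral>s. (\<Prod>b\<in>I. k (s b)) * F (x - from_coords I s) \<partial>(Pi\<^sub>M I (\<lambda>_. lborel)))
    \<le> ennreal (C ^ card I) * Lp_mass p F"
  using I F
proof (induction I arbitrary: F rule: finite_induct)
  case empty
  then show ?case by (simp add: from_coords_def PiM_empty lebesgue_integral_count_space_finite)
next
  case (insert b I)
  have km[measurable]: "k \<in> borel_measurable borel" using k(2) by auto
  have Fm[measurable]: "F \<in> borel_measurable borel" by fact
  obtain B where B: "\<And>x. norm (F x) \<le> B" using insert.prems by (auto simp: bounded_iff)
  have b: "b \<in> Basis" "I \<subseteq> Basis" using insert.prems by auto
  have Lm: "line_conv k b F \<in> borel_measurable borel" by (rule line_conv_measurable) fact+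
  have Lb: "bounded (range (line_conv k b F))" by (rule line_conv_bounded[OF k(2) Fm]) fact
  have eq: "(\<integral>s. (\<Prod>b\<in>insert b I. k (s b)) * F (x - from_coords (insert b I) s) \<partial>(Pi\<^sub>M (insert b I) (\<lambda>_. lborel)))
     = (\<integral>s. (\<Prod>b\<in>I. k (s b)) * line_conv k b F (x - from_coords I s) \<partial>(Pi\<^sub>M I (\<lambda>_. lborel)))" for x
  proof -
    have "integrable (Pi\<^sub>M (insert b I) (\<lambda>_. lborel)) (\<lambda>s. \<Prod>b\<in>insert b I. k (s b))"
      using insert.hyps k(2) by (intro lborel_PiM.product_integrable_prod) auto
    then have "integrable (Pi\<^sub>M (insert b I) (\<lambda>_. lborel)) (\<lambda>s. (\<Prod>b\<in>insert b I. k (s b)) * F (x - from_coords (insert b I) s))"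
      by (rule integrable_mult_bounded[OF _ _ B]) measurable
    then have "(\<integral>s. (\<Prod>b\<in>insert b I. k (s b)) * F (x - from_coords (insert b I) s) \<partial>(Pi\<^sub>M (insert b I) (\<lambda>_. lborel)))
      = (\<integral>s. (\<integral>y. (\<Prod>c\<in>insert b I. k ((s(b := y)) c)) * F (x - from_coords (insert b I) (s(b := y)))) \<partial>(Pi\<^sub>M I (\<lambda>_. lborel)))"
      by (rule lborel_PiM.product_integral_insert[OF insert.hyps(1,2)])
    also have "\<dots> = (\<integral>s. (\<Prod>b\<in>I. k (s b)) * line_conv k b F (x - from_coords I s) \<partial>(Pi\<^sub>M I (\<lambda>_. lborel)))"
    proof (intro Bochner_Integration.integral_cong refl)
      fix s :: "'a \<Rightarrow> real"
      have 1: "(\<Prod>c\<in>insert b I. k ((s(b := y)) c)) = (\<Prod>c\<in>I. k (s c)) * k y" for y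
        using insert.hyps by (subst prod.insert) (auto intro!: prod.cong simp: mult.commute)
      have 2: "x - from_coords (insert b I) (s(b := y)) = (x - from_coords I s) - y *\<^sub>R b" for y
      proof -
        have "from_coords (insert b I) (s(b := y)) = y *\<^sub>R b + from_coords I s"
          unfolding from_coords_def using insert.hyps by (subst sum.insert) (auto intro!: sum.cong)
        then show ?thesis by simp
      qed
      show "(\<integral>y. (\<Prod>c\<in>insert b I. k ((s(b := y)) c)) * F (x - from_coords (insert b I) (s(b := y))))
        = (\<Prod>b\<in>I. k (s b)) * line_conv k b F (x - from_coords I s)"
        unfolding 1 2 line_conv_def by (simp add: mult.assoc)
    qed
    finally show ?thesis .
  qed
  have "Lp_mass p (\<lambda>x. \<integral>s. (\<Prod>b\<in>I. k (s b)) * line_conv k b F (x - from_coords I s) \<partial>(Pi\<^sub>M I (\<lambda>_. lborel)))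
    \<le> ennreal (C ^ card I) * Lp_mass p (line_conv k b F)"
    by (rule insert.IH[OF b(2) Lm Lb])
  also have "\<dots> \<le> ennreal (C ^ card I) * (ennreal C * Lp_mass p F)"
    by (intro mult_left_mono line_conv_Lp_bound k(1) km b Fm insert.prems) simp
  also have "\<dots> = ennreal (C ^ card (insert b I)) * Lp_mass p F"
    using insert.hyps C by (simp add: ennreal_mult' mult_ac)
  finally show ?case unfolding eq .
qed

lemma tensor_kernel_Lp_bound:
  fixes F :: "'a::euclidean_space \<Rightarrow> complex"
  assumes k: "Lp_kernel_bound p C k" "integrable lborel k" and C: "C \<ge> 0"
    and F: "F \<in> borel_measurable borel" "bounded (range F)"
  shows "Lp_mass p (\<lambda>x. \<integral>s. (\<Prod>b\<in>Basis. k (s \<bullet> b)) * F (x - s))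
    \<le> ennreal (C ^ DIM('a)) * Lp_mass p F"
proof -
  have [measurable]: "k \<in> borel_measurable borel" "F \<in> borel_measurable borel" using k(2) F by auto
  have "(\<integral>s. (\<Prod>b\<in>Basis. k (s \<bullet> b)) * F (x - s))
    = (\<integral>s. (\<Prod>b\<in>Basis. k (s b)) * F (x - from_coords Basis s) \<partial>(Pi\<^sub>M Basis (\<lambda>_. lborel)))" for x
    by (subst integral_from_coords) (auto simp: from_coords_inner)
  then show ?thesis
    using iterated_line_conv_Lp_bound[OF k C finite_Basis order_refl F] by simp
qed

section \<open>Multiplier operators as convolutions\<close>

definition convol :: "('a::euclidean_space \<Rightarrow> complex) \<Rightarrow> ('a \<Rightarrow> complex) \<Rightarrow> 'a \<Rightarrow> complex" where
  "convol K f y = (\<integral>x. K (y - x) * f x)"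

lemma convol_measurable [measurable]:
  assumes [measurable]: "K \<in> borel_measurable borel" "f \<in> borel_measurable borel"
  shows "convol K f \<in> borel_measurable borel"
  unfolding convol_def by measurable

lemma cis_inner_measurable:
  fixes f g :: "'b \<Rightarrow> 'a::euclidean_space"
  assumes "f \<in> borel_measurable M" "g \<in> borel_measurable M"
  shows "(\<lambda>z. cis (f z \<bullet> g z)) \<in> borel_measurable M"
  by (rule measurable_compose[OF borel_measurable_inner[OF assms] cis_measurable])

text \<open>
  The inner transform is written out, and by Fubini's theorem the integral over the frequency is
  carried out first.
\<close>

lemma fourier_multiplied_inv_fourier:
  fixes m \<phi> :: "'a::euclidean_space \<Rightarrow> complex"
  assumes m: "integrable lborel m" and \<phi>: "integrable lborel \<phi>"
  shows "fourier (\<lambda>\<xi>. m \<xi> * inv_fourier \<phi> \<xi>) x = (\<integral>y. \<phi> y * inv_fourier m (y - x))"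
proof -
  have [measurable]: "m \<in> borel_measurable borel" "\<phi> \<in> borel_measurable borel" using m \<phi> by auto
  define c where "c = complex_of_real (1 / (2 * pi) ^ DIM('a))"
  have "fourier (\<lambda>\<xi>. m \<xi> * inv_fourier \<phi> \<xi>) x
    = (\<integral>\<xi>. (\<integral>y. c * ((m \<xi> * \<phi> y) * cis ((y - x) \<bullet> \<xi>))))"
    unfolding fourier_def inv_fourier_def c_def[symmetric]
  proof (intro Bochner_Integration.integral_cong refl)
    fix \<xi>
    have "c * ((m \<xi> * \<phi> y) * cis ((y - x) \<bullet> \<xi>)) = (c * m \<xi> * cis (- (x \<bullet> \<xi>))) * (\<phi> y * cis (\<xi> \<bullet> y))" for y
      using cis_mult[of "- (x \<bullet> \<xi>)" "\<xi> \<bullet> y"] by (simp add: inner_diff_left inner_diff_right inner_commute mult_ac)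
    then show "m \<xi> * (c * (\<integral>y. \<phi> y * cis (\<xi> \<bullet> y))) * cis (- (x \<bullet> \<xi>))
      = (\<integral>y. c * ((m \<xi> * \<phi> y) * cis ((y - x) \<bullet> \<xi>)))"
      by (simp only: integral_mult_right_zero) (simp add: mult_ac)
  qed
  also have "\<dots> = (\<integral>y. (\<integral>\<xi>. c * ((m \<xi> * \<phi> y) * cis ((y - x) \<bullet> \<xi>))))"
  proof (rule lborel_pair.Fubini_integral[symmetric])
    have "integrable (lborel \<Otimes>\<^sub>M lborel) (\<lambda>z. (m (fst z) * \<phi> (snd z)) * cis ((snd z - x) \<bullet> fst z))"
    proof (rule integrable_mult_bounded[OF lborel_pair.integrable_pair_mult[OF m \<phi>], where B=1])
      show "(\<lambda>z. cis ((snd z - x) \<bullet> fst z)) \<in> borel_measurable (lborel \<Otimes>\<^sub>M lborel)"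
        by (intro cis_inner_measurable) measurable
    qed simp
    then have "integrable (lborel \<Otimes>\<^sub>M lborel) (\<lambda>z. c * ((m (fst z) * \<phi> (snd z)) * cis ((snd z - x) \<bullet> fst z)))"
      by (rule integrable_mult_right)
    then show "integrable (lborel \<Otimes>\<^sub>M lborel) (\<lambda>(\<xi>, y). c * ((m \<xi> * \<phi> y) * cis ((y - x) \<bullet> \<xi>)))"
      by (simp add: case_prod_unfold)
  qed
  also have "\<dots> = (\<integral>y. \<phi> y * inv_fourier m (y - x))"
  proof (intro Bochner_Integration.integral_cong refl)
    fix y
    have "c * ((m \<xi> * \<phi> y) * cis ((y - x) \<bullet> \<xi>)) = (c * \<phi> y) * (m \<xi> * cis ((y - x) \<bullet> \<xi>))" for \<xi>
      by (simp add: mult_ac)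
    then show "(\<integral>\<xi>. c * ((m \<xi> * \<phi> y) * cis ((y - x) \<bullet> \<xi>))) = \<phi> y * inv_fourier m (y - x)"
      unfolding inv_fourier_def c_def[symmetric] by (simp only: integral_mult_right_zero) (simp add: mult_ac)
  qed
  finally show ?thesis .
qed

text \<open>
  Since \<open>\<bar>f\<bar> \<le> 1 + \<bar>f\<bar> powr p\<close> for \<open>p \<ge> 1\<close>, this covers \<open>Lp_space p\<close> for all exponents at once
  (\<open>L1_plus_Linf_Lp_space\<close>) and suffices for the convergence of convolutions with integrable kernels.
\<close>

definition L1_plus_Linf :: "('a::euclidean_space \<Rightarrow> complex) \<Rightarrow> bool" where
  "L1_plus_Linf f \<longleftrightarrow> f \<in> borel_measurable borel \<and>
     (\<exists>B u. B \<ge> 0 \<and> u \<in> borel_measurable borel \<and> (\<integral>\<^sup>+x. u x) < \<infinity> \<and> (AE x in lborel. ennreal (norm (f x)) \<le> ennreal B + u x))"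

lemma nn_integral_reflect:
  fixes f :: "'a::euclidean_space \<Rightarrow> ennreal"
  assumes [measurable]: "f \<in> borel_measurable borel"
  shows "(\<integral>\<^sup>+x. f (y - x)) = (\<integral>\<^sup>+x. f x)"
proof -
  have "(\<integral>\<^sup>+x. f x) = (\<integral>\<^sup>+x. f x \<partial>density (distr lborel borel (\<lambda>x. y + (-1) *\<^sub>R x)) (\<lambda>_. ennreal (\<bar>-1\<bar> ^ DIM('a))))"
    by (subst lborel_affine[of "-1" y]) auto
  also have "\<dots> = (\<integral>\<^sup>+x. f (y - x))"
    by (subst nn_integral_density, measurable, subst nn_integral_distr) auto
  finally show ?thesis by simp
qed

lemma nn_integral_convol:
  fixes K :: "'a::euclidean_space \<Rightarrow> complex"
  assumes K: "integrable lborel K" and [measurable]: "u \<in> borel_measurable borel" and u: "(\<integral>\<^sup>+x. u x) = U"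
  shows "(\<integral>\<^sup>+y. (\<integral>\<^sup>+x. ennreal (norm (K (y - x))) * u x)) = L1_mass K * U"
proof -
  have [measurable]: "K \<in> borel_measurable borel" using K by auto
  have "(\<integral>\<^sup>+y. (\<integral>\<^sup>+x. ennreal (norm (K (y - x))) * u x))
    = (\<integral>\<^sup>+x. (\<integral>\<^sup>+y. ennreal (norm (K (y - x))) * u x))"
    by (rule lborel_pair.Fubini') measurable
  also have "\<dots> = (\<integral>\<^sup>+x. (L1_mass K) * u x)"
  proof (rule nn_integral_cong)
    fix x
    have "(\<integral>\<^sup>+y. ennreal (norm (K (y - x))) * u x) = L1_mass (\<lambda>y. K (y - x)) * u x"
      by (rule nn_integral_multc) measurable
    then show "(\<integral>\<^sup>+y. ennreal (norm (K (y - x))) * u x) = L1_mass K * u x"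
      by (simp add: nn_integral_translate_diff[of "\<lambda>x. ennreal (norm (K x))"])
  qed
  also have "\<dots> = L1_mass K * U"
    unfolding u[symmetric] by (rule nn_integral_cmult) measurable
  finally show ?thesis .
qed

lemma AE_integrable_convol:
  fixes K f :: "'a::euclidean_space \<Rightarrow> complex"
  assumes K: "integrable lborel K" and f: "L1_plus_Linf f"
  shows "AE y in lborel. integrable lborel (\<lambda>x. K (y - x) * f x)"
proof -
  obtain B u where [measurable]: "f \<in> borel_measurable borel" and B: "B \<ge> 0" and [measurable]: "u \<in> borel_measurable borel"
    and u: "(\<integral>\<^sup>+x. u x) < \<infinity>" and le: "AE x in lborel. ennreal (norm (f x)) \<le> ennreal B + u x"
    using f by (auto simp: L1_plus_Linf_def)
  have [measurable]: "K \<in> borel_measurable borel" using K by auto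
  have Kf: "L1_mass K < \<infinity>" using K by (simp add: integrable_iff_bounded)
  have "(\<integral>\<^sup>+y. (\<integral>\<^sup>+x. ennreal (norm (K (y - x))) * u x)) \<noteq> \<infinity>"
    using nn_integral_convol[OF K _ refl, of u] Kf u by (simp add: ennreal_mult_eq_top_iff less_top)
  then have "AE y in lborel. (\<integral>\<^sup>+x. ennreal (norm (K (y - x))) * u x) \<noteq> \<infinity>"
    by (intro nn_integral_PInf_AE) measurable
  then show ?thesis
  proof eventually_elim
    case (elim y)
    have "L1_mass (\<lambda>x. K (y - x) * f x)
      \<le> (\<integral>\<^sup>+x. ennreal (norm (K (y - x))) * ennreal B + ennreal (norm (K (y - x))) * u x)"
    proof (rule nn_integral_mono_AE)
      show "AE x in lborel. ennreal (norm (K (y - x) * f x)) \<le> ennreal (norm (K (y - x))) * ennreal B + ennreal (norm (K (y - x))) * u x"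
        using le by eventually_elim (auto simp: norm_mult ennreal_mult distrib_left[symmetric] intro!: mult_left_mono)
    qed
    also have "\<dots> = L1_mass (\<lambda>x. K (y - x)) * ennreal B + (\<integral>\<^sup>+x. ennreal (norm (K (y - x))) * u x)"
      by (subst nn_integral_add, measurable) (subst nn_integral_multc, measurable)
    also have "\<dots> < \<infinity>"
      using elim Kf by (simp add: nn_integral_reflect[of "\<lambda>x. ennreal (norm (K x))"] ennreal_mult_less_top less_top)
    finally show ?case by (intro integrableI_bounded) auto
  qed
qed

lemma integrable_convol_pair:
  fixes K f \<phi> :: "'a::euclidean_space \<Rightarrow> complex"
  assumes K: "integrable lborel K" and f: "L1_plus_Linf f" and \<phi>: "integrable lborel \<phi>" "bounded (range \<phi>)"
  shows "integrable (lborel \<Otimes>\<^sub>M lborel) (\<lambda>(y, x). \<phi> y * (K (y - x) * f x))"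
proof -
  obtain B u where [measurable]: "f \<in> borel_measurable borel" and B: "B \<ge> 0" and [measurable]: "u \<in> borel_measurable borel"
    and u: "(\<integral>\<^sup>+x. u x) < \<infinity>" and le: "AE x in lborel. ennreal (norm (f x)) \<le> ennreal B + u x"
    using f by (auto simp: L1_plus_Linf_def)
  obtain D where D: "\<And>x. norm (\<phi> x) \<le> D" using \<phi>(2) by (auto simp: bounded_iff)
  have [measurable]: "K \<in> borel_measurable borel" "\<phi> \<in> borel_measurable borel" using K \<phi> by auto
  have Kf: "L1_mass K < \<infinity>" using K by (simp add: integrable_iff_bounded)
  have \<phi>f: "L1_mass (\<lambda>x. \<phi> x) < \<infinity>" using \<phi> by (simp add: integrable_iff_bounded)
  show ?thesis
  proof (rule integrableI_bounded)
    show "(\<lambda>(y, x). \<phi> y * (K (y - x) * f x)) \<in> borel_measurable (lborel \<Otimes>\<^sub>M lborel)" by measurable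
    have "(\<integral>\<^sup>+z. ennreal (norm (case z of (y, x) \<Rightarrow> \<phi> y * (K (y - x) * f x))) \<partial>(lborel \<Otimes>\<^sub>M lborel))
      = (\<integral>\<^sup>+y. (L1_mass (\<lambda>x. \<phi> y * (K (y - x) * f x))))"
      by (subst lborel.nn_integral_fst[symmetric]) auto
    also have "\<dots> \<le> (\<integral>\<^sup>+y. (ennreal (norm (\<phi> y)) * (L1_mass K * ennreal B))
       + ennreal D * (\<integral>\<^sup>+x. ennreal (norm (K (y - x))) * u x))"
    proof (rule nn_integral_mono)
      fix y
      have "L1_mass (\<lambda>x. \<phi> y * (K (y - x) * f x))
        \<le> (\<integral>\<^sup>+x. ennreal (norm (\<phi> y)) * (ennreal (norm (K (y - x))) * ennreal B) + ennreal D * (ennreal (norm (K (y - x))) * u x))"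
      proof (rule nn_integral_mono_AE)
        show "AE x in lborel. ennreal (norm (\<phi> y * (K (y - x) * f x)))
          \<le> ennreal (norm (\<phi> y)) * (ennreal (norm (K (y - x))) * ennreal B) + ennreal D * (ennreal (norm (K (y - x))) * u x)"
          using le
        proof eventually_elim
          case (elim x)
          have "ennreal (norm (\<phi> y * (K (y - x) * f x))) = ennreal (norm (\<phi> y)) * (ennreal (norm (K (y - x))) * ennreal (norm (f x)))"
            by (simp add: norm_mult ennreal_mult)
          also have "\<dots> \<le> ennreal (norm (\<phi> y)) * (ennreal (norm (K (y - x))) * (ennreal B + u x))"
            by (intro mult_left_mono elim) auto
          also have "\<dots> = ennreal (norm (\<phi> y)) * (ennreal (norm (K (y - x))) * ennreal B) + ennreal (norm (\<phi> y)) * (ennreal (norm (K (y - x))) * u x)"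
            by (simp add: distrib_left)
          also have "\<dots> \<le> ennreal (norm (\<phi> y)) * (ennreal (norm (K (y - x))) * ennreal B) + ennreal D * (ennreal (norm (K (y - x))) * u x)"
            by (intro add_left_mono mult_right_mono ennreal_leI D) auto
          finally show ?case .
        qed
      qed
      also have "\<dots> = (\<integral>\<^sup>+x. ennreal (norm (\<phi> y)) * (ennreal (norm (K (y - x))) * ennreal B))
          + (\<integral>\<^sup>+x. ennreal D * (ennreal (norm (K (y - x))) * u x))"
        by (rule nn_integral_add) measurable
      also have "(\<integral>\<^sup>+x. ennreal D * (ennreal (norm (K (y - x))) * u x)) = ennreal D * (\<integral>\<^sup>+x. ennreal (norm (K (y - x))) * u x)"
        by (rule nn_integral_cmult) measurable
      also have "(\<integral>\<^sup>+x. ennreal (norm (\<phi> y)) * (ennreal (norm (K (y - x))) * ennreal B))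
        = ennreal (norm (\<phi> y)) * (L1_mass (\<lambda>x. K (y - x)) * ennreal B)"
        by (subst nn_integral_cmult, measurable) (subst nn_integral_multc, measurable)
      also have "L1_mass (\<lambda>x. K (y - x)) = L1_mass K"
        by (rule nn_integral_reflect) measurable
      finally show "L1_mass (\<lambda>x. \<phi> y * (K (y - x) * f x)) \<le> (ennreal (norm (\<phi> y)) * (L1_mass K * ennreal B))
         + ennreal D * (\<integral>\<^sup>+x. ennreal (norm (K (y - x))) * u x)" .
    qed
    also have "\<dots> = (\<integral>\<^sup>+y. ennreal (norm (\<phi> y)) * (L1_mass K * ennreal B))
      + (\<integral>\<^sup>+y. ennreal D * (\<integral>\<^sup>+x. ennreal (norm (K (y - x))) * u x))"
      by (rule nn_integral_add) measurable
    also have "(\<integral>\<^sup>+y. ennreal (norm (\<phi> y)) * (L1_mass K * ennreal B))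
      = L1_mass (\<lambda>y. \<phi> y) * (L1_mass K * ennreal B)"
      by (rule nn_integral_multc) measurable
    also have "(\<integral>\<^sup>+y. ennreal D * (\<integral>\<^sup>+x. ennreal (norm (K (y - x))) * u x))
      = ennreal D * (L1_mass K * (\<integral>\<^sup>+x. u x))"
      by (subst nn_integral_cmult, measurable) (subst nn_integral_convol[OF K _ refl], auto)
    also have "L1_mass (\<lambda>y. \<phi> y) * (L1_mass K * ennreal B)
       + ennreal D * (L1_mass K * (\<integral>\<^sup>+x. u x)) < \<infinity>"
      using Kf \<phi>f u by (simp add: ennreal_mult_less_top)
    finally show "(\<integral>\<^sup>+z. ennreal (norm (case z of (y, x) \<Rightarrow> \<phi> y * (K (y - x) * f x))) \<partial>(lborel \<Otimes>\<^sub>M lborel)) < \<infinity>" .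
  qed
qed

text \<open>
  Fubini's theorem shows that the distribution is a function: the kernel acts on the Schwartz function
  in the first formula and on \<open>f\<close> in the second.
\<close>

lemma multiplier_op_eq_convol:
  fixes m f \<phi> :: "'a::euclidean_space \<Rightarrow> complex"
  assumes m: "integrable lborel m" and K: "integrable lborel (inv_fourier m)"
    and f: "L1_plus_Linf f" and \<phi>: "integrable lborel \<phi>" "bounded (range \<phi>)"
  shows "multiplier_op m f \<phi> = (\<integral>x. f x * (\<integral>y. \<phi> y * inv_fourier m (y - x)))"
    and "multiplier_op m f \<phi> = regular_dist (convol (inv_fourier m) f) \<phi>"
proof -
  show 1: "multiplier_op m f \<phi> = (\<integral>x. f x * (\<integral>y. \<phi> y * inv_fourier m (y - x)))"
    unfolding multiplier_op_def dist_inv_fourier_def dist_mult_def dist_fourier_def regular_dist_def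
      fourier_multiplied_inv_fourier[OF m \<phi>(1)] ..
  have "(\<integral>x. f x * (\<integral>y. \<phi> y * inv_fourier m (y - x)))
    = (\<integral>x. (\<integral>y. \<phi> y * (inv_fourier m (y - x) * f x)))"
  proof (intro Bochner_Integration.integral_cong refl)
    fix x
    have "\<phi> y * (inv_fourier m (y - x) * f x) = f x * (\<phi> y * inv_fourier m (y - x))" for y by simp
    then show "f x * (\<integral>y. \<phi> y * inv_fourier m (y - x)) = (\<integral>y. \<phi> y * (inv_fourier m (y - x) * f x))"
      by (simp only: integral_mult_right_zero)
  qed
  also have "\<dots> = (\<integral>y. (\<integral>x. \<phi> y * (inv_fourier m (y - x) * f x)))"
    by (rule lborel_pair.Fubini_integral[OF integrable_convol_pair[OF K f \<phi>]])
  also have "\<dots> = regular_dist (convol (inv_fourier m) f) \<phi>"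
    unfolding regular_dist_def convol_def by (simp add: mult.commute)
  finally show "multiplier_op m f \<phi> = regular_dist (convol (inv_fourier m) f) \<phi>" unfolding 1 .
qed

lemma schwartz_continuous:
  assumes "schwartz \<phi>"
  shows "continuous_on UNIV \<phi>"
proof -
  have "\<phi> differentiable (at x)" for x
    using assms unfolding schwartz_def by (metis empty_subsetI iterated_partial.simps(1) list.set(1))
  then show ?thesis
    by (simp add: continuous_on_eq_continuous_at differentiable_imp_continuous_within)
qed

lemma schwartz_decay:
  assumes "schwartz \<phi>"
  obtains B where "\<And>x. norm x ^ k * norm (\<phi> x) \<le> B"
proof -
  have "bounded (range (\<lambda>x. norm x ^ k * norm (\<phi> x)))"
    using assms unfolding schwartz_def by (metis empty_subsetI iterated_partial.simps(1) list.set(1))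
  then obtain B where "\<And>x. norm (norm x ^ k * norm (\<phi> x)) \<le> B" by (auto simp: bounded_iff)
  then show ?thesis using that by auto
qed

lemma schwartz_bounded:
  assumes "schwartz \<phi>"
  shows "bounded (range \<phi>)"
proof -
  obtain B where "\<And>x. norm x ^ 0 * norm (\<phi> x) \<le> B" using schwartz_decay[OF assms, of 0] by metis
  then show ?thesis by (auto simp: bounded_iff)
qed

text \<open>
  A Schwartz function is dominated by a product of one-dimensional Poisson kernels.
\<close>

lemma schwartz_integrable:
  fixes \<phi> :: "'a::euclidean_space \<Rightarrow> complex"
  assumes "schwartz \<phi>"
  shows "integrable lborel \<phi>"
proof -
  define n where "n = DIM('a)"
  obtain B0 where B0: "\<And>x. norm x ^ 0 * norm (\<phi> x) \<le> B0" using schwartz_decay[OF assms, of 0] by metis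
  obtain B1 where B1: "\<And>x. norm x ^ (2 * n) * norm (\<phi> x) \<le> B1" using schwartz_decay[OF assms, of "2 * n"] by metis
  define W where "W x = (\<Prod>b\<in>Basis. complex_of_real (poisson_kernel 1 (x \<bullet> b)))" for x :: 'a
  have pk: "integrable lborel (\<lambda>t. complex_of_real (poisson_kernel 1 t))"
  proof -
    have "poisson_kernel 1 (0 - t) = poisson_kernel 1 t" for t by (simp add: poisson_kernel_def)
    then show ?thesis using integrable_poisson_kernel(1)[of 1 0] by simp
  qed
  have W: "integrable lborel W" unfolding W_def by (rule integrable_prod_Basis) (rule pk)
  have "norm (\<phi> x) \<le> norm (complex_of_real (2 ^ n * (B0 + B1)) * W x)" for x
  proof -
    have "(\<Prod>b\<in>Basis. (x \<bullet> b)^2 + 1) \<le> (\<Prod>b\<in>(Basis :: 'a set). (norm x)^2 + 1)"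
    proof (rule prod_mono)
      fix b :: 'a assume "b \<in> Basis"
      then have "\<bar>x \<bullet> b\<bar>^2 \<le> (norm x)^2" by (intro power_mono Basis_le_norm) auto
      then show "0 \<le> (x \<bullet> b)^2 + 1 \<and> (x \<bullet> b)^2 + 1 \<le> (norm x)^2 + 1" by simp
    qed
    also have "\<dots> = ((norm x)^2 + 1) ^ n" by (simp add: n_def)
    also have "\<dots> \<le> (2 * max 1 ((norm x)^2)) ^ n" by (intro power_mono) auto
    also have "\<dots> = 2 ^ n * (max 1 ((norm x)^2)) ^ n" by (simp add: power_mult_distrib)
    also have "(max 1 ((norm x)^2)) ^ n \<le> 1 + norm x ^ (2 * n)"
      by (cases "1 \<le> (norm x)^2") (auto simp: max_def power_mult)
    finally have "(\<Prod>b\<in>Basis. (x \<bullet> b)^2 + 1) \<le> 2 ^ n * (1 + norm x ^ (2 * n))" by simp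
    then have "norm (\<phi> x) * (\<Prod>b\<in>Basis. (x \<bullet> b)^2 + 1) \<le> norm (\<phi> x) * (2 ^ n * (1 + norm x ^ (2 * n)))"
      by (intro mult_left_mono) auto
    also have "\<dots> = 2 ^ n * (norm x ^ 0 * norm (\<phi> x) + norm x ^ (2 * n) * norm (\<phi> x))" by (simp add: algebra_simps)
    also have "\<dots> \<le> 2 ^ n * (B0 + B1)" by (intro mult_left_mono add_mono B0 B1) auto
    finally have le: "norm (\<phi> x) * (\<Prod>b\<in>Basis. (x \<bullet> b)^2 + 1) \<le> 2 ^ n * (B0 + B1)" .
    have pos: "(\<Prod>b\<in>Basis. (x \<bullet> b)^2 + 1) > 0" by (intro prod_pos) (simp add: add_nonneg_pos)
    have "W x = complex_of_real (1 / (\<Prod>b\<in>Basis. (x \<bullet> b)^2 + 1))"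
      unfolding W_def of_real_prod[symmetric] poisson_kernel_def prod_dividef by simp
    then have nW: "norm (W x) = 1 / (\<Prod>b\<in>Basis. (x \<bullet> b)^2 + 1)"
      using pos by (simp only: norm_of_real) simp
    have "norm (\<phi> x) \<le> 2 ^ n * (B0 + B1) / (\<Prod>b\<in>Basis. (x \<bullet> b)^2 + 1)"
      using le pos by (simp add: pos_le_divide_eq)
    also have "\<dots> \<le> norm (complex_of_real (2 ^ n * (B0 + B1)) * W x)"
      unfolding norm_mult norm_of_real nW using pos by (simp add: divide_right_mono)
    finally show ?thesis .
  qed
  moreover have "\<phi> \<in> borel_measurable lborel"
    using borel_measurable_continuous_onI[OF schwartz_continuous[OF assms]] by simp
  ultimately show ?thesis
    by (intro Bochner_Integration.integrable_bound[OF integrable_mult_right[OF W, of "complex_of_real (2 ^ n * (B0 + B1))"]]) auto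
qed

section \<open>Upper bounds for multiplier norms\<close>

lemma integral_affine_subst:
  fixes g :: "'a::euclidean_space \<Rightarrow> complex"
  assumes [measurable]: "g \<in> borel_measurable borel" and c: "c \<noteq> 0"
  shows "(\<integral>x. g x) = (\<bar>c\<bar> ^ DIM('a)) *\<^sub>R (\<integral>x. g (t + c *\<^sub>R x))"
proof -
  have "(\<integral>x. g x) = (\<integral>x. g x \<partial>density (distr lborel borel (\<lambda>x. t + c *\<^sub>R x)) (\<lambda>_. ennreal (\<bar>c\<bar> ^ DIM('a))))"
    by (subst lborel_affine[OF c, of t]) simp
  also have "\<dots> = (\<integral>x. (\<bar>c\<bar> ^ DIM('a)) *\<^sub>R g x \<partial>distr lborel borel (\<lambda>x. t + c *\<^sub>R x))"
    by (rule integral_density) auto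
  also have "\<dots> = (\<integral>x. (\<bar>c\<bar> ^ DIM('a)) *\<^sub>R g (t + c *\<^sub>R x))"
    by (rule integral_distr) auto
  finally show ?thesis by simp
qed

lemma integral_reflect_euclidean:
  fixes g :: "'a::euclidean_space \<Rightarrow> complex"
  assumes "g \<in> borel_measurable borel"
  shows "(\<integral>x. g (y - x)) = (\<integral>x. g x)"
  using integral_affine_subst[OF assms, of "-1" y] by simp

lemma Lp_norm_eq_1_imp:
  fixes f :: "'a::euclidean_space \<Rightarrow> complex"
  assumes p: "0 < p" "p < \<infinity>" and f: "Lp_norm p f = 1"
  shows "Lp_mass (enn2real p) f = 1"
proof -
  define I where "I = Lp_mass (enn2real p) f"
  have P: "enn2real p > 0" using p by (simp add: enn2real_positive_iff)
  have *: "(if I = \<infinity> then \<infinity> else ennreal (enn2real I powr (1 / enn2real p))) = 1"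
  proof -
    have "p \<noteq> \<infinity>" using p(2) by auto
    with f show ?thesis unfolding Lp_norm_def I_def Let_def by (simp only: if_False)
  qed
  then have fin: "I \<noteq> \<infinity>" by (auto split: if_splits)
  with * have "enn2real I powr (1 / enn2real p) = 1" by simp
  then have "(enn2real I powr (1 / enn2real p)) powr enn2real p = 1" by simp
  then have "enn2real I = 1" using P by (simp add: powr_powr)
  then have "I = 1" using fin by (metis ennreal_1 ennreal_enn2real infinity_ennreal_def less_top)
  then show ?thesis by (simp add: I_def)
qed

lemma Lp_norm_le_powr:
  fixes f :: "'a::euclidean_space \<Rightarrow> complex"
  assumes p: "0 < p" "p < \<infinity>" and C: "C \<ge> 0"
    and f: "Lp_mass (enn2real p) f \<le> ennreal C"
  shows "Lp_norm p f \<le> ennreal (C powr (1 / enn2real p))"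
proof -
  define I where "I = Lp_mass (enn2real p) f"
  have I: "I \<le> ennreal C" using f by (simp add: I_def)
  then have fin: "I \<noteq> \<infinity>" by (auto simp: top_unique)
  have "enn2real I \<le> C" using I C by (simp add: enn2real_leI)
  then have "enn2real I powr (1 / enn2real p) \<le> C powr (1 / enn2real p)" by (intro powr_mono2) auto
  then show ?thesis using p fin unfolding Lp_norm_def I_def Let_def by (auto intro: ennreal_leI)
qed

lemma L1_plus_Linf_Lp_space:
  fixes f :: "'a::euclidean_space \<Rightarrow> complex"
  assumes p: "1 \<le> p" and f: "f \<in> Lp_space p"
  shows "L1_plus_Linf f"
proof -
  have fm[measurable]: "f \<in> borel_measurable borel" and fin: "Lp_norm p f < \<infinity>" using f by (auto simp: Lp_space_def)
  show ?thesis
  proof (cases "p = \<infinity>")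
    case True
    define B where "B = enn2real (Lp_norm p f)"
    have "AE x in lborel. ennreal (norm (f x)) \<le> Lp_norm p f"
      using esssup_AE[of "\<lambda>x. ennreal (norm (f x))" lborel] True by (simp add: Lp_norm_def)
    then have "AE x in lborel. ennreal (norm (f x)) \<le> ennreal B + 0"
      using fin by (simp add: B_def ennreal_enn2real)
    then show ?thesis unfolding L1_plus_Linf_def
      by (intro conjI exI[of _ B] exI[of _ "\<lambda>_. 0"]) (auto simp: B_def)
  next
    case False
    define P where "P = enn2real p"
    have P: "P \<ge> 1" using p False enn2real_mono[of 1 p] by (simp add: P_def less_top)
    have "Lp_mass P f < \<infinity>"
      using fin False unfolding Lp_norm_def Let_def P_def by (auto split: if_splits simp: less_top)
    moreover have "ennreal (norm (f x)) \<le> ennreal 1 + ennreal (norm (f x) powr P)" for x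
    proof -
      have "norm (f x) \<le> 1 + norm (f x) powr P"
      proof (cases "norm (f x) \<le> 1")
        case True
        then show ?thesis by (simp add: add_increasing2)
      next
        case False
        then have "norm (f x) powr 1 \<le> norm (f x) powr P" using P by (intro powr_mono) auto
        then show ?thesis using False by simp
      qed
      then show ?thesis by (simp add: ennreal_plus[symmetric] del: ennreal_plus ennreal_1)
    qed
    ultimately show ?thesis unfolding L1_plus_Linf_def
      by (intro conjI exI[of _ 1] exI[of _ "\<lambda>x. ennreal (norm (f x) powr P)"]) auto
  qed
qed

lemma multiplier_norm_leI:
  fixes m :: "'a::euclidean_space \<Rightarrow> complex"
  assumes m: "integrable lborel m" and K: "integrable lborel (inv_fourier m)" and p: "1 \<le> p"
    and le: "\<And>f :: 'a \<Rightarrow> complex. f \<in> Lp_space p \<Longrightarrow> Lp_norm p f = 1 \<Longrightarrow> Lp_norm p (convol (inv_fourier m) f) \<le> c"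
    and c: "c < \<infinity>"
  shows "multiplier_norm p m \<le> c"
  unfolding multiplier_norm_def
proof (rule SUP_least)
  fix f :: "'a \<Rightarrow> complex" assume "f \<in> {f \<in> Lp_space p. Lp_norm p f = 1}"
  then have f: "f \<in> Lp_space p" "Lp_norm p f = 1" by auto
  have f': "L1_plus_Linf f" by (rule L1_plus_Linf_Lp_space[OF p f(1)])
  have [measurable]: "f \<in> borel_measurable borel" "inv_fourier m \<in> borel_measurable borel"
    using f K by (auto simp: Lp_space_def)
  have "convol (inv_fourier m) f \<in> Lp_space p"
    using le[OF f] c unfolding Lp_space_def by (auto intro: le_less_trans)
  moreover have "\<forall>\<phi>. schwartz \<phi> \<longrightarrow> multiplier_op m f \<phi> = regular_dist (convol (inv_fourier m) f) \<phi>"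
    by (intro allI impI multiplier_op_eq_convol(2)[OF m K f'] schwartz_integrable schwartz_bounded)
  ultimately have "dist_Lp_norm p (multiplier_op m f) \<le> Lp_norm p (convol (inv_fourier m) f)"
    unfolding dist_Lp_norm_def by (intro Inf_lower) blast
  also have "\<dots> \<le> c" by (rule le[OF f])
  finally show "dist_Lp_norm p (multiplier_op m f) \<le> c" .
qed

text \<open>
  The function is truncated at height \<open>n\<close>; the convolutions converge wherever the full integral
  converges absolutely, hence almost everywhere.
\<close>

lemma convol_Lp_bound_unbounded:
  fixes K f :: "'a::euclidean_space \<Rightarrow> complex"
  assumes K: "integrable lborel K" and p: "p > 0" and f: "L1_plus_Linf f"
    and bound: "\<And>F. F \<in> borel_measurable borel \<Longrightarrow> bounded (range F) \<Longrightarrow>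
       (Lp_mass p (convol K F)) \<le> ennreal C * Lp_mass p F"
  shows "Lp_mass p (convol K f) \<le> ennreal C * Lp_mass p f"
proof -
  have [measurable]: "K \<in> borel_measurable borel" "f \<in> borel_measurable borel"
    using K f by (auto simp: L1_plus_Linf_def)
  define fn where "fn n x = (if norm (f x) \<le> real n then f x else 0)" for n x
  have fnm[measurable]: "fn n \<in> borel_measurable borel" for n unfolding fn_def by measurable
  have fnb: "bounded (range (fn n))" for n
    unfolding bounded_iff by (intro exI[of _ "real n"]) (auto simp: fn_def)
  have fn_le: "norm (fn n x) \<le> norm (f x)" for n x by (simp add: fn_def)
  have fn_lim: "(\<lambda>n. fn n x) \<longlonglongrightarrow> f x" for x
  proof -
    obtain N where N: "norm (f x) \<le> real N" using real_arch_simple by blast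
    have "\<forall>\<^sub>F n in sequentially. fn n x = f x"
      using eventually_ge_at_top[of N] by eventually_elim (use N in \<open>auto simp: fn_def\<close>)
    then show ?thesis by (rule tendsto_eventually)
  qed
  show ?thesis
  proof (rule nn_integral_le_of_fatou[OF _ _ always_eventually tendsto_const])
    show "(\<lambda>x. ennreal (norm (convol K (fn n) x) powr p)) \<in> borel_measurable lborel" for n by measurable
    show "AE x in lborel. (\<lambda>n. ennreal (norm (convol K (fn n) x) powr p)) \<longlonglongrightarrow> ennreal (norm (convol K f x) powr p)"
      using AE_integrable_convol[OF K f]
    proof eventually_elim
      case (elim y)
      have "(\<lambda>n. convol K (fn n) y) \<longlonglongrightarrow> convol K f y"
        unfolding convol_def
      proof (rule integral_dominated_convergence[where w="\<lambda>x. norm (K (y - x) * f x)"])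
        show "integrable lborel (\<lambda>x. norm (K (y - x) * f x))" using elim by (rule integrable_norm)
        show "AE x in lborel. norm (K (y - x) * fn n x) \<le> norm (K (y - x) * f x)" for n
          unfolding norm_mult by (intro AE_I2 mult_left_mono fn_le) simp
        show "AE x in lborel. (\<lambda>n. K (y - x) * fn n x) \<longlonglongrightarrow> K (y - x) * f x"
          by (intro AE_I2 tendsto_intros fn_lim)
      qed measurable
      then show ?case using p by (rule tendsto_ennreal_norm_powr)
    qed
    show "\<forall>n. (Lp_mass p (convol K (fn n))) \<le> ennreal C * Lp_mass p f"
    proof
      fix n
      have "Lp_mass p (convol K (fn n)) \<le> ennreal C * Lp_mass p (\<lambda>x. fn n x)"
        by (rule bound[OF fnm fnb])
      also have "\<dots> \<le> ennreal C * Lp_mass p f"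
        using p by (intro mult_left_mono nn_integral_mono ennreal_leI powr_mono2 fn_le) auto
      finally show "Lp_mass p (convol K (fn n)) \<le> ennreal C * Lp_mass p f" .
    qed
  qed
qed

lemma multiplier_norm_le_of_convol_bound:
  fixes m :: "'a::euclidean_space \<Rightarrow> complex"
  assumes m: "integrable lborel m" and K: "integrable lborel (inv_fourier m)" and p: "1 < p" "p < \<infinity>" and C: "C \<ge> 0"
    and bound: "\<And>F. F \<in> borel_measurable borel \<Longrightarrow> bounded (range F) \<Longrightarrow>
       (Lp_mass (enn2real p) (convol (inv_fourier m) F))
          \<le> ennreal C * Lp_mass (enn2real p) F"
  shows "multiplier_norm p m \<le> ennreal (C powr (1 / enn2real p))"
proof (rule multiplier_norm_leI[OF m K])
  show p1: "1 \<le> p" using p by simp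
  have p0: "0 < p" using p by (meson less_trans zero_less_one)
  have P: "enn2real p > 0" using p0 p by (simp add: enn2real_positive_iff)
  fix f :: "'a \<Rightarrow> complex" assume f: "f \<in> Lp_space p" "Lp_norm p f = 1"
  have "Lp_mass (enn2real p) (convol (inv_fourier m) f)
      \<le> ennreal C * Lp_mass (enn2real p) f"
    by (rule convol_Lp_bound_unbounded[OF K P L1_plus_Linf_Lp_space[OF p1 f(1)] bound])
  then have "Lp_mass (enn2real p) (convol (inv_fourier m) f) \<le> ennreal C"
    unfolding Lp_norm_eq_1_imp[OF p0 p(2) f(2)] by simp
  then show "Lp_norm p (convol (inv_fourier m) f) \<le> ennreal (C powr (1 / enn2real p))"
    by (rule Lp_norm_le_powr[OF p0 p(2) C])
qed simp

lemma ennreal_norm_convol_le: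
  fixes K f :: "'a::euclidean_space \<Rightarrow> complex"
  shows "ennreal (norm (convol K f y)) \<le> (\<integral>\<^sup>+x. ennreal (norm (K (y - x))) * ennreal (norm (f x)))"
proof -
  have "ennreal (norm (convol K f y)) \<le> L1_mass (\<lambda>x. K (y - x) * f x)"
    unfolding convol_def
    by (cases "integrable lborel (\<lambda>x. K (y - x) * f x)")
      (auto intro: integral_norm_bound_ennreal simp: not_integrable_integral_eq)
  then show ?thesis by (simp add: norm_mult ennreal_mult)
qed

lemma multiplier_norm_1_le:
  fixes m :: "'a::euclidean_space \<Rightarrow> complex"
  assumes m: "integrable lborel m" and K: "integrable lborel (inv_fourier m)"
  shows "multiplier_norm 1 m \<le> L1_mass (inv_fourier m)"
proof (rule multiplier_norm_leI[OF m K])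
  show fin: "L1_mass (inv_fourier m) < \<infinity>" using K by (simp add: integrable_iff_bounded)
  fix f :: "'a \<Rightarrow> complex" assume f: "f \<in> Lp_space 1" "Lp_norm 1 f = 1"
  have [measurable]: "f \<in> borel_measurable borel" using f by (auto simp: Lp_space_def)
  have f1: "L1_mass f = 1"
    using Lp_norm_eq_1_imp[OF _ _ f(2)] by simp
  have "Lp_mass (enn2real 1) (convol (inv_fourier m) f)
    \<le> (\<integral>\<^sup>+y. (\<integral>\<^sup>+x. ennreal (norm (inv_fourier m (y - x))) * ennreal (norm (f x))))"
    by (intro nn_integral_mono) (simp add: ennreal_norm_convol_le)
  also have "\<dots> = L1_mass (inv_fourier m)"
    using nn_integral_convol[OF K _ f1] by simp
  also have "\<dots> = ennreal (enn2real (L1_mass (inv_fourier m)))"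
    using fin by (simp add: ennreal_enn2real)
  finally have "Lp_norm 1 (convol (inv_fourier m) f)
    \<le> ennreal (enn2real (L1_mass (inv_fourier m)) powr (1 / enn2real 1))"
    by (intro Lp_norm_le_powr) auto
  also have "\<dots> = L1_mass (inv_fourier m)"
    using fin by (simp add: ennreal_enn2real)
  finally show "Lp_norm 1 (convol (inv_fourier m) f) \<le> L1_mass (inv_fourier m)" .
qed simp

lemma multiplier_norm_inf_le:
  fixes m :: "'a::euclidean_space \<Rightarrow> complex"
  assumes m: "integrable lborel m" and K: "integrable lborel (inv_fourier m)"
  shows "multiplier_norm \<infinity> m \<le> L1_mass (inv_fourier m)"
proof (rule multiplier_norm_leI[OF m K])
  show fin: "L1_mass (inv_fourier m) < \<infinity>" using K by (simp add: integrable_iff_bounded)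
  fix f :: "'a \<Rightarrow> complex" assume f: "f \<in> Lp_space \<infinity>" "Lp_norm \<infinity> f = 1"
  have [measurable]: "f \<in> borel_measurable borel" "inv_fourier m \<in> borel_measurable borel"
    using f K by (auto simp: Lp_space_def)
  have le1: "AE x in lborel. ennreal (norm (f x)) \<le> 1"
    using esssup_AE[of "\<lambda>x. ennreal (norm (f x))" lborel] f(2) by (simp add: Lp_norm_def)
  have "ennreal (norm (convol (inv_fourier m) f y)) \<le> L1_mass (inv_fourier m)" for y
  proof -
    have "ennreal (norm (convol (inv_fourier m) f y)) \<le> (\<integral>\<^sup>+x. ennreal (norm (inv_fourier m (y - x))) * ennreal (norm (f x)))"
      by (rule ennreal_norm_convol_le)
    also have "\<dots> \<le> (\<integral>\<^sup>+x. ennreal (norm (inv_fourier m (y - x))) * 1)"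
      by (intro nn_integral_mono_AE) (use le1 in eventually_elim, rule mult_left_mono, auto)
    also have "\<dots> = L1_mass (inv_fourier m)"
      by (simp add: nn_integral_reflect[of "\<lambda>x. ennreal (norm (inv_fourier m x))"])
    finally show ?thesis .
  qed
  then show "Lp_norm \<infinity> (convol (inv_fourier m) f) \<le> L1_mass (inv_fourier m)"
    unfolding Lp_norm_def by (auto intro!: esssup_I)
qed simp

lemma norm_inv_fourier_le:
  fixes m :: "'a::euclidean_space \<Rightarrow> complex"
  assumes m: "integrable lborel m"
  shows "norm (inv_fourier m x) \<le> (\<integral>\<xi>. norm (m \<xi>)) / (2 * pi) ^ DIM('a)"
proof -
  have "norm (\<integral>\<xi>. m \<xi> * cis (x \<bullet> \<xi>)) \<le> (\<integral>\<xi>. norm (m \<xi> * cis (x \<bullet> \<xi>)))"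
    by (rule integral_norm_bound)
  then have "norm (\<integral>\<xi>. m \<xi> * cis (x \<bullet> \<xi>)) \<le> (\<integral>\<xi>. norm (m \<xi>))" by (simp add: norm_mult)
  then show ?thesis unfolding inv_fourier_def norm_mult norm_of_real
    by (simp add: divide_right_mono power_mult_distrib)
qed

lemma isCont_inv_fourier:
  fixes m :: "'a::euclidean_space \<Rightarrow> complex"
  assumes m: "integrable lborel m"
  shows "isCont (inv_fourier m) x"
  unfolding continuous_at_sequentially o_def
proof (intro allI impI)
  fix X assume X: "X \<longlonglongrightarrow> x"
  have [measurable]: "m \<in> borel_measurable borel" using m by auto
  have cm: "(\<lambda>\<xi>. cis (y \<bullet> \<xi>)) \<in> borel_measurable lborel" for y :: 'a
    by (intro cis_inner_measurable) auto
  have "(\<lambda>n. \<integral>\<xi>. m \<xi> * cis (X n \<bullet> \<xi>)) \<longlonglongrightarrow> (\<integral>\<xi>. m \<xi> * cis (x \<bullet> \<xi>))"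
  proof (rule integral_dominated_convergence[where w="\<lambda>\<xi>. norm (m \<xi>)"])
    show "AE \<xi> in lborel. (\<lambda>n. m \<xi> * cis (X n \<bullet> \<xi>)) \<longlonglongrightarrow> m \<xi> * cis (x \<bullet> \<xi>)"
    proof (intro AE_I2 tendsto_mult tendsto_const)
      fix \<xi>
      have "isCont cis (x \<bullet> \<xi>)"
        using continuous_on_cis[OF continuous_on_id, of UNIV] by (simp add: continuous_on_eq_continuous_at)
      then show "(\<lambda>n. cis (X n \<bullet> \<xi>)) \<longlonglongrightarrow> cis (x \<bullet> \<xi>)"
        by (rule isCont_tendsto_compose) (intro tendsto_intros X)
    qed
  qed (use m cm in \<open>auto simp: norm_mult intro!: borel_measurable_times\<close>)
  then show "(\<lambda>n. inv_fourier m (X n)) \<longlonglongrightarrow> inv_fourier m x"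
    unfolding inv_fourier_def by (intro tendsto_mult tendsto_const)
qed

section \<open>Gaussians as test functions and approximate identities\<close>

text \<open>
  The polynomials in the coordinates. They are closed under directional derivatives, so that every
  iterated partial derivative of a Gaussian is the Gaussian times such a function.
\<close>

inductive coord_poly :: "('a::euclidean_space \<Rightarrow> complex) \<Rightarrow> bool" where
  const: "coord_poly (\<lambda>_. c)"
| coord: "coord_poly (\<lambda>x. complex_of_real (x \<bullet> v))"
| add: "coord_poly P \<Longrightarrow> coord_poly Q \<Longrightarrow> coord_poly (\<lambda>x. P x + Q x)"
| mult: "coord_poly P \<Longrightarrow> coord_poly Q \<Longrightarrow> coord_poly (\<lambda>x. P x * Q x)"

lemma coord_poly_has_derivative:
  assumes "coord_poly P"
  shows "\<exists>D. (\<forall>x. (P has_derivative D x) (at x)) \<and> (\<forall>v. coord_poly (\<lambda>x. D x v))"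
  using assms
proof induction
  case (const c)
  show ?case
    by (rule exI[of _ "\<lambda>_ _. 0"]) (auto intro: coord_poly.const)
next
  case (coord v)
  have "((\<lambda>x. complex_of_real (x \<bullet> v)) has_derivative (\<lambda>h. complex_of_real (h \<bullet> v))) (at x)" for x
    by (auto intro!: derivative_eq_intros)
  then show ?case
    by (intro exI[of _ "\<lambda>_ h. complex_of_real (h \<bullet> v)"]) (auto intro: coord_poly.const)
next
  case (add P Q)
  then obtain D E where D: "\<And>x. (P has_derivative D x) (at x)" "\<And>v. coord_poly (\<lambda>x. D x v)"
    and E: "\<And>x. (Q has_derivative E x) (at x)" "\<And>v. coord_poly (\<lambda>x. E x v)" by metis
  show ?case
    by (rule exI[of _ "\<lambda>x h. D x h + E x h"]) (auto intro!: coord_poly.add D E has_derivative_add)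
next
  case (mult P Q)
  then obtain D E where D: "\<And>x. (P has_derivative D x) (at x)" "\<And>v. coord_poly (\<lambda>x. D x v)"
    and E: "\<And>x. (Q has_derivative E x) (at x)" "\<And>v. coord_poly (\<lambda>x. E x v)" by metis
  show ?case
    by (rule exI[of _ "\<lambda>x h. P x * E x h + D x h * Q x"])
      (auto intro!: coord_poly.add coord_poly.mult mult.hyps D E has_derivative_mult)
qed

lemma coord_poly_growth:
  assumes "coord_poly P"
  shows "\<exists>A N. A \<ge> 0 \<and> (\<forall>x. norm (P x) \<le> A * (1 + norm x) ^ N)"
  using assms
proof induction
  case (const c)
  show ?case by (rule exI[of _ "norm c"], rule exI[of _ 0]) simp
next
  case (coord v)
  have "norm (complex_of_real (x \<bullet> v)) \<le> norm v * (1 + norm x) ^ 1" for x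
    using Cauchy_Schwarz_ineq2[of x v] by (simp add: algebra_simps add_increasing)
  then show ?case by (intro exI[of _ "norm v"] exI[of _ 1]) simp
next
  case (add P Q)
  then obtain A N B M where A: "A \<ge> 0" "\<And>x. norm (P x) \<le> A * (1 + norm x) ^ N"
    and B: "B \<ge> 0" "\<And>x. norm (Q x) \<le> B * (1 + norm x) ^ M" by metis
  have "norm (P x + Q x) \<le> (A + B) * (1 + norm x) ^ (N + M)" for x
  proof -
    have "A * (1 + norm x) ^ N \<le> A * (1 + norm x) ^ (N + M)" "B * (1 + norm x) ^ M \<le> B * (1 + norm x) ^ (N + M)"
      using A(1) B(1) by (auto intro!: mult_left_mono power_increasing)
    then show ?thesis using norm_triangle_ineq[of "P x" "Q x"] A(2)[of x] B(2)[of x] by (simp add: distrib_right)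
  qed
  then show ?case using A B by (intro exI[of _ "A + B"] exI[of _ "N + M"]) auto
next
  case (mult P Q)
  then obtain A N B M where A: "A \<ge> 0" "\<And>x. norm (P x) \<le> A * (1 + norm x) ^ N"
    and B: "B \<ge> 0" "\<And>x. norm (Q x) \<le> B * (1 + norm x) ^ M" by metis
  have "norm (P x * Q x) \<le> (A * B) * (1 + norm x) ^ (N + M)" for x
  proof -
    have "norm (P x * Q x) \<le> (A * (1 + norm x) ^ N) * (B * (1 + norm x) ^ M)"
      unfolding norm_mult using A B by (intro mult_mono) auto
    then show ?thesis by (simp add: power_add mult_ac)
  qed
  then show ?case using A B by (intro exI[of _ "A * B"] exI[of _ "N + M"]) auto
qed

definition gaussian :: "real \<Rightarrow> 'a::euclidean_space \<Rightarrow> 'a \<Rightarrow> complex" where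
  "gaussian c a x = complex_of_real (exp (- c * (norm (x - a))\<^sup>2))"

lemma gaussian_has_derivative:
  "(gaussian c a has_derivative (\<lambda>h. gaussian c a x * complex_of_real (- 2 * c * ((x - a) \<bullet> h)))) (at x)"
proof -
  have "((\<lambda>x. exp (- c * ((x - a) \<bullet> (x - a)))) has_derivative (\<lambda>h. exp (- c * ((x - a) \<bullet> (x - a))) * (- 2 * c * ((x - a) \<bullet> h)))) (at x)"
    by (rule derivative_eq_intros refl)+ (auto simp: fun_eq_iff inner_commute algebra_simps)
  from has_derivative_of_real[OF this, where 'a=complex] show ?thesis
    unfolding gaussian_def power2_norm_eq_inner by simp
qed

lemma iterated_partial_coord_poly_gaussian:
  assumes "coord_poly P"
  shows "\<exists>Q. coord_poly Q \<and> iterated_partial bs (\<lambda>x. P x * gaussian c a x) = (\<lambda>x. Q x * gaussian c a x)"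
proof (induction bs)
  case Nil
  then show ?case using assms by auto
next
  case (Cons b bs)
  then obtain Q where Q: "coord_poly Q" and eq: "iterated_partial bs (\<lambda>x. P x * gaussian c a x) = (\<lambda>x. Q x * gaussian c a x)"
    by blast
  obtain D where D: "\<And>x. (Q has_derivative D x) (at x)" "\<And>v. coord_poly (\<lambda>x. D x v)"
    using coord_poly_has_derivative[OF Q] by blast
  define R where "R x = Q x * (complex_of_real (x \<bullet> (-2 * c) *\<^sub>R b) + complex_of_real (2 * c * (a \<bullet> b))) + D x b" for x
  have R: "coord_poly R"
    unfolding R_def by (intro coord_poly.intros Q D)
  have fd: "frechet_derivative (\<lambda>x. Q x * gaussian c a x) (at x) =
      (\<lambda>h. Q x * (gaussian c a x * complex_of_real (- 2 * c * ((x - a) \<bullet> h))) + D x h * gaussian c a x)" for x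
    by (rule frechet_derivative_at[OF has_derivative_mult[OF D(1) gaussian_has_derivative], symmetric])
  have "iterated_partial (b # bs) (\<lambda>x. P x * gaussian c a x) = (\<lambda>x. R x * gaussian c a x)"
    unfolding iterated_partial.simps eq fd
    by (rule ext) (simp add: R_def inner_diff_left ring_distribs mult_ac)
  with R show ?case by blast
qed

text \<open>
  By \<open>r\<^sup>2 \<ge> 2 * r - 1\<close> it suffices to bound powers of \<open>y = 2 * c * (1 + r)\<close> by \<open>exp y\<close>, and
  \<open>exp y = exp (y / n) ^ n \<ge> (y / n) ^ n\<close> for \<open>n > 0\<close>.
\<close>

lemma power_times_gaussian_bounded:
  fixes c :: real
  assumes c: "c > 0"
  obtains B where "\<And>r. r \<ge> 0 \<Longrightarrow> (1 + r) ^ N * exp (- c * r\<^sup>2) \<le> B"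
proof -
  define B where "B = exp (3 * c) * (real (Suc N) / (2 * c)) ^ Suc N"
  have "(1 + r) ^ N * exp (- c * r\<^sup>2) \<le> B" if r: "r \<ge> 0" for r
  proof -
    define y where "y = 2 * c * (1 + r)"
    have y: "y > 0" using c r by (simp add: y_def)
    have "c * (r - 1)\<^sup>2 \<ge> 0" using c by simp
    then have "- c * r\<^sup>2 \<le> 3 * c - y" by (simp add: y_def power2_eq_square algebra_simps)
    then have "exp (- c * r\<^sup>2) \<le> exp (3 * c) * exp (- y)" by (simp add: exp_add[symmetric])
    moreover have "(1 + r) ^ N \<le> (1 + r) ^ Suc N" using r by (intro power_increasing) auto
    ultimately have "(1 + r) ^ N * exp (- c * r\<^sup>2) \<le> (1 + r) ^ Suc N * (exp (3 * c) * exp (- y))"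
      using r by (intro mult_mono) auto
    also have "(1 + r) ^ Suc N \<le> (real (Suc N) / (2 * c)) ^ Suc N * exp y"
    proof -
      have "y / real (Suc N) \<le> exp (y / real (Suc N))" using exp_ge_add_one_self[of "y / real (Suc N)"] by linarith
      then have "(y / real (Suc N)) ^ Suc N \<le> exp (y / real (Suc N)) ^ Suc N" using y by (intro power_mono) auto
      also have "\<dots> = exp y" by (subst exp_of_nat_mult[symmetric]) simp
      finally have *: "(y / real (Suc N)) ^ Suc N \<le> exp y" .
      have "(1 + r) ^ Suc N = ((real (Suc N) / (2 * c)) * (y / real (Suc N))) ^ Suc N"
      proof -
        have "(real (Suc N) / (2 * c)) * (y / real (Suc N)) = 1 + r" using c by (simp add: y_def del: of_nat_Suc)
        then show ?thesis by simp
      qed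
      also have "\<dots> = (real (Suc N) / (2 * c)) ^ Suc N * (y / real (Suc N)) ^ Suc N" by (rule power_mult_distrib)
      also have "\<dots> \<le> (real (Suc N) / (2 * c)) ^ Suc N * exp y" using c by (intro mult_left_mono *) auto
      finally show ?thesis .
    qed
    finally have "(1 + r) ^ N * exp (- c * r\<^sup>2) \<le> (real (Suc N) / (2 * c)) ^ Suc N * exp y * (exp (3 * c) * exp (- y))"
      by (simp add: mult_right_mono)
    also have "\<dots> = exp (3 * c) * (real (Suc N) / (2 * c)) ^ Suc N * (exp y * exp (- y))" by (simp only: mult_ac)
    also have "\<dots> = B" by (simp only: B_def exp_minus_inverse mult_1_right)
    finally show ?thesis .
  qed
  then show ?thesis using that by blast
qed

lemma schwartz_gaussian:
  fixes a :: "'a::euclidean_space"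
  assumes c: "c > 0"
  shows "schwartz (\<lambda>x. d * gaussian c a x)"
  unfolding schwartz_def
proof (intro allI impI conjI)
  fix bs :: "'a list"
  obtain Q where Q: "coord_poly Q" and eq: "iterated_partial bs (\<lambda>x. d * gaussian c a x) = (\<lambda>x. Q x * gaussian c a x)"
    using iterated_partial_coord_poly_gaussian[OF coord_poly.const] by blast
  show "iterated_partial bs (\<lambda>x. d * gaussian c a x) differentiable (at x)" for x
  proof -
    obtain D where "(Q has_derivative D x) (at x)" using coord_poly_has_derivative[OF Q] by blast
    then show ?thesis unfolding eq differentiable_def by (blast intro: has_derivative_mult gaussian_has_derivative)
  qed
  fix k :: nat
  obtain A N where A: "A \<ge> 0" "\<And>x. norm (Q x) \<le> A * (1 + norm x) ^ N" using coord_poly_growth[OF Q] by blast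
  obtain B where B: "\<And>r. r \<ge> 0 \<Longrightarrow> (1 + r) ^ (k + N) * exp (- c * r\<^sup>2) \<le> B"
    using power_times_gaussian_bounded[OF c] by metis
  have "norm x ^ k * norm (Q x * gaussian c a x) \<le> A * ((1 + norm a) ^ (k + N) * B)" for x
  proof -
    define r where "r = norm (x - a)"
    have x: "1 + norm x \<le> (1 + norm a) * (1 + r)"
    proof -
      have "norm x \<le> r + norm a" using norm_triangle_ineq[of "x - a" a] by (simp add: r_def)
      moreover have "0 \<le> norm a * r" by (simp add: r_def)
      ultimately show ?thesis by (simp add: algebra_simps)
    qed
    have "norm x ^ k * norm (Q x * gaussian c a x) = norm x ^ k * norm (Q x) * exp (- c * r\<^sup>2)"
      by (simp add: norm_mult gaussian_def r_def)
    also have "\<dots> \<le> (1 + norm x) ^ k * (A * (1 + norm x) ^ N) * exp (- c * r\<^sup>2)"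
      using A by (intro mult_right_mono mult_mono power_mono) auto
    also have "\<dots> = A * ((1 + norm x) ^ (k + N) * exp (- c * r\<^sup>2))" by (simp add: power_add)
    also have "\<dots> \<le> A * (((1 + norm a) * (1 + r)) ^ (k + N) * exp (- c * r\<^sup>2))"
      using A x by (intro mult_left_mono mult_right_mono power_mono) auto
    also have "\<dots> = A * ((1 + norm a) ^ (k + N) * ((1 + r) ^ (k + N) * exp (- c * r\<^sup>2)))"
      by (simp add: power_mult_distrib)
    also have "\<dots> \<le> A * ((1 + norm a) ^ (k + N) * B)"
      using A B[of r] by (intro mult_left_mono) (auto simp: r_def)
    finally show ?thesis .
  qed
  then show "bounded (range (\<lambda>x. norm x ^ k * norm (iterated_partial bs (\<lambda>x. d * gaussian c a x) x)))"
    unfolding eq bounded_iff by (intro exI[of _ "A * ((1 + norm a) ^ (k + N) * B)"]) auto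
qed

definition gauss_density :: "'a::euclidean_space \<Rightarrow> real" where
  "gauss_density x = exp (- (norm x)\<^sup>2) / (\<integral>u. exp (- (norm (u::'a))\<^sup>2))"

lemma integrable_exp_norm: "integrable lborel (\<lambda>x::'a::euclidean_space. exp (- (norm x)\<^sup>2))"
proof -
  have "integrable lborel (\<lambda>x::'a. 1 * gaussian 1 0 x)" by (intro schwartz_integrable schwartz_gaussian) simp
  then have "integrable lborel (\<lambda>x::'a. complex_of_real (exp (- (norm x)\<^sup>2)))" by (simp add: gaussian_def)
  then show ?thesis by (simp only: complex_of_real_integrable_eq)
qed

lemma integral_exp_norm_pos: "(\<integral>u. exp (- (norm (u::'a::euclidean_space))\<^sup>2)) > 0"
proof -
  have "(\<integral>u. exp (- (norm (u::'a))\<^sup>2)) \<ge> 0" by (rule integral_nonneg_AE) simp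
  moreover have "(\<integral>u. exp (- (norm (u::'a))\<^sup>2)) \<noteq> 0"
  proof
    assume "(\<integral>u. exp (- (norm (u::'a))\<^sup>2)) = 0"
    then have "AE u in (lborel :: 'a measure). exp (- (norm u)\<^sup>2) = 0"
      using integral_nonneg_eq_0_iff_AE[OF integrable_exp_norm[where 'a='a]] by simp
    then have "AE u in (lborel :: 'a measure). False" by eventually_elim simp
    then have "emeasure (lborel :: 'a measure) (space lborel) = 0"
      unfolding ae_filter_eq_bot_iff[symmetric] trivial_limit_def .
    then show False by simp
  qed
  ultimately show ?thesis by linarith
qed

lemma gauss_density_nonneg: "gauss_density x \<ge> 0"
  using integral_exp_norm_pos[where 'a='a] by (simp add: gauss_density_def)

lemma gauss_density_integrable: "integrable lborel gauss_density"
  unfolding gauss_density_def by (intro integrable_divide integrable_exp_norm)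

lemma gauss_density_measurable [measurable]: "gauss_density \<in> borel_measurable borel"
  using gauss_density_integrable by auto

lemma gauss_density_integral: "(\<integral>x. gauss_density x) = 1"
  unfolding gauss_density_def using integral_exp_norm_pos[where 'a='a] by simp

lemma gauss_density_uminus: "gauss_density (- x) = gauss_density x"
  by (simp add: gauss_density_def)

text \<open>
  The density rescaled to width \<open>e\<close> and centred at \<open>a\<close>: an approximate identity as \<open>e\<close> tends to zero.
\<close>

definition gauss_bump :: "real \<Rightarrow> 'a::euclidean_space \<Rightarrow> 'a \<Rightarrow> complex" where
  "gauss_bump e a x = complex_of_real (gauss_density ((1 / e) *\<^sub>R (x - a)) / e ^ DIM('a))"

lemma gauss_bump_measurable [measurable]: "gauss_bump e a \<in> borel_measurable borel"
  unfolding gauss_bump_def by measurable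

lemma schwartz_gauss_bump:
  fixes a :: "'a::euclidean_space"
  assumes "e > 0"
  shows "schwartz (gauss_bump e a)"
proof -
  have "gauss_bump e a = (\<lambda>x. complex_of_real (1 / ((\<integral>u. exp (- (norm (u::'a))\<^sup>2)) * e ^ DIM('a))) * gaussian (1 / e\<^sup>2) a x)"
    using assms by (auto simp: fun_eq_iff gauss_bump_def gauss_density_def gaussian_def power_mult_distrib power_divide)
  then show ?thesis using assms by (simp only:) (intro schwartz_gaussian, simp)
qed

lemma integral_gauss_bump_mult:
  fixes \<psi> :: "'a::euclidean_space \<Rightarrow> complex"
  assumes e: "e > 0" and [measurable]: "\<psi> \<in> borel_measurable borel"
  shows "(\<integral>x. gauss_bump e a x * \<psi> x) = (\<integral>s. complex_of_real (gauss_density s) * \<psi> (a + e *\<^sub>R s))"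
proof -
  have "(\<integral>x. gauss_bump e a x * \<psi> x)
    = (\<bar>e\<bar> ^ DIM('a)) *\<^sub>R (\<integral>s. gauss_bump e a (a + e *\<^sub>R s) * \<psi> (a + e *\<^sub>R s))"
    using e by (intro integral_affine_subst) auto
  also have "\<dots> = (\<integral>s. (\<bar>e\<bar> ^ DIM('a)) *\<^sub>R (gauss_bump e a (a + e *\<^sub>R s) * \<psi> (a + e *\<^sub>R s)))" by simp
  also have "\<dots> = (\<integral>s. complex_of_real (gauss_density s) * \<psi> (a + e *\<^sub>R s))"
    using e by (intro Bochner_Integration.integral_cong refl) (simp add: gauss_bump_def scaleR_conv_of_real)
  finally show ?thesis .
qed

lemma norm_gauss_bump: "e > 0 \<Longrightarrow> norm (gauss_bump e a x) = Re (gauss_bump e a x)"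
  unfolding gauss_bump_def norm_of_real Re_complex_of_real
  by (intro abs_of_nonneg divide_nonneg_pos gauss_density_nonneg) simp

lemma nn_integral_gauss_bump:
  fixes a :: "'a::euclidean_space"
  assumes e: "e > 0"
  shows "L1_mass (\<lambda>x. gauss_bump e a x) = 1"
proof -
  have i: "integrable lborel (gauss_bump e a)" using schwartz_integrable[OF schwartz_gauss_bump[OF e]] .
  have "(\<integral>x. gauss_bump e a x) = 1"
    using integral_gauss_bump_mult[OF e, of "\<lambda>_. 1" a] by (simp add: gauss_density_integral)
  then have "(\<integral>x. Re (gauss_bump e a x)) = 1" using i by simp
  then have "(\<integral>x. norm (gauss_bump e a x)) = 1" by (simp only: norm_gauss_bump[OF e])
  then show ?thesis using i by (subst nn_integral_eq_integral) auto
qed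

lemma gauss_average_tendsto:
  fixes \<psi> :: "nat \<Rightarrow> 'a::euclidean_space \<Rightarrow> complex"
  assumes [measurable]: "\<And>n. \<psi> n \<in> borel_measurable borel" and B: "\<And>n x. norm (\<psi> n x) \<le> B"
    and lim: "\<And>s. (\<lambda>n. \<psi> n s) \<longlonglongrightarrow> l"
  shows "(\<lambda>n. \<integral>s. complex_of_real (gauss_density s) * \<psi> n s) \<longlonglongrightarrow> l"
proof -
  have "(\<lambda>n. \<integral>s. complex_of_real (gauss_density s) * \<psi> n s) \<longlonglongrightarrow> (\<integral>s. complex_of_real (gauss_density (s::'a)) * l)"
  proof (rule integral_dominated_convergence[where w="\<lambda>s. gauss_density s * B"])
    show "integrable lborel (\<lambda>s. gauss_density s * B)" by (intro integrable_mult_left gauss_density_integrable)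
    show "AE s in lborel. norm (complex_of_real (gauss_density s) * \<psi> n s) \<le> gauss_density s * B" for n
      using B by (intro AE_I2) (simp add: norm_mult mult_left_mono gauss_density_nonneg)
    show "AE s in lborel. (\<lambda>n. complex_of_real (gauss_density s) * \<psi> n s) \<longlonglongrightarrow> complex_of_real (gauss_density s) * l"
      by (intro AE_I2 tendsto_intros lim)
  qed measurable
  also have "(\<integral>s. complex_of_real (gauss_density (s::'a)) * l) = l" by (simp add: gauss_density_integral)
  finally show ?thesis .
qed

lemma norm_gauss_average_le:
  fixes \<psi> :: "'a::euclidean_space \<Rightarrow> complex"
  assumes [measurable]: "\<psi> \<in> borel_measurable borel" and B: "\<And>x. norm (\<psi> x) \<le> B"
  shows "norm (\<integral>s. complex_of_real (gauss_density s) * \<psi> s) \<le> B"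
proof -
  have "norm (\<integral>s. complex_of_real (gauss_density s) * \<psi> s) \<le> (\<integral>s. gauss_density (s::'a) * B)"
  proof (rule Bochner_Integration.integral_norm_bound_integral)
    show "integrable lborel (\<lambda>s. complex_of_real (gauss_density s) * \<psi> s)"
      by (rule integrable_mult_bounded[OF _ _ B]) (use gauss_density_integrable in auto)
    show "norm (complex_of_real (gauss_density s) * \<psi> s) \<le> gauss_density s * B" for s
      using B gauss_density_nonneg[of s] by (simp add: norm_mult mult_left_mono)
  qed (use gauss_density_integrable in auto)
  then show ?thesis by (simp add: gauss_density_integral)
qed

section \<open>Lower bounds for multiplier norms at the end points\<close>

lemma convol_gauss_bump:
  fixes K :: "'a::euclidean_space \<Rightarrow> complex"
  assumes e: "e > 0" and [measurable]: "K \<in> borel_measurable borel"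
  shows "convol K (gauss_bump e a) y = (\<integral>s. complex_of_real (gauss_density s) * K (y - (a + e *\<^sub>R s)))"
  using integral_gauss_bump_mult[OF e, of "\<lambda>x. K (y - x)" a] by (simp add: convol_def mult.commute)

lemma regular_dist_gauss_bump:
  fixes g :: "'a::euclidean_space \<Rightarrow> complex"
  assumes e: "e > 0" and [measurable]: "g \<in> borel_measurable borel"
  shows "regular_dist g (gauss_bump e a) = (\<integral>s. complex_of_real (gauss_density s) * g (a + e *\<^sub>R s))"
  using integral_gauss_bump_mult[OF e, of g a] by (simp add: regular_dist_def mult.commute)

lemma gauss_bump_reflect: "gauss_bump e a x = gauss_bump e 0 (a - x)"
proof -
  have "(1 / e) *\<^sub>R (x - a) = - ((1 / e) *\<^sub>R (a - x))" by (simp add: scaleR_diff_right)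
  then show ?thesis unfolding gauss_bump_def by (simp only: gauss_density_uminus diff_zero)
qed

lemma regular_dist_eq_convol_gauss_bump:
  "regular_dist g (gauss_bump e a) = convol (gauss_bump e 0) g a"
  unfolding regular_dist_def convol_def by (subst gauss_bump_reflect) (simp add: mult.commute)

text \<open>
  A lower bound must hold for every \<open>g\<close> representing the distribution, since only the values on
  Schwartz functions are known.
\<close>

lemma le_multiplier_normI:
  fixes m f :: "'a::euclidean_space \<Rightarrow> complex"
  assumes f: "f \<in> Lp_space p" "Lp_norm p f = 1"
    and le: "\<And>g. g \<in> Lp_space p \<Longrightarrow> (\<And>\<phi>. schwartz \<phi> \<Longrightarrow> multiplier_op m f \<phi> = regular_dist g \<phi>) \<Longrightarrow> c \<le> Lp_norm p g"
  shows "c \<le> multiplier_norm p m"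
proof -
  have "c \<le> dist_Lp_norm p (multiplier_op m f)"
    unfolding dist_Lp_norm_def using le by (intro Inf_greatest) blast
  also have "\<dots> \<le> multiplier_norm p m"
    unfolding multiplier_norm_def using f by (intro SUP_upper) auto
  finally show ?thesis .
qed

lemma L1_mass_le_of_pointwise_limit:
  fixes K :: "'a::euclidean_space \<Rightarrow> complex" and H :: "real \<Rightarrow> 'a \<Rightarrow> complex"
  assumes [measurable]: "\<And>e. H e \<in> borel_measurable borel"
    and le: "\<And>e. e > 0 \<Longrightarrow> (L1_mass (\<lambda>x. H e x)) \<le> c"
    and lim: "\<And>x. (\<lambda>n. H (1 / real (Suc n)) x) \<longlonglongrightarrow> K x"
  shows "L1_mass K \<le> c"
proof (rule nn_integral_le_of_fatou[OF _ _ always_eventually tendsto_const])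
  show "(\<lambda>x. ennreal (norm (H (1 / real (Suc n)) x))) \<in> borel_measurable lborel" for n by measurable
  show "AE x in lborel. (\<lambda>n. ennreal (norm (H (1 / real (Suc n)) x))) \<longlonglongrightarrow> ennreal (norm (K x))"
    by (intro AE_I2 tendsto_ennrealI tendsto_norm lim)
qed (intro allI le, simp)

lemma inverse_Suc_tendsto_0: "(\<lambda>n. 1 / real (Suc n)) \<longlonglongrightarrow> 0"
  by (rule LIMSEQ_inverse_real_of_nat[unfolded inverse_eq_divide])

text \<open>
  Pairing the distribution belonging to \<open>f\<close> with a Gaussian bump at the origin gives the integral of
  \<open>f * J\<close>, where \<open>J\<close> averages the kernel over bumps. If \<open>f\<close> is the conjugate sign of \<open>J\<close>, this is the
  \<open>L\<^sub>1\<close> norm of \<open>J\<close>; it cannot exceed the norm of a function \<open>g\<close> representing the distribution, because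
  the bump has mass one. The averages tend to the kernel as the bumps shrink.
\<close>

lemma multiplier_norm_inf_ge:
  fixes m :: "'a::euclidean_space \<Rightarrow> complex"
  assumes m: "integrable lborel m" and K: "integrable lborel (inv_fourier m)"
    and even: "\<And>x. inv_fourier m (- x) = inv_fourier m x"
  shows "L1_mass (inv_fourier m) \<le> multiplier_norm \<infinity> m"
proof -
  define K where "K = inv_fourier m"
  have [measurable]: "K \<in> borel_measurable borel" using K by (auto simp: K_def)
  obtain B where B: "\<And>x. norm (K x) \<le> B" using norm_inv_fourier_le[OF m] unfolding K_def by blast
  have cont: "isCont K x" for x unfolding K_def by (rule isCont_inv_fourier[OF m])
  show ?thesis unfolding K_def[symmetric]
  proof (rule L1_mass_le_of_pointwise_limit[where H="\<lambda>e. convol K (gauss_bump e 0)"])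
    show "convol K (gauss_bump e 0) \<in> borel_measurable borel" for e by measurable
  next
    fix x
    have "(\<lambda>n. \<integral>s. complex_of_real (gauss_density s) * K (x - (0 + (1 / real (Suc n)) *\<^sub>R s))) \<longlonglongrightarrow> K x"
    proof (rule gauss_average_tendsto[where \<psi>="\<lambda>n s. K (x - (0 + (1 / real (Suc n)) *\<^sub>R s))", OF _ B])
      fix s :: 'a
      have "(\<lambda>n. x - (0 + (1 / real (Suc n)) *\<^sub>R s)) \<longlonglongrightarrow> x - (0 + 0 *\<^sub>R s)"
        by (intro tendsto_intros inverse_Suc_tendsto_0)
      then have "(\<lambda>n. x - (0 + (1 / real (Suc n)) *\<^sub>R s)) \<longlonglongrightarrow> x" by simp
      then show "(\<lambda>n. K (x - (0 + (1 / real (Suc n)) *\<^sub>R s))) \<longlonglongrightarrow> K x"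
        by (rule isCont_tendsto_compose[OF cont])
    qed measurable
    then show "(\<lambda>n. convol K (gauss_bump (1 / real (Suc n)) 0) x) \<longlonglongrightarrow> K x"
      by (subst convol_gauss_bump) auto
  next
    fix e :: real assume e: "e > 0"
    define J where "J = convol K (gauss_bump e 0)"
    have [measurable]: "J \<in> borel_measurable borel" unfolding J_def by measurable
    note \<phi> = schwartz_integrable[OF schwartz_gauss_bump[OF e, of 0]] schwartz_bounded[OF schwartz_gauss_bump[OF e, of 0]]
    have "L1_mass J
      \<le> (\<integral>\<^sup>+y. (\<integral>\<^sup>+x. ennreal (norm (K (y - x))) * ennreal (norm (gauss_bump e 0 x))))"
      unfolding J_def by (intro nn_integral_mono ennreal_norm_convol_le)
    also have "\<dots> = L1_mass K"
      using nn_integral_convol[OF K _ nn_integral_gauss_bump[OF e, of 0]] by (simp add: K_def)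
    also have "\<dots> < \<infinity>" using K by (simp add: K_def integrable_iff_bounded)
    finally have Ji: "integrable lborel J" by (intro integrableI_bounded) auto
    define f where "f x = (if J x = 0 then 1 else cnj (J x) / complex_of_real (norm (J x)))" for x
    have cnjJ: "(\<lambda>x. cnj (J x)) \<in> borel_measurable borel"
      by (intro measurable_compose[OF _ borel_measurable_continuous_onI[OF continuous_on_cnj[OF continuous_on_id]]]) simp
    have fm[measurable]: "f \<in> borel_measurable borel" unfolding f_def using cnjJ by measurable
    have nf: "norm (f x) = 1" for x by (simp add: f_def norm_divide)
    have fJ: "f x * J x = complex_of_real (norm (J x))" for x
      by (cases "J x = 0") (simp_all add: f_def complex_norm_square[symmetric] mult.commute power2_eq_square)
    have f1: "Lp_norm \<infinity> f = 1" unfolding Lp_norm_def nf by (simp add: esssup_const)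
    have fL: "f \<in> Lp_space \<infinity>" using f1 by (simp add: Lp_space_def)
    show "L1_mass (convol K (gauss_bump e 0)) \<le> multiplier_norm \<infinity> m"
      unfolding J_def[symmetric]
    proof (rule le_multiplier_normI[OF fL f1])
      fix g :: "'a \<Rightarrow> complex"
      assume g: "g \<in> Lp_space \<infinity>" and rep: "\<And>\<phi>. schwartz \<phi> \<Longrightarrow> multiplier_op m f \<phi> = regular_dist g \<phi>"
      have [measurable]: "g \<in> borel_measurable borel" using g by (simp add: Lp_space_def)
      have "(\<integral>y. gauss_bump e 0 y * K (y - x)) = J x" for x
      proof -
        have "K (y - x) = K (x - y)" for y using even[of "x - y"] by (simp add: K_def)
        then show ?thesis unfolding J_def convol_def by (simp add: mult.commute)
      qed
      then have "multiplier_op m f (gauss_bump e 0) = (\<integral>x. f x * J x)"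
        unfolding multiplier_op_eq_convol(1)[OF m K L1_plus_Linf_Lp_space[OF _ fL] \<phi>, simplified] K_def[symmetric] by simp
      also have "\<dots> = complex_of_real (\<integral>x. norm (J x))" unfolding fJ by simp
      finally have "regular_dist g (gauss_bump e 0) = complex_of_real (\<integral>x. norm (J x))"
        using rep[OF schwartz_gauss_bump[OF e]] by simp
      moreover have "(\<integral>x. norm (J x)) \<ge> 0" by simp
      ultimately have "norm (regular_dist g (gauss_bump e 0)) = (\<integral>x. norm (J x))" by simp
      then have "L1_mass J = ennreal (norm (convol (gauss_bump e 0) g 0))"
        using Ji by (simp add: nn_integral_eq_integral regular_dist_eq_convol_gauss_bump)
      also have "\<dots> \<le> (\<integral>\<^sup>+x. ennreal (norm (gauss_bump e 0 (0 - x))) * ennreal (norm (g x)))"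
        by (rule ennreal_norm_convol_le)
      also have "\<dots> \<le> (\<integral>\<^sup>+x. ennreal (norm (gauss_bump e (0::'a) (0 - x))) * Lp_norm \<infinity> g)"
      proof (rule nn_integral_mono_AE)
        have "AE x in lborel. ennreal (norm (g x)) \<le> Lp_norm \<infinity> g"
          using esssup_AE[of "\<lambda>x. ennreal (norm (g x))" lborel] by (simp add: Lp_norm_def)
        then show "AE x in lborel. ennreal (norm (gauss_bump e 0 (0 - x))) * ennreal (norm (g x)) \<le> ennreal (norm (gauss_bump e (0::'a) (0 - x))) * Lp_norm \<infinity> g"
          by eventually_elim (rule mult_left_mono, auto)
      qed
      also have "\<dots> = L1_mass (\<lambda>x. gauss_bump e (0::'a) (0 - x)) * Lp_norm \<infinity> g"
        by (rule nn_integral_multc) measurable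
      also have "L1_mass (\<lambda>x. gauss_bump e (0::'a) (0 - x)) = 1"
        using nn_integral_reflect[of "\<lambda>x. ennreal (norm (gauss_bump e (0::'a) x))" 0] by (simp add: nn_integral_gauss_bump[OF e])
      finally show "L1_mass J \<le> Lp_norm \<infinity> g" by simp
    qed
  qed
qed

text \<open>
  Here \<open>f\<close> is a bump itself. Averaging over bumps does not increase the \<open>L\<^sub>1\<close> norm of a function \<open>g\<close>
  representing the distribution, and since bumps are Schwartz functions the averages of \<open>g\<close> are those
  of the convolution of \<open>f\<close> with the kernel. They tend to the kernel as the bumps shrink.
\<close>

lemma multiplier_norm_1_ge:
  fixes m :: "'a::euclidean_space \<Rightarrow> complex"
  assumes m: "integrable lborel m" and K: "integrable lborel (inv_fourier m)"
  shows "L1_mass (inv_fourier m) \<le> multiplier_norm 1 m"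
proof -
  define K where "K = inv_fourier m"
  have [measurable]: "K \<in> borel_measurable borel" using K by (auto simp: K_def)
  obtain B where B: "\<And>x. norm (K x) \<le> B" using norm_inv_fourier_le[OF m] unfolding K_def by blast
  have cont: "isCont K x" for x unfolding K_def by (rule isCont_inv_fourier[OF m])
  define J where "J e = convol K (gauss_bump e 0)" for e
  have Jm[measurable]: "J e \<in> borel_measurable borel" for e unfolding J_def by measurable
  have JB: "norm (J e x) \<le> B" if "e > 0" for e x
    unfolding J_def convol_gauss_bump[OF that \<open>K \<in> borel_measurable borel\<close>] by (rule norm_gauss_average_le[OF _ B]) measurable
  have Jlim: "(\<lambda>n. J (1 / real (Suc n)) (X n)) \<longlonglongrightarrow> K x" if X: "X \<longlonglongrightarrow> x" for X x
  proof -
    have "(\<lambda>n. \<integral>s. complex_of_real (gauss_density s) * K (X n - (0 + (1 / real (Suc n)) *\<^sub>R s))) \<longlonglongrightarrow> K x"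
    proof (rule gauss_average_tendsto[where \<psi>="\<lambda>n s. K (X n - (0 + (1 / real (Suc n)) *\<^sub>R s))", OF _ B])
      fix s :: 'a
      have "(\<lambda>n. X n - (0 + (1 / real (Suc n)) *\<^sub>R s)) \<longlonglongrightarrow> x - (0 + 0 *\<^sub>R s)"
        by (intro tendsto_intros X inverse_Suc_tendsto_0)
      then have "(\<lambda>n. X n - (0 + (1 / real (Suc n)) *\<^sub>R s)) \<longlonglongrightarrow> x" by simp
      then show "(\<lambda>n. K (X n - (0 + (1 / real (Suc n)) *\<^sub>R s))) \<longlonglongrightarrow> K x"
        by (rule isCont_tendsto_compose[OF cont])
    qed measurable
    then show ?thesis unfolding J_def by (subst convol_gauss_bump) auto
  qed
  show ?thesis unfolding K_def[symmetric]
  proof (rule L1_mass_le_of_pointwise_limit[where H="\<lambda>e a. regular_dist (J e) (gauss_bump e a)"])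
    show "(\<lambda>a. regular_dist (J e) (gauss_bump e a)) \<in> borel_measurable borel" for e
      unfolding regular_dist_eq_convol_gauss_bump by measurable
  next
    fix x
    have "(\<lambda>n. \<integral>s. complex_of_real (gauss_density s) * J (1 / real (Suc n)) (x + (1 / real (Suc n)) *\<^sub>R s)) \<longlonglongrightarrow> K x"
    proof (rule gauss_average_tendsto[where \<psi>="\<lambda>n s. J (1 / real (Suc n)) (x + (1 / real (Suc n)) *\<^sub>R s)"])
      show "norm (J (1 / real (Suc n)) (x + (1 / real (Suc n)) *\<^sub>R s)) \<le> B" for n s by (rule JB) simp
      fix s :: 'a
      have "(\<lambda>n. x + (1 / real (Suc n)) *\<^sub>R s) \<longlonglongrightarrow> x + 0 *\<^sub>R s"
        by (intro tendsto_intros inverse_Suc_tendsto_0)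
      then show "(\<lambda>n. J (1 / real (Suc n)) (x + (1 / real (Suc n)) *\<^sub>R s)) \<longlonglongrightarrow> K x"
        by (intro Jlim) simp
    qed measurable
    then show "(\<lambda>n. regular_dist (J (1 / real (Suc n))) (gauss_bump (1 / real (Suc n)) x)) \<longlonglongrightarrow> K x"
      by (subst regular_dist_gauss_bump) auto
  next
    fix e :: real assume e: "e > 0"
    define f where "f = (gauss_bump e 0 :: 'a \<Rightarrow> complex)"
    have [measurable]: "f \<in> borel_measurable borel" unfolding f_def by measurable
    have f1: "Lp_norm 1 f = 1"
      unfolding Lp_norm_def Let_def f_def using nn_integral_gauss_bump[OF e, of "0::'a"] by simp
    have fL: "f \<in> Lp_space 1" using f1 by (simp add: Lp_space_def)
    show "L1_mass (\<lambda>a. regular_dist (J e) (gauss_bump e a)) \<le> multiplier_norm 1 m"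
    proof (rule le_multiplier_normI[OF fL f1])
      fix g :: "'a \<Rightarrow> complex"
      assume g: "g \<in> Lp_space 1" and rep: "\<And>\<phi>. schwartz \<phi> \<Longrightarrow> multiplier_op m f \<phi> = regular_dist g \<phi>"
      have [measurable]: "g \<in> borel_measurable borel" and gfin: "Lp_norm 1 g < \<infinity>" using g by (auto simp: Lp_space_def)
      have "regular_dist (J e) (gauss_bump e a) = convol (gauss_bump e 0) g a" for a
      proof -
        have "regular_dist (J e) (gauss_bump e a) = multiplier_op m f (gauss_bump e a)"
          unfolding J_def K_def f_def[symmetric]
          by (rule multiplier_op_eq_convol(2)[OF m K L1_plus_Linf_Lp_space[OF _ fL], symmetric])
            (auto intro: schwartz_integrable schwartz_bounded schwartz_gauss_bump e)
        also have "\<dots> = regular_dist g (gauss_bump e a)" by (rule rep[OF schwartz_gauss_bump[OF e]])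
        finally show ?thesis unfolding regular_dist_eq_convol_gauss_bump .
      qed
      then have "L1_mass (\<lambda>a. regular_dist (J e) (gauss_bump e a))
        \<le> (\<integral>\<^sup>+y. (\<integral>\<^sup>+x. ennreal (norm (gauss_bump e 0 (y - x))) * ennreal (norm (g x))))"
        by (intro nn_integral_mono) (simp add: ennreal_norm_convol_le)
      also have "\<dots> = L1_mass (\<lambda>x. gauss_bump e (0::'a) x) * L1_mass g"
        by (rule nn_integral_convol[OF schwartz_integrable[OF schwartz_gauss_bump[OF e]] _ refl]) measurable
      also have "\<dots> = L1_mass g" by (simp add: nn_integral_gauss_bump[OF e])
      also have "\<dots> \<le> Lp_norm 1 g"
        using gfin unfolding Lp_norm_def Let_def by (auto simp: ennreal_enn2real_if split: if_splits)
      finally show "L1_mass (\<lambda>a. regular_dist (J e) (gauss_bump e a)) \<le> Lp_norm 1 g" .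
    qed
  qed
qed

section \<open>The theta function\<close>

text \<open>
  A power series in \<open>exp u\<close>, so that it can be differentiated term by term.
\<close>

definition exp_series :: "(nat \<Rightarrow> real) \<Rightarrow> real \<Rightarrow> real" where
  "exp_series c u = (\<Sum>n. c n * exp u ^ n)"

lemma summable_mult_index:
  fixes c :: "nat \<Rightarrow> real"
  assumes c: "\<And>y. summable (\<lambda>n. c n * y ^ n)"
  shows "summable (\<lambda>n. (real n * c n) * y ^ n)"
proof -
  have "summable (\<lambda>n. diffs c n * y ^ n)" by (rule termdiff_converges_all) (rule c)
  then have "summable (\<lambda>n. (diffs c n * y ^ n) * y)" by (rule summable_mult2)
  then have "summable (\<lambda>n. (real (Suc n) * c (Suc n)) * y ^ Suc n)" by (simp add: diffs_def mult_ac)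
  then show ?thesis by (simp only: summable_Suc_iff[of "\<lambda>n. (real n * c n) * y ^ n"])
qed

lemma exp_series_has_derivative:
  fixes c :: "nat \<Rightarrow> real"
  assumes c: "\<And>y. summable (\<lambda>n. c n * y ^ n)"
  shows "(exp_series c has_real_derivative exp_series (\<lambda>n. real n * c n) u) (at u)"
proof -
  have D: "((\<lambda>x. \<Sum>n. c n * x ^ n) has_real_derivative (\<Sum>n. diffs c n * exp u ^ n)) (at (exp u))"
    by (rule termdiffs_strong_converges_everywhere) (rule c)
  have "((\<lambda>u. \<Sum>n. c n * exp u ^ n) has_real_derivative (\<Sum>n. diffs c n * exp u ^ n) * exp u) (at u)"
    by (rule DERIV_chain2[OF D DERIV_exp])
  moreover have "(\<Sum>n. diffs c n * exp u ^ n) * exp u = (\<Sum>n. (real (Suc n) * c (Suc n)) * exp u ^ Suc n)"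
  proof -
    have "summable (\<lambda>n. diffs c n * exp u ^ n)" by (rule termdiff_converges_all) (rule c)
    then show ?thesis by (subst suminf_mult2) (simp_all add: diffs_def mult_ac)
  qed
  moreover have "(\<Sum>n. (real (Suc n) * c (Suc n)) * exp u ^ Suc n) = (\<Sum>n. (real n * c n) * exp u ^ n)"
    using suminf_split_head[OF summable_mult_index[OF c, of "exp u"]] by simp
  ultimately show ?thesis unfolding exp_series_def by simp
qed

lemma summable_gauss_power:
  fixes b :: real
  assumes b: "b > 0"
  shows "summable (\<lambda>n. exp (- b\<^sup>2 * (real n)\<^sup>2) * y ^ n)"
proof (rule summable_comparison_test')
  define r where "r = ln (\<bar>y\<bar> + 1)"
  define K where "K = (r + 1)\<^sup>2 / (4 * b\<^sup>2)"
  show "summable (\<lambda>n. exp K * exp (-1) ^ n)"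
    by (intro summable_mult summable_geometric) simp
  fix n :: nat
  have r: "exp r = \<bar>y\<bar> + 1" by (simp add: r_def)
  \<comment> \<open>Completing the square: the exponent is at most \<open>K - n\<close>.\<close>
  have "(2 * b\<^sup>2 * real n - (r + 1))\<^sup>2 \<ge> 0" by simp
  then have "4 * b\<^sup>2 * ((r + 1) * real n) \<le> 4 * b\<^sup>2 * (b\<^sup>2 * (real n)\<^sup>2) + (r + 1)\<^sup>2"
    by (simp add: power2_eq_square algebra_simps)
  then have "(r + 1) * real n \<le> b\<^sup>2 * (real n)\<^sup>2 + K"
    using b by (simp add: K_def field_simps)
  then have le: "- b\<^sup>2 * (real n)\<^sup>2 + r * real n \<le> K - real n" by (simp add: algebra_simps)
  have "norm (exp (- b\<^sup>2 * (real n)\<^sup>2) * y ^ n) = exp (- b\<^sup>2 * (real n)\<^sup>2) * \<bar>y\<bar> ^ n"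
    by (simp add: abs_mult power_abs)
  also have "\<dots> \<le> exp (- b\<^sup>2 * (real n)\<^sup>2) * exp r ^ n"
    by (intro mult_left_mono power_mono) (auto simp: r)
  also have "\<dots> = exp (- b\<^sup>2 * (real n)\<^sup>2 + r * real n)" by (simp add: mult_exp_exp exp_of_nat_mult[symmetric] mult.commute)
  also have "\<dots> \<le> exp (K - real n)" using le by simp
  also have "\<dots> = exp K * exp (-1) ^ n" by (simp add: exp_diff exp_minus power_inverse exp_of_nat_mult[symmetric] divide_inverse)
  finally show "norm (exp (- b\<^sup>2 * (real n)\<^sup>2) * y ^ n) \<le> exp K * exp (-1) ^ n" .
qed

text \<open>
  The term for \<open>n = 0\<close> is halved because \<open>theta\<close> adds the series at \<open>u\<close> and at \<open>- u\<close>.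
\<close>

definition theta_coeff :: "real \<Rightarrow> nat \<Rightarrow> real" where
  "theta_coeff b n = (if n = 0 then 1 / 2 else exp (- b\<^sup>2 * (real n)\<^sup>2))"

text \<open>
  This is the sum of \<open>exp (j * u - b\<^sup>2 * j\<^sup>2)\<close> over all integers \<open>j\<close> (\<open>theta_has_sum\<close>); \<open>theta1\<close> and \<open>theta2\<close>
  are its first two derivatives.
\<close>

definition theta :: "real \<Rightarrow> real \<Rightarrow> real" where
  "theta b u = exp_series (theta_coeff b) u + exp_series (theta_coeff b) (- u)"

definition theta1 :: "real \<Rightarrow> real \<Rightarrow> real" where
  "theta1 b u = exp_series (\<lambda>n. real n * theta_coeff b n) u - exp_series (\<lambda>n. real n * theta_coeff b n) (- u)"

definition theta2 :: "real \<Rightarrow> real \<Rightarrow> real" where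
  "theta2 b u = exp_series (\<lambda>n. real n * (real n * theta_coeff b n)) u + exp_series (\<lambda>n. real n * (real n * theta_coeff b n)) (- u)"

context
  fixes b :: real
  assumes b: "b > 0"
begin

lemma theta_coeff_summable: "summable (\<lambda>n. theta_coeff b n * y ^ n)"
proof -
  have "summable (\<lambda>n. theta_coeff b (Suc n) * y ^ Suc n) \<longleftrightarrow> summable (\<lambda>n. exp (- b\<^sup>2 * (real (Suc n))\<^sup>2) * y ^ Suc n)"
    by (simp add: theta_coeff_def)
  then show ?thesis
    unfolding summable_Suc_iff[of "\<lambda>n. theta_coeff b n * y ^ n"] summable_Suc_iff[of "\<lambda>n. exp (- b\<^sup>2 * (real n)\<^sup>2) * y ^ n"]
    using summable_gauss_power[OF b] by blast
qed

lemma theta_coeff_nonneg: "theta_coeff b n \<ge> 0"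
  by (simp add: theta_coeff_def)

lemmas theta1_coeff_summable = summable_mult_index[OF theta_coeff_summable]

lemmas theta2_coeff_summable = summable_mult_index[OF theta1_coeff_summable]

lemma theta_deriv: "(theta b has_real_derivative theta1 b u) (at u)"
  unfolding theta_def[abs_def] theta1_def
  using DERIV_add[OF exp_series_has_derivative[OF theta_coeff_summable, of u]
      DERIV_chain2[OF exp_series_has_derivative[OF theta_coeff_summable, of "- u"] DERIV_minus[OF DERIV_ident]]]
  by simp

lemma theta1_deriv: "(theta1 b has_real_derivative theta2 b u) (at u)"
  unfolding theta1_def[abs_def] theta2_def
  using DERIV_diff[OF exp_series_has_derivative[OF theta1_coeff_summable, of u]
      DERIV_chain2[OF exp_series_has_derivative[OF theta1_coeff_summable, of "- u"] DERIV_minus[OF DERIV_ident]]]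
  by simp

lemma theta2_continuous: "continuous_on S (theta2 b)"
proof -
  have "isCont (exp_series (\<lambda>n. real n * (real n * theta_coeff b n))) u" for u
    using exp_series_has_derivative[OF theta2_coeff_summable] by (rule DERIV_isCont)
  then have [simp]: "continuous_on T (exp_series (\<lambda>n. real n * (real n * theta_coeff b n)))" for T
    by (simp add: continuous_at_imp_continuous_on)
  then show ?thesis unfolding theta2_def[abs_def]
    by (rule continuous_on_add[OF _ continuous_on_compose2[OF _ continuous_on_minus[OF continuous_on_id]]]) auto
qed

lemma theta_even: "theta b (- u) = theta b u" by (simp add: theta_def)

lemma theta1_odd: "theta1 b (- u) = - theta1 b u" by (simp add: theta1_def)

lemma theta2_even: "theta2 b (- u) = theta2 b u" by (simp add: theta2_def)

lemma exp_series_ge_half: "exp_series (theta_coeff b) u \<ge> 1 / 2"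
proof -
  have "sum (\<lambda>n. theta_coeff b n * exp u ^ n) {0} \<le> exp_series (theta_coeff b) u"
    unfolding exp_series_def by (rule sum_le_suminf[OF theta_coeff_summable]) (auto simp: theta_coeff_nonneg)
  then show ?thesis by (simp add: theta_coeff_def)
qed

lemma theta_ge_1: "theta b u \<ge> 1"
  using exp_series_ge_half[of u] exp_series_ge_half[of "- u"] by (simp add: theta_def)

lemma theta_pos: "theta b u > 0"
  using theta_ge_1[of u] by linarith

text \<open>
  The left-hand side is the theta series with the factors \<open>(j + l)\<^sup>2\<close> inserted.
\<close>

lemma theta_quadratic_nonneg: "theta2 b u + 2 * l * theta1 b u + l\<^sup>2 * theta b u \<ge> 0"
proof -
  define a where "a n = theta_coeff b n" for n
  define A0 A1 A2 where "A0 v = exp_series a v" and "A1 v = exp_series (\<lambda>n. real n * a n) v"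
    and "A2 v = exp_series (\<lambda>n. real n * (real n * a n)) v" for v
  have *: "A2 v + 2 * k * A1 v + k\<^sup>2 * A0 v \<ge> 0" for v k
  proof -
    have s: "summable (\<lambda>n. a n * exp v ^ n)" "summable (\<lambda>n. (real n * a n) * exp v ^ n)"
      "summable (\<lambda>n. (real n * (real n * a n)) * exp v ^ n)"
      unfolding a_def by (rule theta_coeff_summable theta1_coeff_summable theta2_coeff_summable)+
    have "A2 v + 2 * k * A1 v + k\<^sup>2 * A0 v = (\<Sum>n. (real n * (real n * a n)) * exp v ^ n
        + (2 * k) * ((real n * a n) * exp v ^ n) + k\<^sup>2 * (a n * exp v ^ n))"
      unfolding A0_def A1_def A2_def exp_series_def
      using s by (simp add: suminf_add[symmetric] suminf_mult[symmetric] summable_add summable_mult)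
    also have "\<dots> = (\<Sum>n. (real n + k)\<^sup>2 * (a n * exp v ^ n))"
      by (simp add: power2_eq_square algebra_simps)
    also have "\<dots> \<ge> 0"
    proof (rule suminf_nonneg)
      have "summable (\<lambda>n. (real n * (real n * a n)) * exp v ^ n
        + (2 * k) * ((real n * a n) * exp v ^ n) + k\<^sup>2 * (a n * exp v ^ n))"
        by (intro summable_add summable_mult s)
      then show "summable (\<lambda>n. (real n + k)\<^sup>2 * (a n * exp v ^ n))"
        by (simp add: power2_eq_square algebra_simps)
    qed (simp add: a_def theta_coeff_nonneg)
    finally show ?thesis .
  qed
  have "theta2 b u + 2 * l * theta1 b u + l\<^sup>2 * theta b u
    = (A2 u + 2 * l * A1 u + l\<^sup>2 * A0 u) + (A2 (-u) + 2 * (-l) * A1 (-u) + (-l)\<^sup>2 * A0 (-u))"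
    unfolding theta_def theta1_def theta2_def A0_def A1_def A2_def a_def by (simp add: algebra_simps)
  then show ?thesis using *[of u l] *[of "-u" "-l"] by linarith
qed

text \<open>
  The discriminant of the quadratic in \<open>theta_quadratic_nonneg\<close> is not positive.
\<close>

lemma theta_log_convex: "(theta1 b u)\<^sup>2 \<le> theta2 b u * theta b u"
proof -
  \<comment> \<open>The minimiser of the quadratic.\<close>
  define l where "l = - theta1 b u / theta b u"
  have "0 \<le> (theta2 b u + 2 * l * theta1 b u + l\<^sup>2 * theta b u) * theta b u"
    using theta_quadratic_nonneg[of u l] theta_pos[of u] by simp
  also have "\<dots> = theta2 b u * theta b u - (theta1 b u)\<^sup>2"
    using theta_pos[of u] by (simp add: l_def field_simps power2_eq_square)
  finally show ?thesis by simp
qed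

lemma theta_has_sum: "((\<lambda>j::int. exp (real_of_int j * u - b\<^sup>2 * (real_of_int j)\<^sup>2)) has_sum theta b u) UNIV"
proof -
  define f where "f v n = theta_coeff b n * exp v ^ n" for v n
  have f_eq: "f v n = exp (real n * v - b\<^sup>2 * (real n)\<^sup>2)" if "n > 0" for v n
    using that by (simp add: f_def theta_coeff_def exp_of_nat_mult[symmetric] mult_exp_exp)
  have sums: "f v sums exp_series (theta_coeff b) v" for v
    unfolding f_def exp_series_def using theta_coeff_summable by (rule summable_sums)
  have "(\<lambda>n. f v (Suc n)) sums (exp_series (theta_coeff b) v - 1 / 2)" for v
    using sums[of v] by (subst sums_Suc_iff) (simp add: f_def theta_coeff_def)
  then have tail: "(\<lambda>n. exp (real (Suc n) * v - b\<^sup>2 * (real (Suc n))\<^sup>2)) sums (exp_series (theta_coeff b) v - 1 / 2)" for v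
    by (simp add: f_eq del: of_nat_Suc)
  have pos: "((\<lambda>j::int. exp (real_of_int j * u - b\<^sup>2 * (real_of_int j)\<^sup>2)) has_sum (exp_series (theta_coeff b) u + 1 / 2)) (range int)"
  proof -
    have "(\<lambda>n. exp (real n * u - b\<^sup>2 * (real n)\<^sup>2)) sums (exp_series (theta_coeff b) u - 1 / 2 + 1)"
      using tail[of u] by (subst (asm) sums_Suc_iff) simp
    then have "((\<lambda>n. exp (real n * u - b\<^sup>2 * (real n)\<^sup>2)) has_sum (exp_series (theta_coeff b) u + 1 / 2)) UNIV"
      by (intro sums_nonneg_imp_has_sum) (auto simp: add.commute)
    then show ?thesis by (subst has_sum_reindex) (auto simp: o_def)
  qed
  have neg: "((\<lambda>j::int. exp (real_of_int j * u - b\<^sup>2 * (real_of_int j)\<^sup>2)) has_sum (exp_series (theta_coeff b) (- u) - 1 / 2))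
     (range (\<lambda>n. - int (Suc n)))"
  proof -
    have "((\<lambda>n. exp (real (Suc n) * (-u) - b\<^sup>2 * (real (Suc n))\<^sup>2)) has_sum (exp_series (theta_coeff b) (-u) - 1 / 2)) UNIV"
      by (intro sums_nonneg_imp_has_sum tail) auto
    moreover have "exp (real (Suc n) * (-u) - b\<^sup>2 * (real (Suc n))\<^sup>2)
      = exp (real_of_int (- int (Suc n)) * u - b\<^sup>2 * (real_of_int (- int (Suc n)))\<^sup>2)" for n
      by (simp only: of_int_minus of_int_of_nat_eq power2_minus) (simp add: algebra_simps)
    ultimately show ?thesis
      by (subst has_sum_reindex) (auto simp: o_def inj_on_def)
  qed
  have "range int \<inter> range (\<lambda>n. - int (Suc n)) = {}" by auto
  from has_sum_Un_disjoint[OF pos neg this]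
  have "((\<lambda>j::int. exp (real_of_int j * u - b\<^sup>2 * (real_of_int j)\<^sup>2)) has_sum theta b u) (range int \<union> range (\<lambda>n. - int (Suc n)))"
    by (simp add: theta_def)
  moreover have "range int \<union> range (\<lambda>n. - int (Suc n)) = UNIV"
  proof -
    have "j \<in> range int \<union> range (\<lambda>n. - int (Suc n))" for j
      by (cases j rule: int_cases) auto
    then show ?thesis by blast
  qed
  ultimately show ?thesis by simp
qed

text \<open>
  Completing the square in the exponent shifts the summation index by \<open>k\<close>.
\<close>

lemma theta_shift: "theta b (u + real_of_int k * (2 * b\<^sup>2)) = exp (real_of_int k * u + b\<^sup>2 * (real_of_int k)\<^sup>2) * theta b u"
proof -
  let ?g = "\<lambda>v (j::int). exp (real_of_int j * v - b\<^sup>2 * (real_of_int j)\<^sup>2)"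
  have "((\<lambda>j. exp (real_of_int k * u + b\<^sup>2 * (real_of_int k)\<^sup>2) * ?g u j) has_sum
     (exp (real_of_int k * u + b\<^sup>2 * (real_of_int k)\<^sup>2) * theta b u)) UNIV"
    by (rule has_sum_cmult_right[OF theta_has_sum])
  moreover have "exp (real_of_int k * u + b\<^sup>2 * (real_of_int k)\<^sup>2) * ?g u j = ?g (u + real_of_int k * (2 * b\<^sup>2)) (j + k)" for j
    by (simp add: mult_exp_exp power2_eq_square algebra_simps)
  ultimately have "((?g (u + real_of_int k * (2 * b\<^sup>2)) \<circ> (\<lambda>j. j + k)) has_sum
     (exp (real_of_int k * u + b\<^sup>2 * (real_of_int k)\<^sup>2) * theta b u)) UNIV"
    by (simp add: o_def)
  then have "(?g (u + real_of_int k * (2 * b\<^sup>2)) has_sum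
     (exp (real_of_int k * u + b\<^sup>2 * (real_of_int k)\<^sup>2) * theta b u)) (range (\<lambda>j. j + k))"
    by (subst has_sum_reindex) auto
  moreover have "range (\<lambda>j. j + k) = UNIV"
    by (rule surjI[of _ "\<lambda>j. j - k"]) simp
  ultimately have "(?g (u + real_of_int k * (2 * b\<^sup>2)) has_sum
     (exp (real_of_int k * u + b\<^sup>2 * (real_of_int k)\<^sup>2) * theta b u)) UNIV"
    by simp
  with theta_has_sum show ?thesis by (rule has_sum_unique)
qed

lemma theta_ge_exp: "theta b u \<ge> exp (u - b\<^sup>2)"
proof -
  have "sum (\<lambda>j::int. exp (real_of_int j * u - b\<^sup>2 * (real_of_int j)\<^sup>2)) {1} \<le> theta b u"
    by (rule finite_sum_le_has_sum[OF theta_has_sum]) auto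
  then show ?thesis by simp
qed

definition recip_theta where "recip_theta u = 1 / theta b u"

definition log_theta1 where "log_theta1 u = theta1 b u / theta b u"

definition log_theta2 where "log_theta2 u = (theta2 b u * theta b u - (theta1 b u)\<^sup>2) / (theta b u)\<^sup>2"

lemma log_theta1_deriv: "(log_theta1 has_real_derivative log_theta2 u) (at u)"
proof -
  have "theta b u \<noteq> 0" using theta_pos[of u] by simp
  from DERIV_divide[OF theta1_deriv theta_deriv this]
  show ?thesis unfolding log_theta1_def[abs_def] log_theta2_def by (simp only: power2_eq_square)
qed

lemma recip_theta_deriv: "(recip_theta has_real_derivative - (log_theta1 u * recip_theta u)) (at u)"
proof -
  have "theta b u \<noteq> 0" using theta_pos[of u] by simp
  from DERIV_divide[OF DERIV_const[of 1] theta_deriv this]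
  have "((\<lambda>u. 1 / theta b u) has_real_derivative (0 * theta b u - 1 * theta1 b u) / (theta b u * theta b u)) (at u)" .
  moreover have "(0 * theta b u - 1 * theta1 b u) / (theta b u * theta b u) = - (log_theta1 u * recip_theta u)"
    by (simp only: log_theta1_def recip_theta_def) simp
  ultimately show ?thesis unfolding recip_theta_def[abs_def] by simp
qed

lemma log_theta2_nonneg: "log_theta2 u \<ge> 0"
  unfolding log_theta2_def using theta_log_convex[of u] by (intro divide_nonneg_nonneg) auto

lemma recip_theta_pos: "recip_theta u > 0" using theta_pos by (simp add: recip_theta_def)

lemma recip_theta_le_1: "recip_theta u \<le> 1" using theta_ge_1[of u] by (simp add: recip_theta_def)

lemma recip_theta_even: "recip_theta (- u) = recip_theta u" by (simp add: recip_theta_def theta_even)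

lemma log_theta1_odd: "log_theta1 (- u) = - log_theta1 u" by (simp add: log_theta1_def theta_even theta1_odd)

lemma log_theta2_even: "log_theta2 (- u) = log_theta2 u" by (simp add: log_theta2_def theta_even theta1_odd theta2_even)

lemma recip_theta_le_exp: "recip_theta u \<le> exp (b\<^sup>2 - u)"
proof -
  have "recip_theta u \<le> 1 / exp (u - b\<^sup>2)" unfolding recip_theta_def by (intro divide_left_mono theta_ge_exp) (auto simp: theta_pos)
  then show ?thesis by (simp add: exp_diff)
qed

lemma log_theta1_0: "log_theta1 0 = 0" using log_theta1_odd[of 0] by simp

lemma log_theta1_mono:
  assumes "u \<le> v"
  shows "log_theta1 u \<le> log_theta1 v"
proof (rule DERIV_nonneg_imp_nondecreasing[OF assms])
  fix x
  show "\<exists>y. (log_theta1 has_real_derivative y) (at x) \<and> 0 \<le> y"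
    by (intro exI[of _ "log_theta2 x"] conjI log_theta1_deriv log_theta2_nonneg)
qed

lemma log_theta1_nonneg: "u \<ge> 0 \<Longrightarrow> log_theta1 u \<ge> 0"
  using log_theta1_mono[of 0 u] by (simp add: log_theta1_0)

lemma recip_theta_shift: "recip_theta (u + real n * (2 * b\<^sup>2)) = exp (- (real n * u) - b\<^sup>2 * (real n)\<^sup>2) * recip_theta u"
proof -
  have "exp (- (real n * u) - b\<^sup>2 * (real n)\<^sup>2) = 1 / exp (real n * u + b\<^sup>2 * (real n)\<^sup>2)"
    by (simp add: exp_diff exp_minus exp_add field_simps)
  then show ?thesis using theta_shift[of u "int n"] by (simp add: recip_theta_def)
qed

text \<open>
  By \<open>recip_theta_shift\<close> the summands are terms of the series for \<open>theta b (- u)\<close>, divided by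
  \<open>theta b u\<close>; the sum over all integers would be \<open>1\<close>.
\<close>

lemma sum_recip_theta_shift_le_1: "(\<Sum>n<N. recip_theta (u + real n * (2 * b\<^sup>2))) \<le> 1"
proof -
  have "(\<Sum>n<N. exp (- (real n * u) - b\<^sup>2 * (real n)\<^sup>2)) =
     sum (\<lambda>j::int. exp (real_of_int j * (- u) - b\<^sup>2 * (real_of_int j)\<^sup>2)) (int ` {..<N})"
    by (subst sum.reindex) (auto simp: o_def)
  also have "\<dots> \<le> theta b (- u)" by (rule finite_sum_le_has_sum[OF theta_has_sum]) auto
  finally have "(\<Sum>n<N. exp (- (real n * u) - b\<^sup>2 * (real n)\<^sup>2)) \<le> theta b u" by (simp add: theta_even)
  then have "(\<Sum>n<N. exp (- (real n * u) - b\<^sup>2 * (real n)\<^sup>2)) * recip_theta u \<le> theta b u * recip_theta u"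
    using recip_theta_pos[of u] by (intro mult_right_mono) auto
  then show ?thesis using theta_pos[of u] unfolding recip_theta_shift sum_distrib_right[symmetric] by (simp add: recip_theta_def)
qed

text \<open>
  The logarithmic derivative of \<open>theta_shift\<close>.
\<close>

lemma log_theta1_shift: "log_theta1 (u + real n * (2 * b\<^sup>2)) = log_theta1 u + real n"
proof -
  define s where "s = real n * (2 * b\<^sup>2)"
  have th: "theta b (v + s) = exp (real n * v + b\<^sup>2 * (real n)\<^sup>2) * theta b v" for v
    using theta_shift[of v "int n"] by (simp add: s_def)
  have "((\<lambda>v. theta b (v + s)) has_real_derivative theta1 b (u + s) * 1) (at u)"
    by (rule DERIV_chain2[OF theta_deriv]) (auto intro!: derivative_eq_intros)
  moreover have "((\<lambda>v. exp (real n * v + b\<^sup>2 * (real n)\<^sup>2) * theta b v) has_real_derivative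
     exp (real n * u + b\<^sup>2 * (real n)\<^sup>2) * (real n * theta b u + theta1 b u)) (at u)"
    by (auto intro!: derivative_eq_intros theta_deriv simp: algebra_simps)
  ultimately have "theta1 b (u + s) = exp (real n * u + b\<^sup>2 * (real n)\<^sup>2) * (real n * theta b u + theta1 b u)"
    unfolding th using DERIV_unique by fastforce
  then show ?thesis unfolding log_theta1_def s_def[symmetric] th using theta_pos[of u] by (simp add: field_simps)
qed

lemma log_theta2_shift: "log_theta2 (u + real n * (2 * b\<^sup>2)) = log_theta2 u"
proof -
  have "((\<lambda>v. log_theta1 (v + real n * (2 * b\<^sup>2))) has_real_derivative log_theta2 (u + real n * (2 * b\<^sup>2)) * 1) (at u)"
    by (rule DERIV_chain2[OF log_theta1_deriv]) (auto intro!: derivative_eq_intros)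
  moreover have "((\<lambda>v. log_theta1 v + real n) has_real_derivative log_theta2 u) (at u)"
    by (auto intro!: derivative_eq_intros log_theta1_deriv)
  ultimately show ?thesis unfolding log_theta1_shift using DERIV_unique by fastforce
qed

lemma log_theta1_le: "u \<ge> 0 \<Longrightarrow> log_theta1 u \<le> u / (2 * b\<^sup>2) + 1"
proof -
  assume u: "u \<ge> 0"
  define n where "n = nat \<lceil>u / (2 * b\<^sup>2)\<rceil>"
  have "u / (2 * b\<^sup>2) \<ge> 0" using u by simp
  then have n: "u / (2 * b\<^sup>2) \<le> real n" "real n \<le> u / (2 * b\<^sup>2) + 1"
    unfolding n_def by linarith+
  then have "u \<le> 0 + real n * (2 * b\<^sup>2)" using b by (simp add: field_simps)
  then have "log_theta1 u \<le> real n" using log_theta1_mono[of u "0 + real n * (2 * b\<^sup>2)"] log_theta1_shift[of 0 n] by (simp add: log_theta1_0)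
  with n show ?thesis by linarith
qed

end

section \<open>The reciprocal of the theta function\<close>

lemma nn_integral_periodize_le:
  fixes G W :: "real \<Rightarrow> ennreal"
  assumes c: "c > 0" and [measurable]: "G \<in> borel_measurable borel" "W \<in> borel_measurable borel"
    and le: "\<And>u N. (\<Sum>n<N. G (u + real n * c)) \<le> W u"
  shows "(\<integral>\<^sup>+u. G u * indicator {0..} u) \<le> (\<integral>\<^sup>+u. W u * indicator {0..<c} u)"
proof -
  have fin: "(\<integral>\<^sup>+u. G u * indicator {0..<real N * c} u)
    = (\<Sum>n<N. \<integral>\<^sup>+u. G (u + real n * c) * indicator {0..<c} u)" for N
  proof (induction N)
    case (Suc N)
    have "(\<integral>\<^sup>+u. G u * indicator {0..<real (Suc N) * c} u)
      = (\<integral>\<^sup>+u. G u * indicator {0..<real N * c} u + G u * indicator {real N * c..<real (Suc N) * c} u)"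
    proof (rule nn_integral_cong)
      fix u
      have "0 \<le> real N * c" "real N * c \<le> real (Suc N) * c" using c by (auto intro: mult_right_mono)
      then show "G u * indicator {0..<real (Suc N) * c} u = G u * indicator {0..<real N * c} u + G u * indicator {real N * c..<real (Suc N) * c} u"
        by (auto simp: indicator_def)
    qed
    also have "\<dots> = (\<integral>\<^sup>+u. G u * indicator {0..<real N * c} u) + (\<integral>\<^sup>+u. G u * indicator {real N * c..<real (Suc N) * c} u)"
      by (rule nn_integral_add) measurable
    also have "(\<integral>\<^sup>+u. G u * indicator {real N * c..<real (Suc N) * c} u)
       = (\<integral>\<^sup>+u. G (real N * c + u) * indicator {real N * c..<real (Suc N) * c} (real N * c + u))"
      by (rule nn_integral_translate[symmetric]) measurable
    also have "\<dots> = (\<integral>\<^sup>+u. G (u + real N * c) * indicator {0..<c} u)"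
      by (intro nn_integral_cong) (auto simp: indicator_def add.commute distrib_right)
    finally show ?case by (simp add: Suc.IH)
  qed simp
  show ?thesis
  proof (rule nn_integral_le_of_fatou[OF _ _ always_eventually tendsto_const])
    show "(\<lambda>u. G u * indicator {0..<real N * c} u) \<in> borel_measurable lborel" for N by measurable
    show "AE u in lborel. (\<lambda>N. G u * indicator {0..<real N * c} u) \<longlonglongrightarrow> G u * indicator {0..} u"
    proof (intro AE_I2 tendsto_eventually)
      fix u
      obtain N0 where N0: "u / c < real N0" using reals_Archimedean2 by blast
      show "\<forall>\<^sub>F N in sequentially. G u * indicator {0..<real N * c} u = G u * indicator {0..} u"
        using eventually_ge_at_top[of N0]
      proof eventually_elim
        case (elim N)
        then have "u / c < real N" using N0 by linarith
        then have "u < real N * c" using c by (simp add: field_simps)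
        then show ?case by (auto simp: indicator_def)
      qed
    qed
    show "\<forall>N. (\<integral>\<^sup>+u. G u * indicator {0..<real N * c} u) \<le> (\<integral>\<^sup>+u. W u * indicator {0..<c} u)"
    proof
      fix N
      have "(\<integral>\<^sup>+u. G u * indicator {0..<real N * c} u) = (\<integral>\<^sup>+u. (\<Sum>n<N. G (u + real n * c) * indicator {0..<c} u))"
        unfolding fin by (subst nn_integral_sum) auto
      also have "\<dots> \<le> (\<integral>\<^sup>+u. W u * indicator {0..<c} u)"
        unfolding sum_distrib_right[symmetric] by (intro nn_integral_mono mult_right_mono le) simp
      finally show "(\<integral>\<^sup>+u. G u * indicator {0..<real N * c} u) \<le> (\<integral>\<^sup>+u. W u * indicator {0..<c} u)" .
    qed
  qed
qed

context
  fixes b :: real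
  assumes b: "b > 0"
begin

lemma recip_theta_continuous: "continuous_on S (recip_theta b)"
  using DERIV_isCont[OF recip_theta_deriv[OF b]] by (simp add: continuous_at_imp_continuous_on)

lemma log_theta1_continuous: "continuous_on S (log_theta1 b)"
  using DERIV_isCont[OF log_theta1_deriv[OF b]] by (simp add: continuous_at_imp_continuous_on)

lemma log_theta2_continuous: "continuous_on S (log_theta2 b)"
proof -
  have "continuous_on S (theta b)" "continuous_on S (theta1 b)"
    using DERIV_isCont[OF theta_deriv[OF b]] DERIV_isCont[OF theta1_deriv[OF b]]
    by (auto simp: continuous_at_imp_continuous_on)
  then show ?thesis unfolding log_theta2_def[OF b, abs_def] using theta_pos[OF b]
    by (intro continuous_intros theta2_continuous[OF b]) (auto simp: less_le)
qed

lemma recip_theta_measurable [measurable]: "recip_theta b \<in> borel_measurable borel"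
  and log_theta1_measurable [measurable]: "log_theta1 b \<in> borel_measurable borel"
  and log_theta2_measurable [measurable]: "log_theta2 b \<in> borel_measurable borel"
  by (intro borel_measurable_continuous_onI recip_theta_continuous log_theta1_continuous log_theta2_continuous)+

lemma nn_integral_recip_theta: "(\<integral>\<^sup>+u. ennreal (recip_theta b u) * indicator {0..} u) \<le> ennreal (2 * b\<^sup>2)"
proof -
  have "(\<integral>\<^sup>+u. ennreal (recip_theta b u) * indicator {0..} u) \<le> (\<integral>\<^sup>+u. 1 * indicator {0..<2 * b\<^sup>2} u)"
  proof (rule nn_integral_periodize_le)
    fix u N
    have "(\<Sum>n<N. ennreal (recip_theta b (u + real n * (2 * b\<^sup>2)))) = ennreal (\<Sum>n<N. recip_theta b (u + real n * (2 * b\<^sup>2)))"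
      by (rule sum_ennreal) (simp add: recip_theta_pos[OF b] less_imp_le)
    also have "\<dots> \<le> ennreal 1" by (intro ennreal_leI sum_recip_theta_shift_le_1 b)
    finally show "(\<Sum>n<N. ennreal (recip_theta b (u + real n * (2 * b\<^sup>2)))) \<le> 1" by simp
  qed (use b in auto)
  also have "\<dots> = ennreal (2 * b\<^sup>2)" by simp
  finally show ?thesis .
qed

text \<open>
  \<open>log_theta2\<close> is periodic and the translates of \<open>recip_theta\<close> by periods add up to at most \<open>1\<close>, so the
  integral is bounded by the increase of \<open>log_theta1\<close> over one period, which is \<open>1\<close>.
\<close>

lemma nn_integral_log_theta2_recip_theta: "(\<integral>\<^sup>+u. ennreal (log_theta2 b u * recip_theta b u) * indicator {0..} u) \<le> 1"
proof -
  have "(\<integral>\<^sup>+u. ennreal (log_theta2 b u * recip_theta b u) * indicator {0..} u)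
    \<le> (\<integral>\<^sup>+u. ennreal (log_theta2 b u) * indicator {0..<2 * b\<^sup>2} u)"
  proof (rule nn_integral_periodize_le)
    fix u N
    have "(\<Sum>n<N. ennreal (log_theta2 b (u + real n * (2 * b\<^sup>2)) * recip_theta b (u + real n * (2 * b\<^sup>2))))
      = ennreal (\<Sum>n<N. log_theta2 b u * recip_theta b (u + real n * (2 * b\<^sup>2)))"
      unfolding log_theta2_shift[OF b]
      by (rule sum_ennreal) (simp add: recip_theta_pos[OF b] log_theta2_nonneg[OF b] less_imp_le)
    also have "\<dots> \<le> ennreal (log_theta2 b u * 1)" unfolding sum_distrib_left[symmetric]
      by (intro ennreal_leI mult_left_mono sum_recip_theta_shift_le_1 b log_theta2_nonneg)
    finally show "(\<Sum>n<N. ennreal (log_theta2 b (u + real n * (2 * b\<^sup>2)) * recip_theta b (u + real n * (2 * b\<^sup>2)))) \<le> ennreal (log_theta2 b u)"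
      by simp
  qed (use b in auto)
  also have "\<dots> \<le> (\<integral>\<^sup>+u. ennreal (log_theta2 b u) * indicator {0..2 * b\<^sup>2} u)"
    by (intro nn_integral_mono) (auto simp: indicator_def)
  also have "\<dots> = ennreal (log_theta1 b (2 * b\<^sup>2) - log_theta1 b 0)"
    by (rule nn_integral_FTC_Icc) (auto intro: log_theta1_deriv[OF b] log_theta2_nonneg[OF b] simp: has_real_derivative_iff_has_vector_derivative[symmetric] has_field_derivative_at_within)
  also have "log_theta1 b (2 * b\<^sup>2) - log_theta1 b 0 = 1" using log_theta1_shift[OF b, of 0 1] by simp
  finally show ?thesis by simp
qed

lemma recip_theta_tendsto_0: "(recip_theta b \<longlongrightarrow> 0) at_top"
proof (rule Lim_null_comparison)
  show "\<forall>\<^sub>F u in at_top. norm (recip_theta b u) \<le> exp (b\<^sup>2 - u)"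
    using recip_theta_le_exp[OF b] recip_theta_pos[OF b] by (intro always_eventually allI) (simp add: less_imp_le)
  have "filterlim (\<lambda>u. b\<^sup>2 - u) at_bot at_top"
    using filterlim_tendsto_add_at_top[OF tendsto_const[of "- b\<^sup>2"] filterlim_ident]
    by (simp add: filterlim_uminus_at_bot)
  then show "((\<lambda>u. exp (b\<^sup>2 - u)) \<longlongrightarrow> 0) at_top" by (rule filterlim_compose[OF exp_at_bot])
qed

lemma log_theta1_recip_theta_tendsto_0: "((\<lambda>u. log_theta1 b u * recip_theta b u) \<longlongrightarrow> 0) at_top"
proof (rule Lim_null_comparison)
  show "\<forall>\<^sub>F u in at_top. norm (log_theta1 b u * recip_theta b u) \<le> (u / (2 * b\<^sup>2) + 1) * exp (b\<^sup>2 - u)"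
    using eventually_ge_at_top[of 0]
  proof eventually_elim
    case (elim u)
    then show ?case
      using log_theta1_nonneg[OF b elim] log_theta1_le[OF b elim] recip_theta_le_exp[OF b, of u] recip_theta_pos[OF b, of u]
      by (simp add: abs_mult) (intro mult_mono, auto)
  qed
  have "((\<lambda>u::real. u / exp u) \<longlongrightarrow> 0) at_top" using tendsto_power_div_exp_0[of 1] by simp
  moreover have "((\<lambda>u. inverse (exp u)) \<longlongrightarrow> (0::real)) at_top"
    by (intro tendsto_inverse_0_at_top exp_at_top)
  ultimately have "((\<lambda>u. exp (b\<^sup>2) / (2 * b\<^sup>2) * (u / exp u) + exp (b\<^sup>2) * inverse (exp u)) \<longlongrightarrow>
    exp (b\<^sup>2) / (2 * b\<^sup>2) * 0 + exp (b\<^sup>2) * 0) at_top"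
    by (intro tendsto_intros)
  moreover have "exp (b\<^sup>2) / (2 * b\<^sup>2) * (u / exp u) + exp (b\<^sup>2) * inverse (exp u) = (u / (2 * b\<^sup>2) + 1) * exp (b\<^sup>2 - u)" for u
    using b by (simp add: exp_diff field_simps)
  ultimately show "((\<lambda>u. (u / (2 * b\<^sup>2) + 1) * exp (b\<^sup>2 - u)) \<longlongrightarrow> 0) at_top" by simp
qed

lemma nn_integral_log_theta1_recip_theta: "(\<integral>\<^sup>+u. ennreal (log_theta1 b u * recip_theta b u) * indicator {0..} u) \<le> 1"
proof -
  have "(\<integral>\<^sup>+u. ennreal (log_theta1 b u * recip_theta b u) * indicator {0..} u) = ennreal (- 0 - (- recip_theta b 0))"
  proof (rule nn_integral_FTC_atLeast)
    show "((\<lambda>u. - recip_theta b u) has_real_derivative log_theta1 b u * recip_theta b u) (at u)" for u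
      using DERIV_minus[OF recip_theta_deriv[OF b, of u]] by simp
    show "((\<lambda>u. - recip_theta b u) \<longlongrightarrow> - 0) at_top" by (intro tendsto_minus recip_theta_tendsto_0)
  qed (use log_theta1_nonneg[OF b] recip_theta_pos[OF b] in \<open>auto simp: less_imp_le\<close>)
  also have "\<dots> \<le> ennreal 1" using recip_theta_le_1[OF b, of 0] by (intro ennreal_leI) simp
  finally show ?thesis by simp
qed

text \<open>
  With \<open>L\<close> and \<open>M\<close> short for \<open>log_theta1\<close> and \<open>recip_theta\<close>, the derivative of \<open>L * M\<close> is \<open>L' * M - L\<^sup>2 * M\<close>.
  As \<open>L * M\<close> vanishes at \<open>0\<close> and is nonnegative beyond, the integral of \<open>L\<^sup>2 * M\<close> is at most that of
  \<open>L' * M\<close>.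
\<close>

lemma nn_integral_log_theta1_sq_recip_theta: "(\<integral>\<^sup>+u. ennreal ((log_theta1 b u)\<^sup>2 * recip_theta b u) * indicator {0..} u) \<le> 1"
proof (rule nn_integral_le_of_fatou[OF _ _ always_eventually tendsto_const])
  show "(\<lambda>u. ennreal ((log_theta1 b u)\<^sup>2 * recip_theta b u) * indicator {0..real n} u) \<in> borel_measurable lborel" for n by measurable
  show "AE u in lborel. (\<lambda>n. ennreal ((log_theta1 b u)\<^sup>2 * recip_theta b u) * indicator {0..real n} u) \<longlonglongrightarrow> ennreal ((log_theta1 b u)\<^sup>2 * recip_theta b u) * indicator {0..} u"
  proof (intro AE_I2 tendsto_eventually)
    fix u
    obtain N where N: "u \<le> real N" using real_arch_simple by blast
    show "\<forall>\<^sub>F n in sequentially. ennreal ((log_theta1 b u)\<^sup>2 * recip_theta b u) * indicator {0..real n} u = ennreal ((log_theta1 b u)\<^sup>2 * recip_theta b u) * indicator {0..} u"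
      using eventually_ge_at_top[of N] by eventually_elim (use N in \<open>auto simp: indicator_def\<close>)
  qed
  show "\<forall>n. (\<integral>\<^sup>+u. ennreal ((log_theta1 b u)\<^sup>2 * recip_theta b u) * indicator {0..real n} u) \<le> 1"
  proof
    fix n
    let ?S = "{0..real n}"
    have c1: "continuous_on ?S (\<lambda>u. (log_theta1 b u)\<^sup>2 * recip_theta b u)" and c2: "continuous_on ?S (\<lambda>u. log_theta2 b u * recip_theta b u)"
      by (intro continuous_intros log_theta1_continuous recip_theta_continuous log_theta2_continuous)+
    have i1: "(\<lambda>u. (log_theta1 b u)\<^sup>2 * recip_theta b u) integrable_on ?S" and i2: "(\<lambda>u. log_theta2 b u * recip_theta b u) integrable_on ?S"
      by (intro integrable_continuous_real c1 c2)+
    have "((\<lambda>u. log_theta2 b u * recip_theta b u - (log_theta1 b u)\<^sup>2 * recip_theta b u) has_integral (log_theta1 b (real n) * recip_theta b (real n) - log_theta1 b 0 * recip_theta b 0)) ?S"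
    proof (rule fundamental_theorem_of_calculus)
      fix u
      have "((\<lambda>u. log_theta1 b u * recip_theta b u) has_real_derivative log_theta2 b u * recip_theta b u - (log_theta1 b u)\<^sup>2 * recip_theta b u) (at u)"
        by (rule DERIV_cong[OF DERIV_mult[OF log_theta1_deriv[OF b] recip_theta_deriv[OF b]]]) (simp add: power2_eq_square)
      then show "((\<lambda>u. log_theta1 b u * recip_theta b u) has_vector_derivative log_theta2 b u * recip_theta b u - (log_theta1 b u)\<^sup>2 * recip_theta b u) (at u within ?S)"
        by (rule has_vector_derivative_at_within[OF has_real_derivative_iff_has_vector_derivative[THEN iffD1]])
    qed simp
    then have "integral ?S (\<lambda>u. log_theta2 b u * recip_theta b u) - integral ?S (\<lambda>u. (log_theta1 b u)\<^sup>2 * recip_theta b u) = log_theta1 b (real n) * recip_theta b (real n)"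
      using Henstock_Kurzweil_Integration.integral_diff[OF i2 i1] by (simp add: integral_unique log_theta1_0[OF b])
    moreover have "log_theta1 b (real n) * recip_theta b (real n) \<ge> 0"
      using log_theta1_nonneg[OF b, of "real n"] recip_theta_pos[OF b, of "real n"] by simp
    ultimately have le: "integral ?S (\<lambda>u. (log_theta1 b u)\<^sup>2 * recip_theta b u) \<le> integral ?S (\<lambda>u. log_theta2 b u * recip_theta b u)" by linarith
    have "(\<integral>\<^sup>+u. ennreal ((log_theta1 b u)\<^sup>2 * recip_theta b u) * indicator ?S u) = ennreal (integral ?S (\<lambda>u. (log_theta1 b u)\<^sup>2 * recip_theta b u))"
      by (rule nn_integral_continuous_interval[OF c1]) (simp add: recip_theta_pos[OF b] less_imp_le)
    also have "\<dots> \<le> ennreal (integral ?S (\<lambda>u. log_theta2 b u * recip_theta b u))" by (rule ennreal_leI[OF le])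
    also have "\<dots> = (\<integral>\<^sup>+u. ennreal (log_theta2 b u * recip_theta b u) * indicator ?S u)"
      by (rule nn_integral_continuous_interval[OF c2, symmetric]) (simp add: recip_theta_pos[OF b] log_theta2_nonneg[OF b] less_imp_le)
    also have "\<dots> \<le> (\<integral>\<^sup>+u. ennreal (log_theta2 b u * recip_theta b u) * indicator {0..} u)"
      by (intro nn_integral_mono) (auto simp: indicator_def)
    also have "\<dots> \<le> 1" by (rule nn_integral_log_theta2_recip_theta)
    finally show "(\<integral>\<^sup>+u. ennreal ((log_theta1 b u)\<^sup>2 * recip_theta b u) * indicator ?S u) \<le> 1" .
  qed
qed

lemma nn_integral_scale:
  fixes F :: "real \<Rightarrow> ennreal"
  assumes [measurable]: "F \<in> borel_measurable borel" and F: "(\<integral>\<^sup>+u. F u) \<le> ennreal V" and V: "V \<ge> 0"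
  shows "(\<integral>\<^sup>+x. F (b * x)) \<le> ennreal (V / b)"
proof -
  have "(\<integral>\<^sup>+u. F u) = ennreal b * (\<integral>\<^sup>+x. F (b * x))"
    using nn_integral_real_affine[of F b 0] b by simp
  then have "ennreal (1 / b) * (ennreal b * (\<integral>\<^sup>+x. F (b * x))) \<le> ennreal (1 / b) * ennreal V"
    using F by (intro mult_left_mono) auto
  moreover have "ennreal (1 / b) * (ennreal b * X) = X" for X
    using b by (simp add: mult.assoc[symmetric] ennreal_mult[symmetric])
  ultimately show ?thesis using b V by (simp add: ennreal_mult[symmetric])
qed

text \<open>
  For \<open>b = \<pi> / h\<close> this is the one-dimensional multiplier; \<open>gauss_ratio1\<close> and \<open>gauss_ratio2\<close> are its
  first two derivatives.
\<close>

definition gauss_ratio :: "real \<Rightarrow> real" where "gauss_ratio x = recip_theta b (b * x)"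

definition gauss_ratio1 :: "real \<Rightarrow> real" where "gauss_ratio1 x = - b * (log_theta1 b (b * x) * recip_theta b (b * x))"

definition gauss_ratio2 :: "real \<Rightarrow> real" where
  "gauss_ratio2 x = b\<^sup>2 * (((log_theta1 b (b * x))\<^sup>2 - log_theta2 b (b * x)) * recip_theta b (b * x))"

lemma gauss_ratio_deriv: "(gauss_ratio has_real_derivative gauss_ratio1 x) (at x)"
proof -
  have "((\<lambda>x. recip_theta b (b * x)) has_real_derivative - (log_theta1 b (b * x) * recip_theta b (b * x)) * (b * 1)) (at x)"
    by (rule DERIV_chain2[OF recip_theta_deriv[OF b] DERIV_cmult[OF DERIV_ident]])
  then show ?thesis by (simp add: gauss_ratio_def[abs_def] gauss_ratio1_def mult_ac)
qed

lemma gauss_ratio1_deriv: "(gauss_ratio1 has_real_derivative gauss_ratio2 x) (at x)"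
proof -
  have "((\<lambda>u. log_theta1 b u * recip_theta b u) has_real_derivative log_theta2 b u * recip_theta b u + (- (log_theta1 b u * recip_theta b u)) * log_theta1 b u) (at u)" for u
    by (rule DERIV_mult[OF log_theta1_deriv[OF b] recip_theta_deriv[OF b]])
  from DERIV_chain2[OF this DERIV_cmult[OF DERIV_ident, of b x]]
  have "((\<lambda>x. log_theta1 b (b * x) * recip_theta b (b * x)) has_real_derivative
    (log_theta2 b (b * x) * recip_theta b (b * x) + (- (log_theta1 b (b * x) * recip_theta b (b * x))) * log_theta1 b (b * x)) * (b * 1)) (at x)" .
  from DERIV_cmult[OF this, of "- b"]
  show ?thesis unfolding gauss_ratio1_def[abs_def] gauss_ratio2_def
    by (rule DERIV_cong) (simp add: power2_eq_square algebra_simps)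
qed

lemma gauss_ratio2_continuous: "continuous_on S gauss_ratio2"
proof -
  have c: "continuous_on S (\<lambda>x. b * x)" by (intro continuous_intros)
  show ?thesis unfolding gauss_ratio2_def[abs_def]
    by (intro continuous_on_mult continuous_on_diff continuous_on_power continuous_on_const
      continuous_on_compose2[OF log_theta1_continuous[of UNIV] c] continuous_on_compose2[OF log_theta2_continuous[of UNIV] c]
      continuous_on_compose2[OF recip_theta_continuous[of UNIV] c]) auto
qed

lemma gauss_ratio1_continuous: "continuous_on S gauss_ratio1"
  using DERIV_isCont[OF gauss_ratio1_deriv] by (simp add: continuous_at_imp_continuous_on)

lemma gauss_ratio_continuous: "continuous_on S gauss_ratio"
  using DERIV_isCont[OF gauss_ratio_deriv] by (simp add: continuous_at_imp_continuous_on)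

lemma gauss_ratio_measurable [measurable]: "gauss_ratio \<in> borel_measurable borel"
  and gauss_ratio1_measurable [measurable]: "gauss_ratio1 \<in> borel_measurable borel"
  and gauss_ratio2_measurable [measurable]: "gauss_ratio2 \<in> borel_measurable borel"
  by (intro borel_measurable_continuous_onI gauss_ratio_continuous gauss_ratio1_continuous gauss_ratio2_continuous)+

lemma nn_integral_gauss_ratio: "(\<integral>\<^sup>+x. ennreal \<bar>gauss_ratio x\<bar>) \<le> ennreal (4 * b)"
proof -
  have "(\<integral>\<^sup>+u. ennreal (recip_theta b u)) = 2 * (\<integral>\<^sup>+u. ennreal (recip_theta b u) * indicator {0..} u)"
    by (rule nn_integral_even) (auto simp: recip_theta_even[OF b])
  also have "\<dots> \<le> 2 * ennreal (2 * b\<^sup>2)" by (intro mult_left_mono nn_integral_recip_theta) simp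
  also have "\<dots> = ennreal (4 * b\<^sup>2)" by (simp add: ennreal_mult'[symmetric] flip: ennreal_numeral)
  finally have "(\<integral>\<^sup>+x. ennreal (recip_theta b (b * x))) \<le> ennreal (4 * b\<^sup>2 / b)"
    by (intro nn_integral_scale) auto
  then show ?thesis using b recip_theta_pos[OF b] by (simp add: gauss_ratio_def power2_eq_square less_imp_le)
qed

lemma nn_integral_gauss_ratio1: "(\<integral>\<^sup>+x. ennreal \<bar>gauss_ratio1 x\<bar>) \<le> ennreal 2"
proof -
  have "(\<integral>\<^sup>+u. ennreal (b * \<bar>log_theta1 b u * recip_theta b u\<bar>)) = 2 * (\<integral>\<^sup>+u. ennreal (b * \<bar>log_theta1 b u * recip_theta b u\<bar>) * indicator {0..} u)"
    by (rule nn_integral_even) (auto simp: recip_theta_even[OF b] log_theta1_odd[OF b])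
  also have "(\<integral>\<^sup>+u. ennreal (b * \<bar>log_theta1 b u * recip_theta b u\<bar>) * indicator {0..} u)
    = (\<integral>\<^sup>+u. ennreal b * (ennreal (log_theta1 b u * recip_theta b u) * indicator {0..} u))"
    using b log_theta1_nonneg[OF b] recip_theta_pos[OF b] by (intro nn_integral_cong) (auto simp: indicator_def ennreal_mult' less_imp_le)
  also have "\<dots> = ennreal b * (\<integral>\<^sup>+u. ennreal (log_theta1 b u * recip_theta b u) * indicator {0..} u)"
    by (rule nn_integral_cmult) measurable
  also have "2 * \<dots> \<le> 2 * (ennreal b * 1)" by (intro mult_left_mono nn_integral_log_theta1_recip_theta) auto
  also have "\<dots> = ennreal (2 * b)" using b by (simp add: ennreal_mult')
  finally have "(\<integral>\<^sup>+x. ennreal (b * \<bar>log_theta1 b (b * x) * recip_theta b (b * x)\<bar>)) \<le> ennreal (2 * b / b)"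
    using b by (intro nn_integral_scale) auto
  then show ?thesis using b by (simp add: gauss_ratio1_def abs_mult)
qed

lemma nn_integral_gauss_ratio2: "(\<integral>\<^sup>+x. ennreal \<bar>gauss_ratio2 x\<bar>) \<le> ennreal (4 * b)"
proof -
  have m1: "(\<lambda>u. ennreal ((log_theta1 b u)\<^sup>2 * recip_theta b u) * indicator {0..} u) \<in> borel_measurable lborel"
    and m2: "(\<lambda>u. ennreal (log_theta2 b u * recip_theta b u) * indicator {0..} u) \<in> borel_measurable lborel"
    by measurable
  note m12 = borel_measurable_add[OF m1 m2]
  have "(\<integral>\<^sup>+u. ennreal (b\<^sup>2 * \<bar>((log_theta1 b u)\<^sup>2 - log_theta2 b u) * recip_theta b u\<bar>) * indicator {0..} u)
    \<le> (\<integral>\<^sup>+u. ennreal (b\<^sup>2) * (ennreal ((log_theta1 b u)\<^sup>2 * recip_theta b u) * indicator {0..} u + ennreal (log_theta2 b u * recip_theta b u) * indicator {0..} u))"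
  proof (intro nn_integral_mono)
    fix u
    have "\<bar>((log_theta1 b u)\<^sup>2 - log_theta2 b u) * recip_theta b u\<bar> \<le> (log_theta1 b u)\<^sup>2 * recip_theta b u + log_theta2 b u * recip_theta b u"
      using recip_theta_pos[OF b, of u] log_theta2_nonneg[OF b, of u] by (simp add: abs_mult distrib_right[symmetric] mult_right_mono abs_le_iff)
    then have "ennreal (b\<^sup>2 * \<bar>((log_theta1 b u)\<^sup>2 - log_theta2 b u) * recip_theta b u\<bar>) \<le> ennreal (b\<^sup>2 * ((log_theta1 b u)\<^sup>2 * recip_theta b u + log_theta2 b u * recip_theta b u))"
      by (intro ennreal_leI mult_left_mono) auto
    also have "\<dots> = ennreal (b\<^sup>2) * (ennreal ((log_theta1 b u)\<^sup>2 * recip_theta b u) + ennreal (log_theta2 b u * recip_theta b u))"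
      using recip_theta_pos[OF b, of u] log_theta2_nonneg[OF b, of u] by (simp add: ennreal_mult' ennreal_plus)
    finally show "ennreal (b\<^sup>2 * \<bar>((log_theta1 b u)\<^sup>2 - log_theta2 b u) * recip_theta b u\<bar>) * indicator {0..} u
      \<le> ennreal (b\<^sup>2) * (ennreal ((log_theta1 b u)\<^sup>2 * recip_theta b u) * indicator {0..} u + ennreal (log_theta2 b u * recip_theta b u) * indicator {0..} u)"
      by (auto simp: indicator_def)
  qed
  also have "\<dots> = ennreal (b\<^sup>2) * (\<integral>\<^sup>+u. ennreal ((log_theta1 b u)\<^sup>2 * recip_theta b u) * indicator {0..} u
      + ennreal (log_theta2 b u * recip_theta b u) * indicator {0..} u)"
    by (rule nn_integral_cmult[OF m12])
  also have "(\<integral>\<^sup>+u. ennreal ((log_theta1 b u)\<^sup>2 * recip_theta b u) * indicator {0..} u + ennreal (log_theta2 b u * recip_theta b u) * indicator {0..} u)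
    = (\<integral>\<^sup>+u. ennreal ((log_theta1 b u)\<^sup>2 * recip_theta b u) * indicator {0..} u)
      + (\<integral>\<^sup>+u. ennreal (log_theta2 b u * recip_theta b u) * indicator {0..} u)"
    by (rule nn_integral_add[OF m1 m2])
  also have "ennreal (b\<^sup>2) * \<dots> \<le> ennreal (b\<^sup>2) * (1 + 1)"
    by (intro mult_left_mono add_mono nn_integral_log_theta1_sq_recip_theta nn_integral_log_theta2_recip_theta) auto
  finally have half: "(\<integral>\<^sup>+u. ennreal (b\<^sup>2 * \<bar>((log_theta1 b u)\<^sup>2 - log_theta2 b u) * recip_theta b u\<bar>) * indicator {0..} u)
    \<le> ennreal (b\<^sup>2) * (1 + 1)" .
  have "(\<integral>\<^sup>+u. ennreal (b\<^sup>2 * \<bar>((log_theta1 b u)\<^sup>2 - log_theta2 b u) * recip_theta b u\<bar>))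
    = 2 * (\<integral>\<^sup>+u. ennreal (b\<^sup>2 * \<bar>((log_theta1 b u)\<^sup>2 - log_theta2 b u) * recip_theta b u\<bar>) * indicator {0..} u)"
    by (rule nn_integral_even) (auto simp: recip_theta_even[OF b] log_theta1_odd[OF b] log_theta2_even[OF b])
  also have "\<dots> \<le> 2 * (ennreal (b\<^sup>2) * (1 + 1))" by (intro mult_left_mono half) simp
  also have "\<dots> = (2 * 2) * ennreal (b\<^sup>2)" by (simp only: one_add_one mult_ac)
  also have "\<dots> = ennreal (4 * b\<^sup>2)" by (simp add: ennreal_mult)
  finally have "(\<integral>\<^sup>+x. ennreal (b\<^sup>2 * \<bar>((log_theta1 b (b * x))\<^sup>2 - log_theta2 b (b * x)) * recip_theta b (b * x)\<bar>)) \<le> ennreal (4 * b\<^sup>2 / b)"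
    using b by (intro nn_integral_scale) (auto simp: mult_left_mono)
  then show ?thesis using b by (simp add: gauss_ratio2_def abs_mult power2_eq_square)
qed

lemma gauss_ratio_tendsto: "(gauss_ratio \<longlongrightarrow> 0) at_top" "(gauss_ratio1 \<longlongrightarrow> 0) at_top"
proof -
  have lim: "filterlim (\<lambda>x. b * x) at_top at_top"
    using filterlim_tendsto_pos_mult_at_top[OF tendsto_const b filterlim_ident] by simp
  show "(gauss_ratio \<longlongrightarrow> 0) at_top"
    unfolding gauss_ratio_def[abs_def] by (rule filterlim_compose[OF recip_theta_tendsto_0 lim])
  have "((\<lambda>x. - b * (log_theta1 b (b * x) * recip_theta b (b * x))) \<longlongrightarrow> - b * 0) at_top"
    by (intro tendsto_mult tendsto_const filterlim_compose[OF log_theta1_recip_theta_tendsto_0 lim])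
  then show "(gauss_ratio1 \<longlongrightarrow> 0) at_top" by (simp add: gauss_ratio1_def[abs_def])
qed

lemma gauss_ratio_even: "gauss_ratio (- x) = gauss_ratio x" by (simp add: gauss_ratio_def recip_theta_even[OF b])

lemma gauss_ratio1_odd: "gauss_ratio1 (- x) = - gauss_ratio1 x" by (simp add: gauss_ratio1_def recip_theta_even[OF b] log_theta1_odd[OF b])

end

section \<open>Fourier integrals of smooth functions\<close>

lemma integral_by_parts_cis:
  fixes g g' :: "real \<Rightarrow> real"
  assumes D: "\<And>t. (g has_real_derivative g' t) (at t)" and c': "continuous_on UNIV g'"
    and g: "integrable lborel g" and g': "integrable lborel g'"
    and top: "(g \<longlongrightarrow> 0) at_top" and bot: "(g \<longlongrightarrow> 0) at_bot"
  shows "complex_of_real x * (\<integral>t. complex_of_real (g t) * cis (x * t))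
    = \<i> * (\<integral>t. complex_of_real (g' t) * cis (x * t))"
proof -
  define F where "F t = complex_of_real (g t) * cis (x * t)" for t
  define F' where "F' t = complex_of_real (g' t) * cis (x * t) + (\<i> * complex_of_real x) * F t" for t
  have cg: "continuous_on UNIV g" using DERIV_isCont[OF D] by (simp add: continuous_at_imp_continuous_on)
  have ccis: "continuous_on UNIV (\<lambda>t. cis (x * t))" by (intro continuous_on_cis continuous_intros)
  have cF: "continuous_on UNIV F" unfolding F_def by (intro continuous_on_mult continuous_on_of_real cg ccis)
  have cF': "continuous_on UNIV F'"
    unfolding F'_def by (intro continuous_on_add continuous_on_mult continuous_on_of_real continuous_on_const c' ccis cF)
  have dcis: "((\<lambda>t. cis (x * t)) has_vector_derivative \<i> * complex_of_real x * cis (x * t)) (at t)" for t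
  proof -
    have "((\<lambda>z. exp (\<i> * complex_of_real x * z)) has_field_derivative
        exp (\<i> * complex_of_real x * complex_of_real t) * (\<i> * complex_of_real x)) (at (complex_of_real t))"
      by (auto intro!: derivative_eq_intros)
    from has_vector_derivative_real_field[OF this] show ?thesis by (simp add: cis_conv_exp mult_ac)
  qed
  have dF: "(F has_vector_derivative F' t) (at t)" for t
  proof -
    have "((\<lambda>t. complex_of_real (g t)) has_vector_derivative complex_of_real (g' t)) (at t)"
      using D[of t] by (simp add: has_vector_derivative_of_real)
    from has_vector_derivative_mult[OF this dcis[of t]]
    show ?thesis by (simp add: F_def[abs_def] F'_def mult_ac add.commute)
  qed
  have ig: "integrable lborel F"
    unfolding F_def by (rule integrable_mult_bounded[where B=1]) (use g in \<open>auto simp: cis_linear_measurable mult.commute[of x]\<close>)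
  have ig': "integrable lborel (\<lambda>t. complex_of_real (g' t) * cis (x * t))"
    by (rule integrable_mult_bounded[where B=1]) (use g' in \<open>auto simp: cis_linear_measurable mult.commute[of x]\<close>)
  have iF': "integrable lborel F'" unfolding F'_def by (intro Bochner_Integration.integrable_add ig' integrable_mult_right ig)
  have int: "(\<integral>t. indicator {- real n..real n} t *\<^sub>R F' t) = F (real n) - F (- real n)" for n
  proof -
    have si: "set_integrable lborel {- real n..real n} F'"
      unfolding set_integrable_def by (intro borel_integrable_compact continuous_on_subset[OF cF']) auto
    have "(F' has_integral (F (real n) - F (- real n))) {- real n..real n}"
      by (rule fundamental_theorem_of_calculus) (auto intro: has_vector_derivative_at_within dF)
    then show ?thesis
      using set_borel_integral_eq_integral(2)[OF si] by (simp add: set_lebesgue_integral_def integral_unique)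
  qed
  have "(\<lambda>n. \<integral>t. indicator {- real n..real n} t *\<^sub>R F' t) \<longlonglongrightarrow> (\<integral>t. F' t)"
  proof (rule integral_dominated_convergence[where w="\<lambda>t. norm (F' t)"])
    have [measurable]: "F' \<in> borel_measurable borel" using iF' by auto
    show "F' \<in> borel_measurable lborel" by simp
    show "(\<lambda>t. indicator {- real n..real n} t *\<^sub>R F' t) \<in> borel_measurable lborel" for n by measurable
    show "integrable lborel (\<lambda>t. norm (F' t))" by (rule integrable_norm[OF iF'])
    show "AE t in lborel. norm (indicator {- real n..real n} t *\<^sub>R F' t) \<le> norm (F' t)" for n
      by (intro AE_I2) (auto simp: indicator_def)
    show "AE t in lborel. (\<lambda>n. indicator {- real n..real n} t *\<^sub>R F' t) \<longlonglongrightarrow> F' t"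
    proof (intro AE_I2 tendsto_eventually)
      fix t
      obtain N where N: "\<bar>t\<bar> \<le> real N" using real_arch_simple by blast
      show "\<forall>\<^sub>F n in sequentially. indicator {- real n..real n} t *\<^sub>R F' t = F' t"
        using eventually_ge_at_top[of N] by eventually_elim (use N in \<open>auto simp: indicator_def abs_le_iff\<close>)
    qed
  qed
  moreover have "(\<lambda>n. F (real n) - F (- real n)) \<longlonglongrightarrow> 0 - 0"
  proof (intro tendsto_diff)
    have *: "(\<lambda>n. F (s n)) \<longlonglongrightarrow> 0" if "(\<lambda>n. g (s n)) \<longlonglongrightarrow> 0" for s :: "nat \<Rightarrow> real"
    proof (rule tendsto_norm_zero_cancel)
      show "(\<lambda>n. norm (F (s n))) \<longlonglongrightarrow> 0" using tendsto_norm_zero[OF that] by (simp add: F_def norm_mult)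
    qed
    show "(\<lambda>n. F (real n)) \<longlonglongrightarrow> 0"
      by (intro * filterlim_compose[OF top] filterlim_real_sequentially)
    have "filterlim (\<lambda>n. - real n) at_bot sequentially"
      using filterlim_real_sequentially by (simp add: filterlim_uminus_at_top)
    then show "(\<lambda>n. F (- real n)) \<longlonglongrightarrow> 0"
      by (intro * filterlim_compose[OF bot])
  qed
  ultimately have "(\<integral>t. F' t) = 0" unfolding int using LIMSEQ_unique by fastforce
  moreover have "(\<integral>t. F' t) = (\<integral>t. complex_of_real (g' t) * cis (x * t)) + (\<i> * complex_of_real x) * (\<integral>t. F t)"
    unfolding F'_def using ig ig' by (simp add: integrable_mult_right)
  ultimately have "(\<integral>t. complex_of_real (g' t) * cis (x * t)) = - (\<i> * complex_of_real x) * (\<integral>t. F t)"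
    by (simp add: eq_neg_iff_add_eq_0)
  then show ?thesis by (simp add: F_def mult.assoc)
qed

text \<open>
  The first bound is used up to \<open>min h 1\<close>, the third beyond \<open>max (1 / h) 1\<close>; each contributes at most
  \<open>2\<close> on the half-line. The bound \<open>1 / \<bar>x\<bar>\<close> in between is the source of the logarithm.
\<close>

lemma nn_integral_kernel_log_bound:
  fixes k :: "real \<Rightarrow> complex"
  assumes h: "h > 0" and [measurable]: "k \<in> borel_measurable borel" and even: "\<And>x. norm (k (- x)) = norm (k x)"
    and b0: "\<And>x. norm (k x) \<le> 2 / h" and b1: "\<And>x. \<bar>x\<bar> * norm (k x) \<le> 1" and b2: "\<And>x. x\<^sup>2 * norm (k x) \<le> 2 / h"
  shows "L1_mass k \<le> ennreal (8 * (1 + \<bar>ln h\<bar>))"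
proof -
  \<comment> \<open>\<open>A\<close> and \<open>B\<close> are \<open>h\<close> and \<open>1 / h\<close> for small \<open>h\<close>, and both \<open>1\<close> for \<open>h \<ge> 1\<close>.\<close>
  define A B where "A = min h 1" and "B = max (1 / h) 1"
  have A: "A > 0" "A \<le> h" and B: "B \<ge> 1 / h" "B > 0" and AB: "A \<le> B" using h by (auto simp: A_def B_def)
  have lnAB: "ln B - ln A \<le> 2 * \<bar>ln h\<bar>"
    using h by (cases "h \<le> 1") (auto simp: A_def B_def min_def max_def ln_div divide_le_eq le_divide_eq abs_if)
  have i1: "(\<integral>\<^sup>+x. ennreal (2 / h) * indicator {0..A} x) \<le> ennreal 2"
  proof -
    have "(\<integral>\<^sup>+x. ennreal (2 / h) * indicator {0..A} x) = ennreal (2 / h) * ennreal A"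
      using A by (simp add: nn_integral_cmult_indicator)
    also have "\<dots> = ennreal (2 / h * A)" using h A by (intro ennreal_mult[symmetric]) auto
    also have "\<dots> \<le> ennreal 2" using A h by (intro ennreal_leI) (simp add: field_simps)
    finally show ?thesis .
  qed
  have i2: "(\<integral>\<^sup>+x. ennreal (1 / x) * indicator {A..B} x) \<le> ennreal (2 * \<bar>ln h\<bar>)"
  proof -
    have "(\<integral>\<^sup>+x. ennreal (1 / x) * indicator {A..B} x) = ennreal (ln B - ln A)"
    proof (rule nn_integral_FTC_Icc[OF _ _ _ AB])
      show "(ln has_real_derivative 1 / x) (at x)" if "x \<in> {A..B}" for x
        using that A by (intro DERIV_ln_divide) auto
    qed (use A in auto)
    also have "\<dots> \<le> ennreal (2 * \<bar>ln h\<bar>)" by (rule ennreal_leI[OF lnAB])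
    finally show ?thesis .
  qed
  have i3: "(\<integral>\<^sup>+x. ennreal (2 / h / x\<^sup>2) * indicator {B..} x) \<le> ennreal 2"
  proof -
    have "(\<integral>\<^sup>+x. ennreal (2 / h / x\<^sup>2) * indicator {B..} x) = ennreal (0 - (- (2 / h / B)))"
    proof (rule nn_integral_FTC_atLeast)
      show "((\<lambda>x. - (2 / h / x)) has_real_derivative 2 / h / x\<^sup>2) (at x)" if "B \<le> x" for x
        using that B h by (auto intro!: derivative_eq_intros simp: power2_eq_square)
      have "((\<lambda>x. - (2 / h) * inverse x) \<longlongrightarrow> - (2 / h) * 0) at_top"
        by (intro tendsto_mult tendsto_const tendsto_inverse_0_at_top filterlim_ident)
      then show "((\<lambda>x. - (2 / h / x)) \<longlongrightarrow> 0) at_top" by (simp add: divide_inverse)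
    qed (use h in auto)
    also have "\<dots> \<le> ennreal 2" using B h by (intro ennreal_leI) (simp add: field_simps)
    finally show ?thesis .
  qed
  have half: "(\<integral>\<^sup>+x. ennreal (norm (k x)) * indicator {0..} x) \<le> ennreal (4 * (1 + \<bar>ln h\<bar>))"
  proof -
    have "(\<integral>\<^sup>+x. ennreal (norm (k x)) * indicator {0..} x)
      \<le> (\<integral>\<^sup>+x. (ennreal (2 / h) * indicator {0..A} x + ennreal (1 / x) * indicator {A..B} x) + ennreal (2 / h / x\<^sup>2) * indicator {B..} x)"
    proof (intro nn_integral_mono)
      fix x :: real
      consider "x < 0" | "0 \<le> x" "x \<le> A" | "A \<le> x" "x \<le> B" | "B \<le> x" by linarith
      then show "ennreal (norm (k x)) * indicator {0..} x
        \<le> (ennreal (2 / h) * indicator {0..A} x + ennreal (1 / x) * indicator {A..B} x) + ennreal (2 / h / x\<^sup>2) * indicator {B..} x"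
      proof cases
        case 2
        then have "ennreal (norm (k x)) * indicator {0..} x \<le> ennreal (2 / h) * indicator {0..A} x"
          using b0[of x] by (auto simp: ennreal_leI)
        then show ?thesis by (intro add_increasing2) auto
      next
        case 3
        then have "norm (k x) \<le> 1 / x" using b1[of x] A by (simp add: field_simps)
        then have "ennreal (norm (k x)) * indicator {0..} x \<le> ennreal (1 / x) * indicator {A..B} x"
          using 3 by (auto simp: indicator_def intro: ennreal_leI)
        then show ?thesis by (intro add_increasing2 add_increasing) auto
      next
        case 4
        then have "x > 0" using B by linarith
        then have "norm (k x) \<le> 2 / h / x\<^sup>2" using b2[of x] h by (simp add: field_simps)
        then have "ennreal (norm (k x)) * indicator {0..} x \<le> ennreal (2 / h / x\<^sup>2) * indicator {B..} x"
          using 4 by (auto simp: indicator_def intro: ennreal_leI)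
        then show ?thesis by (intro add_increasing) auto
      qed auto
    qed
    also have "\<dots> = (\<integral>\<^sup>+x. ennreal (2 / h) * indicator {0..A} x) + (\<integral>\<^sup>+x. ennreal (1 / x) * indicator {A..B} x)
        + (\<integral>\<^sup>+x. ennreal (2 / h / x\<^sup>2) * indicator {B..} x)"
    proof -
      have [measurable]: "(\<lambda>x. ennreal (2 / h) * indicator {0..A} x) \<in> borel_measurable lborel"
        "(\<lambda>x. ennreal (1 / x) * indicator {A..B} x) \<in> borel_measurable lborel"
        "(\<lambda>x. ennreal (2 / h / x\<^sup>2) * indicator {B..} x) \<in> borel_measurable lborel" by measurable
      show ?thesis by (simp add: nn_integral_add)
    qed
    also have "\<dots> \<le> ennreal 2 + ennreal (2 * \<bar>ln h\<bar>) + ennreal 2"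
      by (intro add_mono i1 i2 i3)
    also have "\<dots> = ennreal (2 + 2 * \<bar>ln h\<bar> + 2)" by (simp add: ennreal_plus)
    also have "\<dots> \<le> ennreal (4 * (1 + \<bar>ln h\<bar>))" by (intro ennreal_leI) simp
    finally show ?thesis .
  qed
  have "L1_mass k = 2 * (\<integral>\<^sup>+x. ennreal (norm (k x)) * indicator {0..} x)"
    by (rule nn_integral_even) (auto simp: even)
  also have "\<dots> \<le> 2 * ennreal (4 * (1 + \<bar>ln h\<bar>))" by (intro mult_left_mono half) simp
  also have "\<dots> = ennreal (2 * (4 * (1 + \<bar>ln h\<bar>)))" by (subst ennreal_mult') auto
  finally show ?thesis by simp
qed

section \<open>The one-dimensional kernel\<close>

definition theta_kernel :: "real \<Rightarrow> real \<Rightarrow> complex" where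
  "theta_kernel b = inv_fourier (\<lambda>x. complex_of_real (gauss_ratio b x))"

lemma integral_abs_le_of_nn_integral:
  fixes f :: "real \<Rightarrow> real"
  assumes [measurable]: "f \<in> borel_measurable borel" and le: "(\<integral>\<^sup>+x. ennreal \<bar>f x\<bar>) \<le> ennreal V" and V: "V \<ge> 0"
  shows "integrable lborel f" "(\<integral>x. \<bar>f x\<bar>) \<le> V"
proof -
  show i: "integrable lborel f"
    using le_less_trans[OF le] by (intro integrableI_bounded) auto
  then have "ennreal (\<integral>x. \<bar>f x\<bar>) \<le> ennreal V"
    using le by (subst (asm) nn_integral_eq_integral) auto
  then show "(\<integral>x. \<bar>f x\<bar>) \<le> V" using V by simp
qed

context
  fixes b :: real
  assumes b: "b > 0"
begin

lemma gauss_ratio_integrable: "integrable lborel (gauss_ratio b)" "(\<integral>x. \<bar>gauss_ratio b x\<bar>) \<le> 4 * b"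
  using integral_abs_le_of_nn_integral[OF gauss_ratio_measurable[OF b] nn_integral_gauss_ratio[OF b]] b by auto

lemma gauss_ratio1_integrable: "integrable lborel (gauss_ratio1 b)" "(\<integral>x. \<bar>gauss_ratio1 b x\<bar>) \<le> 2"
  using integral_abs_le_of_nn_integral[OF gauss_ratio1_measurable[OF b] nn_integral_gauss_ratio1[OF b]] by auto

lemma gauss_ratio2_integrable: "integrable lborel (gauss_ratio2 b)" "(\<integral>x. \<bar>gauss_ratio2 b x\<bar>) \<le> 4 * b"
  using integral_abs_le_of_nn_integral[OF gauss_ratio2_measurable[OF b] nn_integral_gauss_ratio2[OF b]] b by auto

lemma theta_kernel_eq: "theta_kernel b x = complex_of_real (1 / (2 * pi)) * (\<integral>t. complex_of_real (gauss_ratio b t) * cis (x * t))"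
  by (simp add: theta_kernel_def inv_fourier_def)

lemma theta_kernel_even: "theta_kernel b (- x) = theta_kernel b x"
proof -
  have "(\<lambda>t. complex_of_real (gauss_ratio b t) * cis (x * t)) \<in> borel_measurable borel"
    by (intro borel_measurable_continuous_onI continuous_on_mult continuous_on_of_real gauss_ratio_continuous b continuous_on_cis continuous_intros)
  from integral_reflect_euclidean[OF this, of 0]
  show ?thesis by (simp add: theta_kernel_eq gauss_ratio_even[OF b])
qed

lemma theta_kernel_mult_arg:
  "complex_of_real x * theta_kernel b x = (\<integral>t. (\<i> * complex_of_real (1 / (2 * pi)) * complex_of_real (gauss_ratio1 b t)) * cis (x * t))"
proof -
  have bot: "(gauss_ratio b \<longlongrightarrow> 0) at_bot"
    unfolding filterlim_at_bot_mirror using gauss_ratio_tendsto(1)[OF b] by (simp add: gauss_ratio_even[OF b])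
  have *: "complex_of_real x * (\<integral>t. complex_of_real (gauss_ratio b t) * cis (x * t))
    = \<i> * (\<integral>t. complex_of_real (gauss_ratio1 b t) * cis (x * t))"
    by (rule integral_by_parts_cis[OF gauss_ratio_deriv[OF b] gauss_ratio1_continuous[OF b] gauss_ratio_integrable(1)
        gauss_ratio1_integrable(1) gauss_ratio_tendsto(1)[OF b] bot])
  have "complex_of_real x * theta_kernel b x
    = complex_of_real (1 / (2 * pi)) * (complex_of_real x * (\<integral>t. complex_of_real (gauss_ratio b t) * cis (x * t)))"
    by (simp add: theta_kernel_eq)
  also have "\<dots> = (\<i> * complex_of_real (1 / (2 * pi))) * (\<integral>t. complex_of_real (gauss_ratio1 b t) * cis (x * t))"
    unfolding * by simp
  also have "\<dots> = (\<integral>t. (\<i> * complex_of_real (1 / (2 * pi)) * complex_of_real (gauss_ratio1 b t)) * cis (x * t))"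
    by (simp only: integral_mult_right_zero[symmetric] mult.assoc)
  finally show ?thesis .
qed

lemma norm_integral_cis_le: "norm (\<integral>t. complex_of_real (f t) * cis (x * t)) \<le> (\<integral>t. \<bar>f t\<bar>)"
  by (rule order_trans[OF integral_norm_bound]) (simp add: norm_mult)

lemma norm_theta_kernel_le: "norm (theta_kernel b x) \<le> 4 * b / (2 * pi)"
proof -
  have "norm (theta_kernel b x) = 1 / (2 * pi) * norm (\<integral>t. complex_of_real (gauss_ratio b t) * cis (x * t))"
    unfolding theta_kernel_eq norm_mult norm_of_real by simp
  also have "\<dots> \<le> 1 / (2 * pi) * (4 * b)"
    by (intro mult_left_mono order_trans[OF norm_integral_cis_le gauss_ratio_integrable(2)]) simp
  finally show ?thesis by simp
qed

lemma norm_mult_theta_kernel_le: "\<bar>x\<bar> * norm (theta_kernel b x) \<le> 1"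
proof -
  have "\<bar>x\<bar> * norm (theta_kernel b x) = norm (complex_of_real x * theta_kernel b x)" by (simp add: norm_mult)
  also have "\<dots> = norm ((\<i> * complex_of_real (1 / (2 * pi))) * (\<integral>t. complex_of_real (gauss_ratio1 b t) * cis (x * t)))"
    unfolding theta_kernel_mult_arg by (simp only: integral_mult_right_zero[symmetric] mult.assoc)
  also have "\<dots> = 1 / (2 * pi) * norm (\<integral>t. complex_of_real (gauss_ratio1 b t) * cis (x * t))"
    unfolding norm_mult norm_of_real by simp
  also have "\<dots> \<le> 1 / (2 * pi) * 2"
    by (intro mult_left_mono order_trans[OF norm_integral_cis_le gauss_ratio1_integrable(2)]) simp
  also have "\<dots> \<le> 1" using pi_gt3 by simp
  finally show ?thesis .
qed

lemma norm_square_mult_theta_kernel_le: "x\<^sup>2 * norm (theta_kernel b x) \<le> 4 * b / (2 * pi)"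
proof -
  have bot: "(gauss_ratio1 b \<longlongrightarrow> 0) at_bot"
    unfolding filterlim_at_bot_mirror using tendsto_minus[OF gauss_ratio_tendsto(2)[OF b]] by (simp add: gauss_ratio1_odd[OF b])
  have *: "complex_of_real x * (\<integral>t. complex_of_real (gauss_ratio1 b t) * cis (x * t))
    = \<i> * (\<integral>t. complex_of_real (gauss_ratio2 b t) * cis (x * t))"
    by (rule integral_by_parts_cis[OF gauss_ratio1_deriv[OF b] gauss_ratio2_continuous[OF b] gauss_ratio1_integrable(1)
        gauss_ratio2_integrable(1) gauss_ratio_tendsto(2)[OF b] bot])
  have "x\<^sup>2 * norm (theta_kernel b x) = norm (complex_of_real x * (complex_of_real x * theta_kernel b x))"
    by (simp add: norm_mult power2_eq_square mult.assoc[symmetric] abs_mult[symmetric])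
  also have "complex_of_real x * (complex_of_real x * theta_kernel b x)
    = (\<i> * complex_of_real (1 / (2 * pi))) * (complex_of_real x * (\<integral>t. complex_of_real (gauss_ratio1 b t) * cis (x * t)))"
    unfolding theta_kernel_mult_arg by (simp only: integral_mult_right_zero[symmetric] mult_ac)
  also have "norm \<dots> = 1 / (2 * pi) * norm (\<integral>t. complex_of_real (gauss_ratio2 b t) * cis (x * t))"
    unfolding * norm_mult norm_of_real by simp
  also have "\<dots> \<le> 1 / (2 * pi) * (4 * b)"
    by (intro mult_left_mono order_trans[OF norm_integral_cis_le gauss_ratio2_integrable(2)]) simp
  finally show ?thesis by simp
qed

lemma theta_kernel_measurable [measurable]: "theta_kernel b \<in> borel_measurable borel"
proof -
  have "isCont (theta_kernel b) x" for x
    unfolding theta_kernel_def by (rule isCont_inv_fourier) (use gauss_ratio_integrable(1) in simp)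
  then show ?thesis by (intro borel_measurable_continuous_onI) (simp add: continuous_at_imp_continuous_on)
qed

end

lemma nn_integral_theta_kernel:
  assumes h: "h > 0"
  shows "L1_mass (\<lambda>x. theta_kernel (pi / h) x) \<le> ennreal (8 * (1 + \<bar>ln h\<bar>))"
proof (rule nn_integral_kernel_log_bound[OF h])
  have b: "pi / h > 0" using h by simp
  have c: "4 * (pi / h) / (2 * pi) = 2 / h" using h by simp
  show "theta_kernel (pi / h) \<in> borel_measurable borel" by (rule theta_kernel_measurable[OF b])
  fix x
  show "norm (theta_kernel (pi / h) (- x)) = norm (theta_kernel (pi / h) x)" by (simp add: theta_kernel_even[OF b])
  show "norm (theta_kernel (pi / h) x) \<le> 2 / h" using norm_theta_kernel_le[OF b] unfolding c .
  show "\<bar>x\<bar> * norm (theta_kernel (pi / h) x) \<le> 1" by (rule norm_mult_theta_kernel_le[OF b])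
  show "x\<^sup>2 * norm (theta_kernel (pi / h) x) \<le> 2 / h" using norm_square_mult_theta_kernel_le[OF b] unfolding c .
qed

lemma theta_kernel_integrable:
  assumes h: "h > 0"
  shows "integrable lborel (theta_kernel (pi / h))"
  using le_less_trans[OF nn_integral_theta_kernel[OF h]] theta_kernel_measurable[of "pi / h"] h
  by (intro integrableI_bounded) auto

text \<open>
  The multiplier is unimodal with maximum at most \<open>1\<close>, so its variation is at most \<open>2\<close> for every \<open>h\<close>.
  This is why the bounds for \<open>1 < p < \<infinity>\<close> are uniform.
\<close>

lemma bv_kernel_theta_kernel:
  assumes h: "h > 0"
  shows "bv_kernel 1 (theta_kernel (pi / h))"
  unfolding bv_kernel_def
proof (intro conjI allI exI)
  have b: "pi / h > 0" using h by simp
  let ?\<phi> = "\<lambda>t. \<i> * complex_of_real (1 / (2 * pi)) * complex_of_real (gauss_ratio1 (pi / h) t)"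
  show "theta_kernel (pi / h) \<in> borel_measurable borel" by (rule theta_kernel_measurable[OF b])
  show "bounded (range (theta_kernel (pi / h)))"
    unfolding bounded_iff using norm_theta_kernel_le[OF b] by blast
  show "theta_kernel (pi / h) (- s) = theta_kernel (pi / h) s" for s by (rule theta_kernel_even[OF b])
  show "integrable lborel ?\<phi>"
    using gauss_ratio1_integrable(1)[OF b] by (intro integrable_mult_right) simp
  have "(\<integral>t. norm (?\<phi> t)) = 1 / (2 * pi) * (\<integral>t. \<bar>gauss_ratio1 (pi / h) t\<bar>)"
    unfolding norm_mult norm_of_real by simp
  also have "\<dots> \<le> 1 / (2 * pi) * 2" by (intro mult_left_mono gauss_ratio1_integrable(2)[OF b]) simp
  also have "\<dots> \<le> 1" using pi_gt3 by simp
  finally show "(\<integral>t. norm (?\<phi> t)) \<le> 1" .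
  show "complex_of_real s * theta_kernel (pi / h) s = (\<integral>t. ?\<phi> t * cis (s * t))" for s
    by (rule theta_kernel_mult_arg[OF b])
qed

lemma inv_fourier_prod_Basis:
  fixes m1 :: "real \<Rightarrow> complex"
  assumes m1: "integrable lborel m1"
  shows "inv_fourier (\<lambda>\<xi>::'a::euclidean_space. \<Prod>b\<in>Basis. m1 (\<xi> \<bullet> b)) x = (\<Prod>b\<in>Basis. inv_fourier m1 (x \<bullet> b))"
proof -
  have cis_prod: "cis (x \<bullet> \<xi>) = (\<Prod>b\<in>Basis. cis ((x \<bullet> b) * (\<xi> \<bullet> b)))" for \<xi> :: 'a
    unfolding cis_conv_exp euclidean_inner[of x \<xi>] by (simp add: sum_distrib_left exp_sum)
  have i: "integrable lborel (\<lambda>t. m1 t * cis (y * t))" for y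
    by (rule integrable_mult_bounded[OF m1, where B=1]) (auto simp: cis_linear_measurable mult.commute[of y])
  have "(\<integral>\<xi>. (\<Prod>b\<in>Basis. m1 (\<xi> \<bullet> b)) * cis (x \<bullet> \<xi>)) = (\<integral>\<xi>. (\<Prod>b\<in>Basis. m1 (\<xi> \<bullet> b) * cis ((x \<bullet> b) * (\<xi> \<bullet> b))))"
    by (simp add: cis_prod prod.distrib)
  also have "\<dots> = (\<Prod>b\<in>Basis. \<integral>t. m1 t * cis ((x \<bullet> b) * t))"
    by (rule integral_prod_Basis[of "\<lambda>b t. m1 t * cis ((x \<bullet> b) * t)"]) (rule i)
  finally show ?thesis
    by (simp add: inv_fourier_def prod.distrib power_divide prod_dividef)
qed

section \<open>The Gaussian multiplier\<close>

lemma prod_Basis_vec: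
  fixes F :: "real \<Rightarrow> complex" and x :: "real ^ 'n"
  shows "(\<Prod>b\<in>Basis. F (x \<bullet> b)) = (\<Prod>i\<in>UNIV. F (x $ i))"
proof -
  have B: "(Basis :: (real ^ 'n) set) = range (\<lambda>i. axis i 1)" by (auto simp: Basis_vec_def)
  show ?thesis unfolding B by (subst prod.reindex) (auto simp: inj_on_def axis_eq_axis inner_axis)
qed

text \<open>
  Expanding the square in the exponent separates the factor that does not depend on \<open>j\<close>.
\<close>

lemma gauss_lattice_sum:
  assumes h: "h > 0"
  shows "((\<lambda>j::int. exp (- (1 / 4) * (t - 2 * pi * real_of_int j / h)\<^sup>2)) has_sum (exp (- (1 / 4) * t\<^sup>2) * theta (pi / h) (pi / h * t))) UNIV"
proof -
  have b: "pi / h > 0" using h by simp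
  have "exp (- (1 / 4) * t\<^sup>2) * exp (real_of_int j * (pi / h * t) - (pi / h)\<^sup>2 * (real_of_int j)\<^sup>2)
    = exp (- (1 / 4) * (t - 2 * pi * real_of_int j / h)\<^sup>2)" for j
    using h by (simp add: mult_exp_exp power2_eq_square field_simps)
  then show ?thesis using has_sum_cmult_right[OF theta_has_sum[OF b, of "pi / h * t"], of "exp (- (1 / 4) * t\<^sup>2)"] by simp
qed

text \<open>
  The lattice sum factorises over the coordinates, and the Gaussian in the numerator cancels.
\<close>

lemma gauss_multiplier_eq_prod:
  fixes \<xi> :: "real ^ 'n"
  assumes h: "h > 0"
  shows "gauss_multiplier h \<xi> = (\<Prod>b\<in>Basis. complex_of_real (gauss_ratio (pi / h) (\<xi> \<bullet> b)))"
proof -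
  have b: "pi / h > 0" using h by simp
  define f where "f i j = exp (- (1 / 4) * (\<xi> $ i - 2 * pi * real_of_int j / h)\<^sup>2)" for i and j :: int
  have norm2: "(norm v)\<^sup>2 = (\<Sum>i\<in>UNIV. (v $ i)\<^sup>2)" for v :: "real ^ 'n"
    unfolding power2_norm_eq_inner inner_vec_def by (simp add: power2_eq_square)
  have exp_norm: "exp (- (1 / 4) * (norm v)\<^sup>2) = (\<Prod>i\<in>UNIV. exp (- (1 / 4) * (v $ i)\<^sup>2))" for v :: "real ^ 'n"
    unfolding norm2 by (simp add: sum_distrib_left exp_sum[symmetric] sum_negf)
  have fs: "(f i has_sum (exp (- (1 / 4) * (\<xi> $ i)\<^sup>2) * theta (pi / h) (pi / h * \<xi> $ i))) UNIV" for i
    unfolding f_def by (rule gauss_lattice_sum[OF h])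
  have "(\<Sum>\<^sub>\<infinity>j\<in>(UNIV :: (int ^ 'n) set). exp (- (1 / 4) * (norm (\<xi> - (\<chi> i. 2 * pi * real_of_int (j $ i) / h)))\<^sup>2))
    = (\<Sum>\<^sub>\<infinity>j\<in>(UNIV :: (int ^ 'n) set). (\<Prod>i\<in>UNIV. f i (vec_nth j i)))"
    unfolding exp_norm f_def by simp
  also have "\<dots> = (\<Sum>\<^sub>\<infinity>g\<in>UNIV. (\<Prod>i\<in>UNIV. f i (g i)))"
  proof (rule infsum_reindex_bij_betw)
    show "bij_betw vec_nth (UNIV :: (int ^ 'n) set) UNIV"
      by (rule bij_betwI[of _ _ _ vec_lambda]) auto
  qed
  also have "\<dots> = (\<Sum>\<^sub>\<infinity>g\<in>PiE UNIV (\<lambda>_. UNIV). (\<Prod>i\<in>UNIV. f i (g i)))" by (simp add: PiE_UNIV_domain)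
  also have "\<dots> = (\<Prod>i\<in>UNIV. infsum (f i) UNIV)"
  proof (rule infsum_prod_PiE_abs)
    have "(\<lambda>j. norm (f i j)) = f i" for i by (rule ext) (simp add: f_def)
    then show "(\<lambda>j. norm (f i j)) summable_on UNIV" for i
      using has_sum_imp_summable[OF fs[of i]] by simp
  qed simp
  also have "\<dots> = (\<Prod>i\<in>UNIV. exp (- (1 / 4) * (\<xi> $ i)\<^sup>2) * theta (pi / h) (pi / h * \<xi> $ i))"
    using infsumI[OF fs] by simp
  finally have den: "(\<Sum>\<^sub>\<infinity>j\<in>(UNIV :: (int ^ 'n) set). exp (- (1 / 4) * (norm (\<xi> - (\<chi> i. 2 * pi * real_of_int (j $ i) / h)))\<^sup>2))
    = (\<Prod>i\<in>UNIV. exp (- (1 / 4) * (\<xi> $ i)\<^sup>2)) * (\<Prod>i\<in>UNIV. theta (pi / h) (pi / h * \<xi> $ i))"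
    by (simp only: prod.distrib)
  have "(\<Prod>i\<in>UNIV. exp (- (1 / 4) * (\<xi> $ i)\<^sup>2)) > 0" by (intro prod_pos) simp
  then have "gauss_multiplier h \<xi> = complex_of_real (1 / (\<Prod>i\<in>UNIV. theta (pi / h) (pi / h * \<xi> $ i)))"
    unfolding gauss_multiplier_def den unfolding exp_norm by simp
  also have "\<dots> = (\<Prod>i\<in>UNIV. complex_of_real (gauss_ratio (pi / h) (\<xi> $ i)))"
    unfolding of_real_prod[symmetric] by (simp add: gauss_ratio_def[OF b] recip_theta_def[OF b] prod_dividef)
  also have "\<dots> = (\<Prod>b\<in>Basis. complex_of_real (gauss_ratio (pi / h) (\<xi> \<bullet> b)))"
    by (rule prod_Basis_vec[symmetric])
  finally show ?thesis .
qed

theorem lemma4p2: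
  shows "(\<forall>p::ennreal. 1 < p \<and> p < \<infinity> \<longrightarrow>
            (\<exists>C::real. \<forall>h::real. h > 0 \<longrightarrow>
               multiplier_norm p (gauss_multiplier h :: real ^ 'n \<Rightarrow> complex) \<le> ennreal C)) \<and>
         (\<exists>C::real. \<forall>h::real. h > 0 \<longrightarrow>
            multiplier_norm 1 (gauss_multiplier h :: real ^ 'n \<Rightarrow> complex)
              = multiplier_norm \<infinity> (gauss_multiplier h :: real ^ 'n \<Rightarrow> complex) \<and>
            multiplier_norm \<infinity> (gauss_multiplier h :: real ^ 'n \<Rightarrow> complex)
              \<le> ennreal (C * (1 + \<bar>ln h\<bar>) ^ CARD('n)))"
proof -
  let ?m = "\<lambda>h. gauss_multiplier h :: real ^ 'n \<Rightarrow> complex"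
  have m_eq: "?m h = (\<lambda>\<xi>. \<Prod>b\<in>Basis. complex_of_real (gauss_ratio (pi / h) (\<xi> \<bullet> b)))" if "h > 0" for h
    using gauss_multiplier_eq_prod[OF that] by (rule ext)
  have rt: "integrable lborel (\<lambda>x. complex_of_real (gauss_ratio (pi / h) x))" if "h > 0" for h
    using gauss_ratio_integrable(1)[of "pi / h"] that by simp
  have m_int: "integrable lborel (?m h)" if "h > 0" for h
    unfolding m_eq[OF that] by (rule integrable_prod_Basis) (rule rt[OF that])
  have K_eq: "inv_fourier (?m h) = (\<lambda>x. \<Prod>b\<in>Basis. theta_kernel (pi / h) (x \<bullet> b))" if "h > 0" for h
    unfolding m_eq[OF that] theta_kernel_def by (rule ext, rule inv_fourier_prod_Basis[OF rt[OF that]])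
  have K_int: "integrable lborel (inv_fourier (?m h))" if "h > 0" for h
    unfolding K_eq[OF that] by (rule integrable_prod_Basis) (rule theta_kernel_integrable[OF that])
  have K_even: "inv_fourier (?m h) (- x) = inv_fourier (?m h) x" if "h > 0" for h x
    using theta_kernel_even[of "pi / h"] that unfolding K_eq[OF that] by simp
  have part1: "\<exists>C::real. \<forall>h::real. h > 0 \<longrightarrow> multiplier_norm p (?m h) \<le> ennreal C" if p: "1 < p" "p < \<infinity>" for p
  proof -
    define P where "P = enn2real p"
    have P: "P > 1"
    proof -
      have "ennreal 1 < ennreal P" using p by (simp add: P_def ennreal_enn2real)
      then show ?thesis by (simp add: ennreal_less_iff del: ennreal_1)
    qed
    obtain C where C: "C \<ge> 0" and kb: "\<And>h. h > 0 \<Longrightarrow> Lp_kernel_bound P C (theta_kernel (pi / h))"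
      using bv_kernel_Lp_bound[OF P zero_le_one] bv_kernel_theta_kernel theta_kernel_integrable by metis
    have "multiplier_norm p (?m h) \<le> ennreal ((C ^ CARD('n)) powr (1 / P))" if h: "h > 0" for h
      unfolding P_def
    proof (rule multiplier_norm_le_of_convol_bound[OF m_int[OF h] K_int[OF h] p])
      show "0 \<le> C ^ CARD('n)" using C by simp
      fix F :: "real ^ 'n \<Rightarrow> complex" assume F: "F \<in> borel_measurable borel" "bounded (range F)"
      have [measurable]: "F \<in> borel_measurable borel" "inv_fourier (?m h) \<in> borel_measurable borel"
        using F K_int[OF h] by auto
      have "convol (inv_fourier (?m h)) F x = (\<integral>s. (\<Prod>b\<in>Basis. theta_kernel (pi / h) (s \<bullet> b)) * F (x - s))" for x
      proof -
        have "(\<lambda>s. inv_fourier (?m h) s * F (x - s)) \<in> borel_measurable borel" by measurable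
        from integral_reflect_euclidean[OF this, of x] show ?thesis by (simp add: convol_def K_eq[OF h])
      qed
      then show "Lp_mass (enn2real p) (\<lambda>x. convol (inv_fourier (?m h)) F x)
        \<le> ennreal (C ^ CARD('n)) * Lp_mass (enn2real p) F"
        using tensor_kernel_Lp_bound[OF kb[OF h] theta_kernel_integrable[OF h] C F] by (simp add: P_def)
    qed
    then show ?thesis by blast
  qed
  have norm_eq: "multiplier_norm \<infinity> (?m h) = L1_mass (inv_fourier (?m h))"
    "multiplier_norm 1 (?m h) = L1_mass (inv_fourier (?m h))" if h: "h > 0" for h
    by (intro antisym multiplier_norm_inf_le multiplier_norm_inf_ge multiplier_norm_1_le multiplier_norm_1_ge
        m_int[OF h] K_int[OF h] K_even[OF h])+
  have L1: "L1_mass (inv_fourier (?m h)) \<le> ennreal (8 ^ CARD('n) * (1 + \<bar>ln h\<bar>) ^ CARD('n))" if h: "h > 0" for h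
  proof -
    have [measurable]: "theta_kernel (pi / h) \<in> borel_measurable borel" using h by (simp add: theta_kernel_measurable)
    have "L1_mass (inv_fourier (?m h)) = (\<integral>\<^sup>+x. (\<Prod>b\<in>Basis. ennreal (norm (theta_kernel (pi / h) (x \<bullet> b)))) \<partial>(lborel :: (real ^ 'n) measure))"
      unfolding K_eq[OF h] by (simp add: prod_norm[symmetric] prod_ennreal)
    also have "\<dots> = (\<Prod>b\<in>(Basis :: (real ^ 'n) set). \<integral>\<^sup>+x. ennreal (norm (theta_kernel (pi / h) x)))"
      by (rule nn_integral_lborel_prod) auto
    also have "\<dots> = L1_mass (\<lambda>x. theta_kernel (pi / h) x) ^ CARD('n)" by simp
    also have "\<dots> \<le> ennreal (8 * (1 + \<bar>ln h\<bar>)) ^ CARD('n)"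
      by (intro power_mono nn_integral_theta_kernel h) simp
    also have "\<dots> = ennreal (8 ^ CARD('n) * (1 + \<bar>ln h\<bar>) ^ CARD('n))"
      unfolding power_mult_distrib[symmetric] by (rule ennreal_power) simp
    finally show ?thesis .
  qed
  show ?thesis
  proof (intro conjI)
    show "\<forall>p::ennreal. 1 < p \<and> p < \<infinity> \<longrightarrow> (\<exists>C::real. \<forall>h::real. h > 0 \<longrightarrow> multiplier_norm p (?m h) \<le> ennreal C)"
      using part1 by blast
    show "\<exists>C::real. \<forall>h::real. h > 0 \<longrightarrow> multiplier_norm 1 (?m h) = multiplier_norm \<infinity> (?m h) \<and>
            multiplier_norm \<infinity> (?m h) \<le> ennreal (C * (1 + \<bar>ln h\<bar>) ^ CARD('n))"
      using norm_eq L1 by (intro exI[of _ "8 ^ CARD('n)"]) auto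
  qed
qed

end
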